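(* Assume the conditional density condition (i)–(iii) below holds and $\|f_0\|_\infty\le M_0$ for some $M_0\ge1$. Let $L_q,N_q\ge 3$ be integers, $\mathcal F_n=\mathcal F_{\rm DNN}(d,L_q,N_q,M_0)$, $\delta_{\rm a}=\inf_{f\in\mathcal F_n}\|f-f_0\|_2$ and $\delta_{\rm s}=L_qN_q\sqrt{d\log(dL_qN_q)\log n/n}$. Then there is a constant $c_4>0$ not depending on $(N_q,L_q,n,d,\alpha)$ or on $f_0$ (it depends only on $M_0,\bar p,\underline p,l_0$) such that for every $u\ge1$, any DQR estimator $\hat f_n$ satisfies $$\mathbb P\Big\{\|\hat f_n-f_0\|_2\ge c_4\big(\delta_{\rm s}+\delta_{\rm a}+\sqrt{u/n}\big)\Big\}\le Ce^{-u}$$ for an absolute constant $C>0$.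
   Context: Let $(Y,X)\in\mathbb R\times[0,1]^d$ with $X\sim P_X$, and let $(Y_i,X_i)$, $i=1,\dots,n$ ($n\ge3$), be i.i.d. copies. Fix $\alpha\in(0,1)$; $f_0$ satisfies $\mathbb P(Y\le f_0(X)\mid X=x)=\alpha$. Let $\epsilon=Y-f_0(X)$. For $h:[0,1]^d\to\mathbb R$, $\|h\|_q=(\mathbb E|h(X)|^q)^{1/q}$, $X\sim P_X$. Networks: $\mathcal F_{\rm DNN}(d,L,N)$ is the class of functions $\mathcal L_{L+1}\circ\sigma\circ\mathcal L_L\circ\cdots\circ\sigma\circ\mathcal L_1:\mathbb R^d\to\mathbb R$ with $\sigma(u)=\max(u,0)$ coordinatewise and affine maps $\mathcal L_k(x)=W_kx+b_k$ with arbitrary real weights, layer widths $(d,N,\dots,N,1)$ ($L$ hidden layers); $\mathcal F_{\rm DNN}(d,L,N,M)=\{T_Mh\}$ with $T_Mh=\mathrm{sgn}(h)\min(|h|,M)$. Check loss $\rho_\alpha(u)=\{\alpha-\mathbb 1(u<0)\}u$. The DQR estimator is any $\hat f_n\in\operatorname{argmin}_{f\in\mathcal F_n}n^{-1}\sum_{i=1}^n\rho_\alpha(Y_i-f(X_i))$. Conditional density condition: (i) the conditional density $p_{\epsilon|X}$ of $\epsilon$ given $X$ exists, is continuous and satisfies $\sup_u p_{\epsilon|X}(u)\le\bar p$ a.s.; (ii) $p_{\epsilon|X}(0)\ge\underline p>0$ a.s.; (iii) $|p_{\epsilon|X}(u_1)-p_{\epsilon|X}(u_2)|\le l_0|u_1-u_2|$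 for all $u_1,u_2$ a.s. *)

theory Defs
  imports "HOL-Probability.Probability"
begin

text \<open>Inputs x in [0,1]^d are represented as elements of PiE {..<d} (lambda _. UNIV),
  i.e. functions nat => real (only coordinates j < d matter).\<close>

definition unit_cube :: "nat \<Rightarrow> (nat \<Rightarrow> real) set" where
  "unit_cube d = PiE {..<d} (\<lambda>_. {0..1})"

definition check_loss :: "real \<Rightarrow> real \<Rightarrow> real" where
  "check_loss \<alpha> u = (\<alpha> - (if u < 0 then 1 else 0)) * u"

definition trunc :: "real \<Rightarrow> real \<Rightarrow> real" where
  "trunc M h = sgn h * min \<bar>h\<bar> M"

definition layer_in_dim :: "nat \<Rightarrow> nat \<Rightarrow> nat \<Rightarrow> nat" where
  "layer_in_dim d N k = (if k = 0 then d else N)"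

text \<open>Hidden activations after k hidden layers; W k i j and b k i are the weights/biases
  of the affine map L_k (arbitrary reals; only the entries within the widths are used).\<close>
fun dnn_hidden :: "nat \<Rightarrow> nat \<Rightarrow> (nat \<Rightarrow> nat \<Rightarrow> nat \<Rightarrow> real) \<Rightarrow> (nat \<Rightarrow> nat \<Rightarrow> real)
    \<Rightarrow> (nat \<Rightarrow> real) \<Rightarrow> nat \<Rightarrow> nat \<Rightarrow> real" where
  "dnn_hidden d N W b x 0 = x"
| "dnn_hidden d N W b x (Suc k) =
     (\<lambda>i. if i < N
          then max 0 ((\<Sum>j<layer_in_dim d N k. W (Suc k) i j * dnn_hidden d N W b x k j) + b (Suc k) i)
          else 0)"

definition dnn_eval :: "nat \<Rightarrow> nat \<Rightarrow> nat \<Rightarrow> (nat \<Rightarrow> nat \<Rightarrow> nat \<Rightarrow> real) \<Rightarrow> (nat \<Rightarrow> nat \<Rightarrow> real)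
    \<Rightarrow> (nat \<Rightarrow> real) \<Rightarrow> real" where
  "dnn_eval d L N W b x =
     (\<Sum>j<layer_in_dim d N L. W (Suc L) 0 j * dnn_hidden d N W b x L j) + b (Suc L) 0"

definition F_DNN :: "nat \<Rightarrow> nat \<Rightarrow> nat \<Rightarrow> ((nat \<Rightarrow> real) \<Rightarrow> real) set" where
  "F_DNN d L N = {f. \<exists>W b. f = dnn_eval d L N W b}"

definition F_DNN_trunc :: "nat \<Rightarrow> nat \<Rightarrow> nat \<Rightarrow> real \<Rightarrow> ((nat \<Rightarrow> real) \<Rightarrow> real) set" where
  "F_DNN_trunc d L N M = {(\<lambda>x. trunc M (f x)) | f. f \<in> F_DNN d L N}"

definition L2dist :: "(nat \<Rightarrow> real) measure \<Rightarrow> ((nat \<Rightarrow> real) \<Rightarrow> real) \<Rightarrow> ((nat \<Rightarrow> real) \<Rightarrow> real) \<Rightarrow> real" where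
  "L2dist PX f g = sqrt (\<integral>x. (f x - g x)\<^sup>2 \<partial>PX)"

text \<open>Joint law of (X, epsilon): X ~ PX and epsilon | X = x has Lebesgue density p x.\<close>
definition joint_law :: "(nat \<Rightarrow> real) measure \<Rightarrow> ((nat \<Rightarrow> real) \<Rightarrow> real \<Rightarrow> real)
    \<Rightarrow> ((nat \<Rightarrow> real) \<times> real) measure" where
  "joint_law PX p = density (PX \<Otimes>\<^sub>M lborel) (\<lambda>(x, e). ennreal (p x e))"

text \<open>Law of the i.i.d. sample s = ((X_i, eps_i))_{i<n}; Y_i = f0 X_i + eps_i.\<close>
definition sample_law :: "(nat \<Rightarrow> real) measure \<Rightarrow> ((nat \<Rightarrow> real) \<Rightarrow> real \<Rightarrow> real) \<Rightarrow> nat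
    \<Rightarrow> (nat \<Rightarrow> (nat \<Rightarrow> real) \<times> real) measure" where
  "sample_law PX p n = PiM {..<n} (\<lambda>_. joint_law PX p)"

definition emp_risk :: "real \<Rightarrow> nat \<Rightarrow> ((nat \<Rightarrow> real) \<Rightarrow> real) \<Rightarrow> ((nat \<Rightarrow> real) \<Rightarrow> real)
    \<Rightarrow> (nat \<Rightarrow> (nat \<Rightarrow> real) \<times> real) \<Rightarrow> real" where
  "emp_risk \<alpha> n f0 f s =
     (\<Sum>i<n. check_loss \<alpha> (f0 (fst (s i)) + snd (s i) - f (fst (s i)))) / real n"

definition delta_s :: "nat \<Rightarrow> nat \<Rightarrow> nat \<Rightarrow> nat \<Rightarrow> real" where
  "delta_s d L N n = real L * real N * sqrt (real d * ln (real d * real L * real N) * ln (real n) / real n)"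

definition delta_a :: "(nat \<Rightarrow> real) measure \<Rightarrow> ((nat \<Rightarrow> real) \<Rightarrow> real) set \<Rightarrow> ((nat \<Rightarrow> real) \<Rightarrow> real) \<Rightarrow> real" where
  "delta_a PX F f0 = (INF f\<in>F. L2dist PX f f0)"

definition cond_density_condition :: "(nat \<Rightarrow> real) measure \<Rightarrow> ((nat \<Rightarrow> real) \<Rightarrow> real \<Rightarrow> real)
    \<Rightarrow> real \<Rightarrow> real \<Rightarrow> real \<Rightarrow> bool" where
  "cond_density_condition PX p pbar plow l0 \<longleftrightarrow>
     (\<lambda>(x, e). p x e) \<in> borel_measurable (PX \<Otimes>\<^sub>M lborel) \<and>
     (AE x in PX.
        (\<forall>e. 0 \<le> p x e) \<and> integrable lborel (p x) \<and> (\<integral>e. p x e \<partial>lborel) = 1 \<and>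
        continuous_on UNIV (p x) \<and>
        (\<forall>e. p x e \<le> pbar) \<and>
        plow \<le> p x 0 \<and>
        (\<forall>u1 u2. \<bar>p x u1 - p x u2\<bar> \<le> l0 * \<bar>u1 - u2\<bar>))"

end

theory Submission
  imports Defs
begin

text \<open>Proof idea. The excess check loss \<open>h\<close> of a candidate \<open>f\<close> has mean between \<open>\<kappa> * v\<close> and \<open>pbar * v\<close> and second
  moment at most \<open>v\<close>, where \<open>v = (L2dist PX f f0)\<^sup>2\<close>: the variance is controlled by the mean, which
  gives the fast rate. Uniform control of the means comes from a symmetrization of exponential moments
  with quadratic offset: with a ghost sample, the average over exchanges of
  \<open>exp (\<lambda> * \<Sum>(h(Z'\<^sub>i) - h(Z\<^sub>i) - c * (h(Z'\<^sub>i)\<^sup>2 + h(Z\<^sub>i)\<^sup>2)))\<close> is at most 1 once \<open>\<lambda> \<le> c / 2\<close>, so that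
  the price for uniformity is only the number of cells of a sup-norm cover on the \<open>2n\<close> points.
  The cells are sign patterns of polynomials in the network parameters: layer by layer, the activation
  pattern of the previous layers being fixed, the pre-activations are polynomials in the parameters.
  A Warren-type bound for sign patterns replaces Bezout's theorem by a dimension count: every region
  contains, for all small \<open>y\<close>, a solution of \<open>\<nabla>G = y\<close>, where \<open>G\<close> is the product of the polynomials
  and of factors that vanish on the boundary of a box.\<close>

section \<open>Sign patterns of multivariate polynomials\<close>

text \<open>The form of \<open>delta_s\<close> decides how crude the counting may be. A network has
  of order d * L * N^2 parameters, and counting sign patterns layer by layer multiplies L + 1 bounds
  whose exponents are all this number. The logarithm of the cover is thus of order d * L^2 * N^2
  times two logarithms, which is n * delta_s^2, so treating the layers one at a time already fits
  the rate. The offset does the work of localization: the fluctuation of every \<open>h\<close> is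
  compared with its own second moment, so one exponential moment serves all distances from
  \<open>f0\<close> at once. Its price is that the offset also contains the empirical second moment
  of \<open>h\<close>, which must be brought back to \<open>v\<close>. Hence the deviation bound is
  applied three times, to \<open>h\<close>, to \<open>-h\<close> and to \<open>-h^2\<close>, and the
  three exceptional events give the constant 3. Suprema over the whole class need not be measurable,
  so they are taken over countably many networks; the bounds, not the events, are then extended by
  continuity.\<close>

lemma underdetermined_system:
  fixes m :: "'b \<Rightarrow> 'a \<Rightarrow> real"
  assumes "finite B" "finite A" "card B < card A"
  shows "\<exists>c. (\<exists>a\<in>A. c a \<noteq> 0) \<and> (\<forall>b\<in>B. (\<Sum>a\<in>A. m b a * c a) = 0)"
  using assms
proof (induction B arbitrary: A m rule: finite_induct)
  case empty
  then have "A \<noteq> {}" by auto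
  then show ?case by (intro exI[of _ "\<lambda>_. 1"]) auto
next
  case (insert b B)
  show ?case
  proof (cases "\<forall>a\<in>A. m b a = 0")
    case True
    obtain c where "\<exists>a\<in>A. c a \<noteq> 0" "\<forall>b\<in>B. (\<Sum>a\<in>A. m b a * c a) = 0"
      using insert.IH[of A m] insert.prems insert.hyps by auto
    with True show ?thesis by (intro exI[of _ c]) auto
  next
    case False
    then obtain a0 where a0: "a0 \<in> A" "m b a0 \<noteq> 0" by auto
    define A' where "A' = A - {a0}"
    have A: "A = insert a0 A'" "a0 \<notin> A'" "finite A'"
      using a0 insert.prems by (auto simp: A'_def)
    have "card B < card A'"
      using insert.prems insert.hyps A by simp
    from insert.IH[OF A(3) this, of "\<lambda>b' a. m b' a - m b' a0 * m b a / m b a0"]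
    obtain c where c: "\<exists>a\<in>A'. c a \<noteq> 0"
      "\<And>b'. b' \<in> B \<Longrightarrow> (\<Sum>a\<in>A'. (m b' a - m b' a0 * m b a / m b a0) * c a) = 0" by blast
    \<comment> \<open>The value of \<open>c'\<close> at the pivot \<open>a0\<close> is the one that
      solves equation \<open>b\<close>. Substituting it into the other equations gives the reduced
      system on \<open>A'\<close> that the induction hypothesis has solved.\<close>
    define s where "s = (\<Sum>a\<in>A'. m b a * c a)"
    define c' where "c' = (\<lambda>a. if a = a0 then - s / m b a0 else c a)"
    have sum': "(\<Sum>a\<in>A. m b' a * c' a) = (\<Sum>a\<in>A'. m b' a * c a) - m b' a0 * s / m b a0" for b'
    proof -
      have "(\<Sum>a\<in>A'. m b' a * c' a) = (\<Sum>a\<in>A'. m b' a * c a)"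
        using A(2) by (intro sum.cong) (auto simp: c'_def)
      then show ?thesis using A by (simp add: c'_def)
    qed
    have "(\<Sum>a\<in>A. m b' a * c' a) = 0" if "b' \<in> insert b B" for b'
    proof (cases "b' = b")
      case True
      then show ?thesis using a0 by (simp add: sum' s_def[symmetric])
    next
      case False
      then have "b' \<in> B" using that by auto
      from c(2)[OF this] have "(\<Sum>a\<in>A'. m b' a * c a) - (\<Sum>a\<in>A'. m b' a0 / m b a0 * (m b a * c a)) = 0"
        by (simp add: left_diff_distrib sum_subtractf mult.assoc)
      moreover have "(\<Sum>a\<in>A'. m b' a0 / m b a0 * (m b a * c a)) = m b' a0 * s / m b a0"
        by (simp add: s_def sum_distrib_left sum_divide_distrib mult.assoc)
      ultimately show ?thesis by (simp add: sum')
    qed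
    moreover have "\<exists>a\<in>A. c' a \<noteq> 0"
      using c(1) A by (auto simp: c'_def)
    ultimately show ?thesis by blast
  qed
qed

text \<open>A generic linear form works. Vectors with \<open>v i = 0\<close> are handled by the form
  already found on \<open>I\<close>, and each of the others excludes a single value of the new
  coefficient \<open>s\<close>.\<close>

lemma separating_functional:
  fixes V :: "('i \<Rightarrow> real) set"
  assumes "finite I" "finite V" "\<And>v. v \<in> V \<Longrightarrow> \<exists>i\<in>I. v i \<noteq> 0"
  shows "\<exists>l. \<forall>v\<in>V. (\<Sum>i\<in>I. l i * v i) \<noteq> 0"
  using assms
proof (induction I arbitrary: V rule: finite_induct)
  case empty
  then show ?case by auto
next
  case (insert i I)
  define V' where "V' = {v \<in> V. \<exists>i\<in>I. v i \<noteq> 0}"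
  have "finite V'" using insert.prems by (auto simp: V'_def)
  from insert.IH[OF this] obtain l where l: "\<And>v. v \<in> V' \<Longrightarrow> (\<Sum>i\<in>I. l i * v i) \<noteq> 0"
    by (auto simp: V'_def)
  obtain s where s: "s \<notin> insert 0 ((\<lambda>v. - (\<Sum>i\<in>I. l i * v i) / v i) ` V)"
    using ex_new_if_finite[of "insert 0 ((\<lambda>v. - (\<Sum>i\<in>I. l i * v i) / v i) ` V)"] insert.prems
      infinite_UNIV_char_0 by blast
  have "(\<Sum>j\<in>insert i I. (l(i := s)) j * v j) \<noteq> 0" if v: "v \<in> V" for v
  proof -
    have "(\<Sum>j\<in>I. (l(i := s)) j * v j) = (\<Sum>j\<in>I. l j * v j)"
      using insert.hyps by (intro sum.cong) auto
    then have eq: "(\<Sum>j\<in>insert i I. (l(i := s)) j * v j) = s * v i + (\<Sum>j\<in>I. l j * v j)"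
      using insert.hyps by simp
    show ?thesis
    proof (cases "v i = 0")
      case True
      then have "v \<in> V'" using insert.prems v by (auto simp: V'_def)
      then show ?thesis using l eq True by simp
    next
      case False
      have "s \<noteq> - (\<Sum>i\<in>I. l i * v i) / v i" using s v by auto
      then have "s * v i \<noteq> - (\<Sum>i\<in>I. l i * v i)" using False by (simp add: field_simps)
      then show ?thesis using eq by linarith
    qed
  qed
  then show ?case by blast
qed

section \<open>Polynomials with a degree bound in each variable\<close>

text \<open>The bound \<open>D\<close> limits the exponent of each variable separately, not the
  total degree: the space is then spanned by \<open>(D + 1) ^ card I\<close> monomials, and grid
  arguments run coordinate by coordinate. Only the coordinates in \<open>I\<close> matter, so the
  index type itself may be infinite.\<close>

definition multipoly :: "'i set \<Rightarrow> nat \<Rightarrow> (('i \<Rightarrow> real) \<Rightarrow> real) \<Rightarrow> bool" where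
  "multipoly I D f \<longleftrightarrow>
     (\<exists>c. \<forall>x. f x = (\<Sum>a\<in>PiE I (\<lambda>_. {..D}). c a * (\<Prod>i\<in>I. x i ^ a i)))"

lemma multipoly_monomial:
  assumes "finite I" "\<And>i. i \<in> I \<Longrightarrow> a i \<le> D"
  shows "multipoly I D (\<lambda>x. \<Prod>i\<in>I. x i ^ a i)"
  unfolding multipoly_def
proof (intro exI[of _ "\<lambda>b. if b = restrict a I then 1 else 0"] allI)
  fix x :: "'a \<Rightarrow> real"
  have fin: "finite (PiE I (\<lambda>_. {..D}))" using assms by (intro finite_PiE) auto
  have mem: "restrict a I \<in> PiE I (\<lambda>_. {..D})" using assms by auto
  have "(\<Sum>b\<in>PiE I (\<lambda>_. {..D}). (if b = restrict a I then 1 else 0) * (\<Prod>i\<in>I. x i ^ b i))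
      = (\<Sum>b\<in>PiE I (\<lambda>_. {..D}). (if b = restrict a I then (\<Prod>i\<in>I. x i ^ b i) else 0))"
    by (intro sum.cong) auto
  also have "\<dots> = (\<Prod>i\<in>I. x i ^ restrict a I i)"
    using fin mem by (simp add: sum.delta)
  also have "\<dots> = (\<Prod>i\<in>I. x i ^ a i)" by (intro prod.cong) auto
  finally show "(\<Prod>i\<in>I. x i ^ a i) =
    (\<Sum>b\<in>PiE I (\<lambda>_. {..D}). (if b = restrict a I then 1 else 0) * (\<Prod>i\<in>I. x i ^ b i))" ..
qed

lemma multipoly_cmult:
  assumes "multipoly I D f" shows "multipoly I D (\<lambda>x. c * f x)"
proof -
  from assms obtain e where "\<And>x. f x = (\<Sum>a\<in>PiE I (\<lambda>_. {..D}). e a * (\<Prod>i\<in>I. x i ^ a i))"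
    unfolding multipoly_def by blast
  then show ?thesis unfolding multipoly_def
    by (intro exI[of _ "\<lambda>a. c * e a"]) (simp add: sum_distrib_left mult.assoc)
qed

lemma multipoly_add:
  assumes "multipoly I D f" "multipoly I D g" shows "multipoly I D (\<lambda>x. f x + g x)"
proof -
  from assms obtain e e' where "\<And>x. f x = (\<Sum>a\<in>PiE I (\<lambda>_. {..D}). e a * (\<Prod>i\<in>I. x i ^ a i))"
    "\<And>x. g x = (\<Sum>a\<in>PiE I (\<lambda>_. {..D}). e' a * (\<Prod>i\<in>I. x i ^ a i))"
    unfolding multipoly_def by blast
  then show ?thesis unfolding multipoly_def
    by (intro exI[of _ "\<lambda>a. e a + e' a"]) (simp add: sum.distrib distrib_right)
qed

lemma multipoly_zero: "multipoly I D (\<lambda>x. 0)"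
  unfolding multipoly_def by (intro exI[of _ "\<lambda>_. 0"]) simp

lemma multipoly_sum:
  assumes "\<And>s. s \<in> S \<Longrightarrow> multipoly I D (f s)"
  shows "multipoly I D (\<lambda>x. \<Sum>s\<in>S. f s x)"
  using assms by (induction S rule: infinite_finite_induct) (auto intro: multipoly_zero multipoly_add)

lemma multipoly_const:
  assumes "finite I" shows "multipoly I D (\<lambda>x. c)"
  using multipoly_cmult[OF multipoly_monomial[OF assms, of "\<lambda>_. 0" D], of c] by simp

lemma multipoly_diff:
  assumes "multipoly I D f" "multipoly I D g" shows "multipoly I D (\<lambda>x. f x - g x)"
  using multipoly_add[OF assms(1) multipoly_cmult[OF assms(2), of "-1"]] by simp

lemma multipoly_mono:
  assumes "finite I" "D \<le> D'" "multipoly I D f" shows "multipoly I D' f"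
proof -
  from assms(3) obtain e where e: "\<And>x. f x = (\<Sum>a\<in>PiE I (\<lambda>_. {..D}). e a * (\<Prod>i\<in>I. x i ^ a i))"
    unfolding multipoly_def by blast
  have "multipoly I D' (\<lambda>x. \<Sum>a\<in>PiE I (\<lambda>_. {..D}). e a * (\<Prod>i\<in>I. x i ^ a i))"
    using assms(1,2) by (intro multipoly_sum multipoly_cmult multipoly_monomial)
      (auto simp: PiE_iff intro: order_trans)
  then show ?thesis using e by (metis (no_types, lifting) ext)
qed

lemma multipoly_var:
  assumes "finite I" "i \<in> I" shows "multipoly I 1 (\<lambda>x. x i)"
proof -
  have "(\<Prod>j\<in>I. x j ^ (if j = i then 1 else 0)) = x i" for x :: "'a \<Rightarrow> real"
    using assms by (subst prod.remove[of _ i]) auto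
  with multipoly_monomial[OF assms(1), of "\<lambda>j. if j = i then 1 else 0" 1]
  show ?thesis by simp
qed

lemma multipoly_mult:
  assumes "finite I" "multipoly I D f" "multipoly I D' g"
  shows "multipoly I (D + D') (\<lambda>x. f x * g x)"
proof -
  from assms obtain e e' where e: "\<And>x. f x = (\<Sum>a\<in>PiE I (\<lambda>_. {..D}). e a * (\<Prod>i\<in>I. x i ^ a i))"
    "\<And>x. g x = (\<Sum>a\<in>PiE I (\<lambda>_. {..D'}). e' a * (\<Prod>i\<in>I. x i ^ a i))"
    unfolding multipoly_def by blast
  have "f x * g x = (\<Sum>a\<in>PiE I (\<lambda>_. {..D}). \<Sum>b\<in>PiE I (\<lambda>_. {..D'}).
     (e a * e' b) * (\<Prod>i\<in>I. x i ^ (a i + b i)))" for x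
    unfolding e sum_product by (intro sum.cong refl) (simp add: power_add prod.distrib)
  moreover have "multipoly I (D + D') (\<lambda>x. \<Sum>a\<in>PiE I (\<lambda>_. {..D}). \<Sum>b\<in>PiE I (\<lambda>_. {..D'}).
     (e a * e' b) * (\<Prod>i\<in>I. x i ^ (a i + b i)))"
    using assms(1) by (intro multipoly_sum multipoly_cmult multipoly_monomial) (auto simp: PiE_iff intro!: add_mono)
  ultimately show ?thesis by simp
qed

lemma multipoly_prod:
  assumes "finite I" "\<And>s. s \<in> S \<Longrightarrow> multipoly I D (f s)"
  shows "multipoly I (card S * D) (\<lambda>x. \<Prod>s\<in>S. f s x)"
  using assms(2)
proof (induction S rule: infinite_finite_induct)
  case (insert s S)
  then have "multipoly I (D + card S * D) (\<lambda>x. f s x * (\<Prod>s\<in>S. f s x))"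
    using insert.prems by (intro multipoly_mult assms(1) insert.IH) auto
  with insert show ?case by simp
qed (auto intro: multipoly_const assms)

lemma multipoly_power:
  assumes "finite I" "multipoly I D f" shows "multipoly I (k * D) (\<lambda>x. f x ^ k)"
  using multipoly_prod[OF assms(1), of "{..<k}" D "\<lambda>_. f"] assms(2) by simp

lemma continuous_on_multipoly:
  assumes "multipoly I D f" shows "continuous_on S f"
proof -
  from assms obtain e where e: "\<And>x. f x = (\<Sum>a\<in>PiE I (\<lambda>_. {..D}). e a * (\<Prod>i\<in>I. x i ^ a i))"
    unfolding multipoly_def by blast
  have "continuous_on S (\<lambda>x. \<Sum>a\<in>PiE I (\<lambda>_. {..D}). e a * (\<Prod>i\<in>I. x i ^ a i))"
    by (intro continuous_intros continuous_on_product_coordinates continuous_on_subset[OF continuous_on_product_coordinates]) auto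
  then show ?thesis using e by (metis (no_types, lifting) continuous_on_cong)
qed

lemma multipoly_cong:
  assumes "multipoly I D f" "\<And>i. i \<in> I \<Longrightarrow> x i = y i" shows "f x = f y"
proof -
  from assms obtain e where e: "\<And>x. f x = (\<Sum>a\<in>PiE I (\<lambda>_. {..D}). e a * (\<Prod>i\<in>I. x i ^ a i))"
    unfolding multipoly_def by blast
  show ?thesis unfolding e using assms(2) by (intro sum.cong arg_cong2[of _ _ _ _ "(*)"] prod.cong) auto
qed

lemma multipoly_partial_derivative:
  assumes "finite I" "i \<in> I" "multipoly I D f"
  shows "\<exists>g. multipoly I D g \<and> (\<forall>x. ((\<lambda>t. f (x(i := t))) has_real_derivative g x) (at (x i)))"
proof -
  from assms obtain e where e: "\<And>x. f x = (\<Sum>a\<in>PiE I (\<lambda>_. {..D}). e a * (\<Prod>i\<in>I. x i ^ a i))"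
    unfolding multipoly_def by blast
  \<comment> \<open>Natural subtraction makes \<open>a i - 1\<close> equal to 0 when
    \<open>a i = 0\<close>; the factor \<open>real (a i)\<close> removes that term. The bound
    \<open>D\<close> is kept rather than lowered.\<close>
  define g where "g = (\<lambda>x. \<Sum>a\<in>PiE I (\<lambda>_. {..D}). (e a * real (a i)) * (\<Prod>j\<in>I. x j ^ (a(i := a i - 1)) j))"
  have "multipoly I D g"
    unfolding g_def using assms(1)
    by (intro multipoly_sum multipoly_cmult multipoly_monomial) (auto simp: PiE_iff intro: order_trans[OF diff_le_self])
  moreover have "((\<lambda>t. f (x(i := t))) has_real_derivative g x) (at (x i))" for x
  proof -
    have split: "(\<Prod>j\<in>I. y j ^ a j) = y i ^ a i * (\<Prod>j\<in>I-{i}. y j ^ a j)" for y :: "'a \<Rightarrow> real" and a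
      using assms by (subst prod.remove[of _ i]) auto
    have upd: "(\<Prod>j\<in>I-{i}. (x(i := t)) j ^ a j) = (\<Prod>j\<in>I-{i}. x j ^ a j)" for t a
      by (intro prod.cong) auto
    have upd': "(\<Prod>j\<in>I-{i}. x j ^ (a(i := k)) j) = (\<Prod>j\<in>I-{i}. x j ^ a j)" for k a
      by (intro prod.cong) auto
    have "((\<lambda>t. \<Sum>a\<in>PiE I (\<lambda>_. {..D}). e a * (t ^ a i * (\<Prod>j\<in>I-{i}. x j ^ a j))) has_real_derivative
       (\<Sum>a\<in>PiE I (\<lambda>_. {..D}). e a * (real (a i) * x i ^ (a i - 1) * (\<Prod>j\<in>I-{i}. x j ^ a j)))) (at (x i))"
      by (auto intro!: derivative_eq_intros sum.cong)
    then show ?thesis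
      unfolding e g_def split upd upd' by (simp add: mult.assoc)
  qed
  ultimately show ?thesis by blast
qed

section \<open>Polynomials that vanish on a grid\<close>

lemma univariate_coeffs_zero:
  fixes c :: "nat \<Rightarrow> real"
  assumes "finite G" "n < card G" "\<And>t. t \<in> G \<Longrightarrow> (\<Sum>k\<le>n. c k * t ^ k) = 0" "k \<le> n"
  shows "c k = 0"
proof (rule ccontr)
  assume "c k \<noteq> 0"
  then have "finite {z. (\<Sum>i\<le>n. c i * z^i) = 0} \<and> card {z. (\<Sum>i\<le>n. c i * z^i) = 0} \<le> n"
    using polyfun_rootbound[of n c] assms(4) by blast
  moreover have "G \<subseteq> {z. (\<Sum>i\<le>n. c i * z^i) = 0}" using assms(3) by auto
  ultimately show False using assms(2) card_mono[of "{z. (\<Sum>i\<le>n. c i * z^i) = 0}" G] by simp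
qed

text \<open>With all coordinates but one frozen, the polynomial is univariate with more than
  \<open>n\<close> zeros. Its coefficients are polynomials in the remaining coordinates that vanish
  on the smaller grid.\<close>

lemma grid_coeffs_zero:
  fixes c :: "('i \<Rightarrow> nat) \<Rightarrow> real"
  assumes "finite I" "finite G" "n < card G"
    "\<And>y. y \<in> PiE I (\<lambda>_. G) \<Longrightarrow> (\<Sum>a\<in>PiE I (\<lambda>_. {..n}). c a * (\<Prod>i\<in>I. y i ^ a i)) = 0"
    "a \<in> PiE I (\<lambda>_. {..n})"
  shows "c a = 0"
  using assms(1,4,5)
proof (induction I arbitrary: c a rule: finite_induct)
  case empty
  then show ?case by auto
next
  case (insert i I)
  define c' where "c' = (\<lambda>k a. c (a(i := k)))"
  have inj: "inj_on (\<lambda>(k, a). a(i := k)) ({..n} \<times> PiE I (\<lambda>_. {..n}))"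
  proof (rule inj_onI, clarsimp)
    fix k k' a b assume ab: "a \<in> PiE I (\<lambda>_. {..n})" "b \<in> PiE I (\<lambda>_. {..n})" "a(i := k) = b(i := k')"
    have "a j = b j" for j
      using fun_cong[OF ab(3), of j] ab(1,2) insert.hyps by (cases "j = i") (auto simp: PiE_def extensional_def)
    then show "k = k' \<and> a = b" using fun_cong[OF ab(3), of i] by auto
  qed
  have eq: "(\<Sum>a\<in>PiE (insert i I) (\<lambda>_. {..n}). c a * (\<Prod>j\<in>insert i I. (y(i:=t)) j ^ a j))
    = (\<Sum>k\<le>n. (\<Sum>a\<in>PiE I (\<lambda>_. {..n}). c' k a * (\<Prod>j\<in>I. y j ^ a j)) * t ^ k)" for y :: "'i \<Rightarrow> real" and t
  proof -
    have "(\<Sum>a\<in>PiE (insert i I) (\<lambda>_. {..n}). c a * (\<Prod>j\<in>insert i I. (y(i:=t)) j ^ a j))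
      = (\<Sum>(k,a)\<in>{..n} \<times> PiE I (\<lambda>_. {..n}). c (a(i:=k)) * (\<Prod>j\<in>insert i I. (y(i:=t)) j ^ (a(i:=k)) j))"
      unfolding PiE_insert_eq by (subst sum.reindex[OF inj]) (auto intro!: sum.cong)
    also have "\<dots> = (\<Sum>(k,a)\<in>{..n} \<times> PiE I (\<lambda>_. {..n}). c' k a * (\<Prod>j\<in>I. y j ^ a j) * t ^ k)"
    proof (intro sum.cong refl, clarsimp)
      fix k a
      have "(\<Prod>j\<in>I. (if j = i then t else y j) ^ (if j = i then k else a j)) = (\<Prod>j\<in>I. y j ^ a j)"
        using insert.hyps by (intro prod.cong) auto
      then show "c (a(i := k)) * (\<Prod>j\<in>insert i I. (if j = i then t else y j) ^ (if j = i then k else a j))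
        = c' k a * (\<Prod>j\<in>I. y j ^ a j) * t ^ k"
        using insert.hyps by (simp add: c'_def)
    qed
    finally show ?thesis by (simp add: sum.cartesian_product[symmetric] sum_distrib_right)
  qed
  have "c' k b = 0" if k: "k \<le> n" and b: "b \<in> PiE I (\<lambda>_. {..n})" for k b
  proof (rule insert.IH[of "c' k", OF _ b])
    fix y assume y: "y \<in> PiE I (\<lambda>_. G)"
    show "(\<Sum>a\<in>PiE I (\<lambda>_. {..n}). c' k a * (\<Prod>i\<in>I. y i ^ a i)) = 0"
    proof (rule univariate_coeffs_zero[OF assms(2,3) _ k])
      fix t assume "t \<in> G"
      then have "y(i := t) \<in> PiE (insert i I) (\<lambda>_. G)" using y by (auto simp: PiE_iff extensional_def)
      from insert.prems(1)[OF this] show "(\<Sum>k\<le>n. (\<Sum>a\<in>PiE I (\<lambda>_. {..n}). c' k a * (\<Prod>j\<in>I. y j ^ a j)) * t ^ k) = 0"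
        unfolding eq .
    qed
  qed
  \<comment> \<open>An exponent function on \<open>insert i I\<close> splits into its value at
    \<open>i\<close> and its restriction to \<open>I\<close>, which as an element of
    \<open>PiE\<close> takes the value \<open>undefined\<close> at \<open>i\<close>.\<close>
  from this[of "a i" "a(i := undefined)"] insert.prems(2) insert.hyps show ?case
    by (auto simp: c'_def PiE_iff extensional_def)
qed

section \<open>Counting the regions cut out by polynomials\<close>

text \<open>A maximizer over \<open>C\<close> of \<open>s * G\<close>, tilted by the linear form
  with coefficients \<open>y\<close>, is a critical point as soon as it can be moved inside
  \<open>C\<close>, that is, as soon as \<open>G\<close> does not vanish there. On \<open>C\<close>
  the tilt is at most \<open>card I * (\<eta> * R)\<close> in absolute value, so a zero of
  \<open>G\<close> cannot beat \<open>v\<close>, where \<open>s * G\<close> exceeds twice this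
  amount.\<close>

lemma gradient_value_in_region:
  fixes G :: "('i \<Rightarrow> real) \<Rightarrow> real"
  assumes I: "finite I" and C: "compact C" "v \<in> C" "continuous_on C G"
    and R: "\<And>x i. x \<in> C \<Longrightarrow> i \<in> I \<Longrightarrow> \<bar>x i\<bar> \<le> R"
    and grad: "\<And>x i. i \<in> I \<Longrightarrow> ((\<lambda>t. G (x(i := t))) has_real_derivative dG i x) (at (x i))"
    and inner: "\<And>x i. x \<in> C \<Longrightarrow> G x \<noteq> 0 \<Longrightarrow> i \<in> I \<Longrightarrow> \<forall>\<^sub>F t in nhds (x i). x(i := t) \<in> C"
    and s: "\<bar>s\<bar> = 1" and y: "\<And>i. i \<in> I \<Longrightarrow> \<bar>y i\<bar> \<le> \<eta>" "2 * (real (card I) * (\<eta> * R)) < s * G v"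
  shows "\<exists>x\<in>C. G x \<noteq> 0 \<and> (\<forall>i\<in>I. dG i x = y i)"
proof -
  define H where "H = (\<lambda>x. s * G x - s * (\<Sum>i\<in>I. y i * x i))"
  have "continuous_on C H"
    unfolding H_def by (intro continuous_intros C continuous_on_subset[OF continuous_on_product_coordinates]) auto
  then obtain x where x: "x \<in> C" "\<And>z. z \<in> C \<Longrightarrow> H z \<le> H x"
    using continuous_attains_sup[OF C(1), of H] C(2) by auto
  have lin: "\<bar>s * (\<Sum>i\<in>I. y i * z i)\<bar> \<le> real (card I) * (\<eta> * R)" if "z \<in> C" for z
  proof -
    have "\<bar>s * (\<Sum>i\<in>I. y i * z i)\<bar> \<le> (\<Sum>i\<in>I. \<bar>y i * z i\<bar>)" using s sum_abs[of "\<lambda>i. y i * z i" I] by (simp add: abs_mult)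
    also have "\<dots> \<le> (\<Sum>i\<in>I. \<eta> * R)"
      unfolding abs_mult using y(1) R[OF that]
      by (intro sum_mono mult_mono) (auto intro: order_trans[OF abs_ge_zero])
    finally show ?thesis by simp
  qed
  have "H v \<le> H x" using x C by auto
  then have "s * G x \<noteq> 0" using lin[OF x(1)] lin[OF C(2)] y(2) unfolding H_def by linarith
  then have nz: "G x \<noteq> 0" by auto
  have "dG i x = y i" if i: "i \<in> I" for i
  proof -
    have split: "(\<Sum>j\<in>I. y j * (x(i := t)) j) = y i * t + (\<Sum>j\<in>I-{i}. y j * x j)" for t
      using I i by (subst sum.remove[of _ i]) (auto intro!: sum.cong)
    have "((\<lambda>t. H (x(i := t))) has_real_derivative (s * dG i x - s * y i)) (at (x i))"
      unfolding H_def split by (auto intro!: derivative_eq_intros grad[OF i])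
    moreover obtain d where d: "d > 0" "\<And>t. dist t (x i) < d \<Longrightarrow> x(i := t) \<in> C"
      using inner[OF x(1) nz i] unfolding eventually_nhds_metric by auto
    moreover from d x(2) have "\<forall>t. \<bar>x i - t\<bar> < d \<longrightarrow> H (x(i := t)) \<le> H (x(i := x i))"
      by (auto simp: dist_real_def abs_minus_commute)
    ultimately have "s * dG i x - s * y i = 0" using d(1) DERIV_local_max by blast
    then show ?thesis using s by (auto simp: right_diff_distrib[symmetric])
  qed
  with x nz show ?thesis by auto
qed

text \<open>The functions \<open>(\<Prod>i. (dG i) ^ a i) * l ^ b\<close>, where \<open>l\<close> is a linear form that separates the
  solutions of \<open>dG = y\<close> for \<open>y\<close> in a grid, are linearly independent; the dimension of the space
  of polynomials that contains them bounds their number.\<close>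

lemma card_regions_le:
  fixes dG :: "'i \<Rightarrow> ('i \<Rightarrow> real) \<Rightarrow> real" and U :: "'s \<Rightarrow> ('i \<Rightarrow> real) set"
  assumes I: "finite I" and P: "finite P" and disj: "disjoint_family_on U P"
    and dG: "\<And>i. i \<in> I \<Longrightarrow> multipoly I D (dG i)"
    and supp: "\<And>\<sigma> x i. \<sigma> \<in> P \<Longrightarrow> x \<in> U \<sigma> \<Longrightarrow> i \<notin> I \<Longrightarrow> x i = 0"
    and \<eta>: "\<eta> > 0"
    and ex: "\<And>\<sigma> y. \<sigma> \<in> P \<Longrightarrow> (\<And>i. i \<in> I \<Longrightarrow> \<bar>y i\<bar> \<le> \<eta>) \<Longrightarrow> \<exists>x\<in>U \<sigma>. \<forall>i\<in>I. dG i x = y i"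
  shows "card P \<le> (card I * D + 1) ^ card I"
proof (cases "card P = 0")
  case False
  define K where "K = card P"
  have K: "K > 0" using False by (simp add: K_def)
  \<comment> \<open>\<open>K + 1\<close> grid values per coordinate, one more than the largest
    exponent \<open>K\<close> used below, as \<open>grid_coeffs_zero\<close> demands.\<close>
  define Y where "Y = (\<lambda>k. \<eta> * real k / real K) ` {..K}"
  have finY: "finite Y" by (simp add: Y_def)
  have cY: "card Y = K + 1"
    unfolding Y_def using \<eta> K by (subst card_image) (auto intro!: inj_onI)
  have Yb: "\<bar>t\<bar> \<le> \<eta>" if "t \<in> Y" for t
    using that \<eta> K by (auto simp: Y_def field_simps abs_mult)
  have "\<forall>\<sigma>\<in>P. \<forall>y\<in>PiE I (\<lambda>_. Y). \<exists>x\<in>U \<sigma>. \<forall>i\<in>I. dG i x = y i"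
    by (intro ballI ex) (auto intro!: Yb)
  then obtain X where X: "\<And>\<sigma> y. \<sigma> \<in> P \<Longrightarrow> y \<in> PiE I (\<lambda>_. Y) \<Longrightarrow> X \<sigma> y \<in> U \<sigma>"
    "\<And>\<sigma> y i. \<sigma> \<in> P \<Longrightarrow> y \<in> PiE I (\<lambda>_. Y) \<Longrightarrow> i \<in> I \<Longrightarrow> dG i (X \<sigma> y) = y i"
    by metis
  define Q where "Q = (\<lambda>(\<sigma>, y). X \<sigma> y) ` (P \<times> PiE I (\<lambda>_. Y))"
  have finQ: "finite Q" using I P finY by (auto simp: Q_def intro!: finite_PiE)
  define V where "V = (\<lambda>(x, z) i. x i - z i) ` {(x, z) \<in> Q \<times> Q. x \<noteq> z}"
  have Q0: "x i = 0" if "x \<in> Q" "i \<notin> I" for x i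
    using that X(1) supp by (auto simp: Q_def)
  have "finite V"
    unfolding V_def by (rule finite_imageI, rule finite_subset[of _ "Q \<times> Q"]) (use finQ in auto)
  moreover have "\<exists>i\<in>I. v i \<noteq> 0" if "v \<in> V" for v
  proof -
    obtain x z where xz: "x \<in> Q" "z \<in> Q" "x \<noteq> z" "v = (\<lambda>i. x i - z i)"
      using \<open>v \<in> V\<close> by (auto simp: V_def)
    then obtain i where "x i \<noteq> z i" by auto
    moreover from this have "i \<in> I" using Q0 xz by metis
    ultimately show ?thesis using xz by auto
  qed
  ultimately obtain l where l: "\<And>v. v \<in> V \<Longrightarrow> (\<Sum>i\<in>I. l i * v i) \<noteq> 0"
    using separating_functional[OF I, of V] by blast
  define \<Lambda> where "\<Lambda> = (\<lambda>x. \<Sum>i\<in>I. l i * x i)"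
  have sep: "\<Lambda> x \<noteq> \<Lambda> z" if "x \<in> Q" "z \<in> Q" "x \<noteq> z" for x z
  proof -
    have "(\<lambda>i. x i - z i) \<in> V" using that by (force simp: V_def)
    from l[OF this] show ?thesis by (simp add: \<Lambda>_def right_diff_distrib sum_subtractf)
  qed
  define W where "W = card I"
  define E where "E = W * (K * D) + K"
  define F where "F = (\<lambda>(a, b) x. (\<Prod>i\<in>I. dG i x ^ a i) * \<Lambda> x ^ b)"
  \<comment> \<open>Over every grid point there are \<open>K\<close> solutions, one per region, and
    \<open>\<Lambda>\<close> takes different values at them. This is just enough to determine a
    polynomial in \<open>\<Lambda>\<close> of degree \<open>K - 1\<close>, hence the
    \<open>K\<close> exponents \<open>b\<close>.\<close>
  define S where "S = PiE I (\<lambda>_. {..K}) \<times> {..<K}"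
  define B where "B = PiE I (\<lambda>_. {..E})"
  have "multipoly I 1 \<Lambda>"
    unfolding \<Lambda>_def by (intro multipoly_sum multipoly_cmult multipoly_var I)
  have F: "multipoly I E (F ab)" if ab_in: "ab \<in> S" for ab
  proof -
    obtain a b where ab: "ab = (a, b)" "a \<in> PiE I (\<lambda>_. {..K})" "b < K" using ab_in by (auto simp: S_def)
    have "multipoly I (K * D) (\<lambda>x. dG i x ^ a i)" if "i \<in> I" for i
      using ab(2) that by (intro multipoly_mono[OF I _ multipoly_power[OF I dG[OF that]]]) auto
    then have "multipoly I (W * (K * D)) (\<lambda>x. \<Prod>i\<in>I. dG i x ^ a i)"
      unfolding W_def by (intro multipoly_prod I)
    moreover have "multipoly I K (\<lambda>x. \<Lambda> x ^ b)"
      using ab(3) by (intro multipoly_mono[OF I _ multipoly_power[OF I \<open>multipoly I 1 \<Lambda>\<close>]]) auto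
    ultimately show ?thesis
      unfolding ab F_def E_def using multipoly_mult[OF I] by simp
  qed
  then have "\<forall>ab\<in>S. \<exists>c. \<forall>x. F ab x = (\<Sum>e\<in>B. c e * (\<Prod>i\<in>I. x i ^ e i))"
    unfolding multipoly_def B_def by blast
  then obtain m where m: "\<And>ab x. ab \<in> S \<Longrightarrow> F ab x = (\<Sum>e\<in>B. m ab e * (\<Prod>i\<in>I. x i ^ e i))"
    by metis
  have fin: "finite S" "finite B" using I by (auto simp: S_def B_def intro!: finite_PiE)
  have cards: "card S = (K + 1) ^ W * K" "card B = (E + 1) ^ W"
    using I by (auto simp: S_def B_def card_PiE card_cartesian_product W_def)
  have "\<not> card B < card S"
  proof
    assume "card B < card S"
    from underdetermined_system[OF fin(2,1) this, of "\<lambda>e ab. m ab e"]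
    obtain c where c: "\<exists>ab\<in>S. c ab \<noteq> 0" "\<And>e. e \<in> B \<Longrightarrow> (\<Sum>ab\<in>S. m ab e * c ab) = 0" by blast
    have zero: "(\<Sum>ab\<in>S. c ab * F ab x) = 0" for x
    proof -
      have "(\<Sum>ab\<in>S. c ab * F ab x) = (\<Sum>ab\<in>S. \<Sum>e\<in>B. c ab * (m ab e * (\<Prod>i\<in>I. x i ^ e i)))"
        by (intro sum.cong refl) (simp add: m sum_distrib_left)
      also have "\<dots> = (\<Sum>e\<in>B. (\<Sum>ab\<in>S. m ab e * c ab) * (\<Prod>i\<in>I. x i ^ e i))"
        by (subst sum.swap) (simp add: sum_distrib_right sum_distrib_left mult_ac)
      also have "\<dots> = 0" using c(2) by simp
      finally show ?thesis .
    qed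
    \<comment> \<open>At fixed \<open>y\<close> a linear relation becomes a polynomial in
      \<open>\<Lambda>\<close> with \<open>K\<close> distinct zeros, so each of its coefficients is
      zero. These coefficients are polynomials in \<open>y\<close> that vanish on the whole grid, so
      all \<open>c (a, b)\<close> are zero.\<close>
    have "(\<Sum>a\<in>PiE I (\<lambda>_. {..K}). c (a, b) * (\<Prod>i\<in>I. y i ^ a i)) = 0"
      if y: "y \<in> PiE I (\<lambda>_. Y)" and b: "b \<le> K - 1" for y b
    proof (rule univariate_coeffs_zero[where G="(\<lambda>\<sigma>. \<Lambda> (X \<sigma> y)) ` P" and n="K - 1", OF _ _ _ b])
      have "inj_on (\<lambda>\<sigma>. \<Lambda> (X \<sigma> y)) P"
      proof (rule inj_onI, rule ccontr)
        fix \<sigma> \<tau> assume *: "\<sigma> \<in> P" "\<tau> \<in> P" "\<Lambda> (X \<sigma> y) = \<Lambda> (X \<tau> y)" "\<sigma> \<noteq> \<tau>"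
        have "X \<sigma> y \<noteq> X \<tau> y"
          using X(1)[OF *(1) y] X(1)[OF *(2) y] disjoint_family_onD[OF disj *(1,2,4)] by auto
        moreover have "X \<sigma> y \<in> Q" "X \<tau> y \<in> Q" using * y by (auto simp: Q_def)
        ultimately show False using sep *(3) by blast
      qed
      then show "K - 1 < card ((\<lambda>\<sigma>. \<Lambda> (X \<sigma> y)) ` P)" using K by (simp add: card_image K_def)
    next
      fix t assume "t \<in> (\<lambda>\<sigma>. \<Lambda> (X \<sigma> y)) ` P"
      then obtain \<sigma> where \<sigma>: "\<sigma> \<in> P" "t = \<Lambda> (X \<sigma> y)" by auto
      have set: "{..K - 1} = {..<K}" using K by auto
      have "0 = (\<Sum>ab\<in>S. c ab * F ab (X \<sigma> y))" by (simp add: zero)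
      also have "\<dots> = (\<Sum>(a, b)\<in>S. c (a, b) * (\<Prod>i\<in>I. y i ^ a i) * t ^ b)"
        unfolding F_def using X(2)[OF \<sigma>(1) y] \<sigma>(2)
        by (intro sum.cong refl) (auto simp: mult.assoc intro!: prod.cong)
      also have "\<dots> = (\<Sum>b\<le>K - 1. (\<Sum>a\<in>PiE I (\<lambda>_. {..K}). c (a, b) * (\<Prod>i\<in>I. y i ^ a i)) * t ^ b)"
        unfolding S_def set by (subst sum.cartesian_product[symmetric], subst sum.swap) (simp add: sum_distrib_right)
      finally show "(\<Sum>b\<le>K - 1. (\<Sum>a\<in>PiE I (\<lambda>_. {..K}). c (a, b) * (\<Prod>i\<in>I. y i ^ a i)) * t ^ b) = 0" ..
    qed (use P in auto)
    then have "c (a, b) = 0" if "(a, b) \<in> S" for a b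
      using that K cY by (intro grid_coeffs_zero[OF I finY, of K "\<lambda>a. c (a, b)"]) (auto simp: S_def)
    then show False using c(1) by auto
  qed
  then have "(K + 1) ^ W * K \<le> (E + 1) ^ W" using cards by simp
  \<comment> \<open>\<open>E + 1\<close> is at most \<open>(K + 1) * (W * D + 1)\<close>: the power
    \<open>(K + 1) ^ W\<close> then appears on both sides and cancels, leaving a bound free of
    \<open>K\<close>.\<close>
  also have "\<dots> \<le> ((K + 1) * (W * D + 1)) ^ W"
    by (intro power_mono) (auto simp: E_def algebra_simps)
  also have "\<dots> = (K + 1) ^ W * (W * D + 1) ^ W" by (rule power_mult_distrib)
  finally show ?thesis by (simp add: K_def W_def)
qed auto

text \<open>Every pattern gets an open region \<open>U \<sigma>\<close> inside a box and its closed
  version \<open>C \<sigma>\<close>, on which \<open>G\<close> vanishes exactly outside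
  \<open>U \<sigma>\<close>. The inner factor of the bound is the degree of \<open>G\<close>: 2 for
  each coordinate of the box and \<open>D\<close> for each polynomial.\<close>

lemma card_sign_patterns_le:
  fixes f :: "'j \<Rightarrow> ('i \<Rightarrow> real) \<Rightarrow> real"
  assumes I: "finite I" and J: "finite J" and f: "\<And>j. j \<in> J \<Longrightarrow> multipoly I D (f j)"
  shows "card (range (\<lambda>x. {j\<in>J. f j x \<ge> 0})) \<le> (card I * (2 * card I + card J * D) + 1) ^ card I"
proof -
  define P where "P = range (\<lambda>x. {j\<in>J. f j x \<ge> 0})"
  have finP: "finite P" unfolding P_def by (rule finite_subset[of _ "Pow J"]) (use J in auto)
  have "\<forall>\<sigma>\<in>P. \<exists>v. \<sigma> = {j\<in>J. f j v \<ge> 0}" unfolding P_def by auto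
  then obtain v0 where v0: "\<And>\<sigma>. \<sigma> \<in> P \<Longrightarrow> \<sigma> = {j\<in>J. f j (v0 \<sigma>) \<ge> 0}" by metis
  \<comment> \<open>Putting 0 outside \<open>I\<close> keeps the regions compact even if the index
    type is infinite, and ensures that two different solutions differ at some coordinate in
    \<open>I\<close>.\<close>
  define v where "v = (\<lambda>\<sigma> i. if i \<in> I then v0 \<sigma> i else 0)"
  have v: "\<sigma> = {j\<in>J. f j (v \<sigma>) \<ge> 0}" if "\<sigma> \<in> P" for \<sigma>
  proof -
    have "f j (v \<sigma>) = f j (v0 \<sigma>)" if "j \<in> J" for j
      by (rule multipoly_cong[OF f[OF that]]) (simp add: v_def)
    then have "{j\<in>J. f j (v \<sigma>) \<ge> 0} = {j\<in>J. f j (v0 \<sigma>) \<ge> 0}" by auto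
    with v0[OF that] show ?thesis by simp
  qed
  text \<open>Shifting all polynomials slightly upwards makes the signs at the finitely many witnesses strict.\<close>
  obtain e where e: "e > 0" "\<And>\<sigma> j. \<sigma> \<in> P \<Longrightarrow> j \<in> J \<Longrightarrow> f j (v \<sigma>) < 0 \<Longrightarrow> f j (v \<sigma>) + e < 0"
  proof -
    define S where "S = insert 1 ((\<lambda>(\<sigma>, j). - f j (v \<sigma>) / 2) ` {(\<sigma>, j) \<in> P \<times> J. f j (v \<sigma>) < 0})"
    have S: "finite S" "S \<noteq> {}"
      unfolding S_def using finP J finite_subset[of "{(\<sigma>, j) \<in> P \<times> J. f j (v \<sigma>) < 0}" "P \<times> J"] by auto
    show ?thesis
    proof (rule that[of "Min S"])
      show "Min S > 0" using S by (auto simp: Min_gr_iff S_def)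
      fix \<sigma> j assume *: "\<sigma> \<in> P" "j \<in> J" "f j (v \<sigma>) < 0"
      then have "- f j (v \<sigma>) / 2 \<in> S" by (force simp: S_def)
      then have "Min S \<le> - f j (v \<sigma>) / 2" using S by simp
      with *(3) show "f j (v \<sigma>) + Min S < 0" by linarith
    qed
  qed
  define g where "g = (\<lambda>j x. f j x + e)"
  obtain R where R: "\<And>\<sigma> i. \<sigma> \<in> P \<Longrightarrow> i \<in> I \<Longrightarrow> \<bar>v \<sigma> i\<bar> < R" "R > 0"
  proof -
    define S where "S = insert 0 ((\<lambda>(\<sigma>, i). \<bar>v \<sigma> i\<bar>) ` (P \<times> I))"
    have S: "finite S" using finP I by (auto simp: S_def)
    show ?thesis
    proof (rule that[of "Max S + 1"])
      have "\<bar>v \<sigma> i\<bar> \<le> Max S" if "\<sigma> \<in> P" "i \<in> I" for \<sigma> i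
        using that S by (intro Max_ge) (auto simp: S_def)
      then show "\<bar>v \<sigma> i\<bar> < Max S + 1" if "\<sigma> \<in> P" "i \<in> I" for \<sigma> i using that by fastforce
      have "0 \<le> Max S" using S by (intro Max_ge) (auto simp: S_def)
      then show "Max S + 1 > 0" by simp
    qed
  qed
  define U where "U = (\<lambda>\<sigma>. {x. (\<forall>i\<in>I. \<bar>x i\<bar> < R) \<and> (\<forall>i. i \<notin> I \<longrightarrow> x i = 0) \<and>
     (\<forall>j\<in>J. if j \<in> \<sigma> then g j x > 0 else g j x < 0)})"
  define C where "C = (\<lambda>\<sigma>. {x. (\<forall>i\<in>I. \<bar>x i\<bar> \<le> R) \<and> (\<forall>i. i \<notin> I \<longrightarrow> x i = 0) \<and>
     (\<forall>j\<in>J. if j \<in> \<sigma> then g j x \<ge> 0 else g j x \<le> 0)})"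
  have vU: "v \<sigma> \<in> U \<sigma>" if "\<sigma> \<in> P" for \<sigma>
  proof -
    have "if j \<in> \<sigma> then g j (v \<sigma>) > 0 else g j (v \<sigma>) < 0" if j: "j \<in> J" for j
    proof -
      have "j \<in> \<sigma> \<longleftrightarrow> f j (v \<sigma>) \<ge> 0" using v[OF \<open>\<sigma> \<in> P\<close>] j by blast
      then show ?thesis using e(1) e(2)[OF \<open>\<sigma> \<in> P\<close> j] by (auto simp: g_def)
    qed
    moreover have "v \<sigma> i = 0" if "i \<notin> I" for i using that by (simp add: v_def)
    ultimately show ?thesis unfolding U_def using R(1)[OF that] by blast
  qed
  have UC: "U \<sigma> \<subseteq> C \<sigma>" for \<sigma> unfolding U_def C_def by (smt (verit) Collect_mono)
  have g: "multipoly I D (g j)" if "j \<in> J" for j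
    unfolding g_def by (intro multipoly_add multipoly_const f that I)
  \<comment> \<open>The same \<open>G\<close> serves all patterns, so the solutions found in the
    different regions solve one and the same gradient system; this is what allows them to be counted
    together.\<close>
  define G where "G = (\<lambda>x. (\<Prod>i\<in>I. (R - x i) * (R + x i)) * (\<Prod>j\<in>J. g j x))"
  have CU: "x \<in> U \<sigma>" if "x \<in> C \<sigma>" "G x \<noteq> 0" for x \<sigma>
  proof -
    have nz: "x i \<noteq> R" "x i \<noteq> - R" if "i \<in> I" for i
      using \<open>G x \<noteq> 0\<close> that I by (auto simp: G_def)
    have "\<bar>x i\<bar> < R" if "i \<in> I" for i
    proof -
      have "\<bar>x i\<bar> \<le> R" using \<open>x \<in> C \<sigma>\<close> that by (auto simp: C_def)
      then show ?thesis using nz[OF that] by (auto simp: abs_if split: if_splits)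
    qed
    moreover have "g j x \<noteq> 0" if "j \<in> J" for j using \<open>G x \<noteq> 0\<close> that J by (auto simp: G_def)
    ultimately show ?thesis using that(1) by (auto simp: U_def C_def less_le)
  qed
  have UG: "G x \<noteq> 0" if "x \<in> U \<sigma>" for x \<sigma>
  proof -
    have "g j x \<noteq> 0" if "j \<in> J" for j using \<open>x \<in> U \<sigma>\<close> that by (auto simp: U_def split: if_splits)
    moreover have "R - x i \<noteq> 0" "R + x i \<noteq> 0" if "i \<in> I" for i
      using \<open>x \<in> U \<sigma>\<close> that by (auto simp: U_def)
    ultimately show ?thesis using I J by (auto simp: G_def)
  qed
  have polyG: "multipoly I (2 * card I + card J * D) G"
  proof -
    have "multipoly I (1 + 1) (\<lambda>x. (R - x i) * (R + x i))" if "i \<in> I" for i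
      by (intro multipoly_mult multipoly_diff multipoly_add multipoly_const multipoly_var I that)
    then have "multipoly I (card I * 2) (\<lambda>x. \<Prod>i\<in>I. (R - x i) * (R + x i))"
      by (intro multipoly_prod I) (simp add: numeral_2_eq_2)
    from multipoly_mult[OF I this multipoly_prod[OF I, of J D g]] g show ?thesis
      by (simp add: G_def mult.commute)
  qed
  have "\<forall>i\<in>I. \<exists>h. multipoly I (2 * card I + card J * D) h \<and> (\<forall>x. ((\<lambda>t. G (x(i := t))) has_real_derivative h x) (at (x i)))"
    using multipoly_partial_derivative[OF I _ polyG] by blast
  then obtain dG where dG: "\<And>i. i \<in> I \<Longrightarrow> multipoly I (2 * card I + card J * D) (dG i)"
    "\<And>i x. i \<in> I \<Longrightarrow> ((\<lambda>t. G (x(i := t))) has_real_derivative dG i x) (at (x i))"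
    by metis
  have compC: "compact (C \<sigma>)" for \<sigma>
  proof -
    \<comment> \<open>Tychonoff: intervals at the coordinates in \<open>I\<close> and singletons
      elsewhere give a compact box in the product topology.\<close>
    define T where "T = (\<lambda>i. if i \<in> I then {-R..R} else {0::real})"
    have "compactin (product_topology (\<lambda>_. euclidean) UNIV) (PiE UNIV T)"
      by (subst compactin_PiE) (auto simp: T_def)
    then have "compact (PiE UNIV T)" by (simp add: euclidean_product_topology)
    moreover have "closed {x. if j \<in> \<sigma> then g j x \<ge> 0 else g j x \<le> 0}" if "j \<in> J" for j
      using continuous_on_multipoly[OF g[OF that], of UNIV]
      by (cases "j \<in> \<sigma>") (auto intro!: closed_Collect_le simp: continuous_on_const)
    then have "closed (\<Inter>j\<in>J. {x. if j \<in> \<sigma> then g j x \<ge> 0 else g j x \<le> 0})" by (intro closed_INT) auto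
    ultimately have "compact (PiE UNIV T \<inter> (\<Inter>j\<in>J. {x. if j \<in> \<sigma> then g j x \<ge> 0 else g j x \<le> 0}))"
      by (rule compact_Int_closed)
    also have "PiE UNIV T \<inter> (\<Inter>j\<in>J. {x. if j \<in> \<sigma> then g j x \<ge> 0 else g j x \<le> 0}) = C \<sigma>"
      unfolding C_def T_def PiE_UNIV_domain by (fastforce simp: Pi_iff abs_le_iff split: if_splits)
    finally show ?thesis .
  qed
  have inner: "\<forall>\<^sub>F t in nhds (x i). x(i := t) \<in> C \<sigma>" if "x \<in> C \<sigma>" "G x \<noteq> 0" and i: "i \<in> I" for x i \<sigma>
  proof -
    have xU: "x \<in> U \<sigma>" using CU that by blast
    have tend: "((\<lambda>t. g j (x(i := t))) \<longlongrightarrow> g j x) (nhds (x i))" if j: "j \<in> J" for j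
    proof -
      obtain h where "\<forall>x. ((\<lambda>t. g j (x(i := t))) has_real_derivative h x) (at (x i))"
        using multipoly_partial_derivative[OF I i g[OF j]] by blast
      then have "isCont (\<lambda>t. g j (x(i := t))) (x i)" using DERIV_isCont by blast
      then show ?thesis by (simp add: isCont_def tendsto_nhds_iff)
    qed
    have "\<forall>\<^sub>F t in nhds (x i). if j \<in> \<sigma> then g j (x(i := t)) > 0 else g j (x(i := t)) < 0" if j: "j \<in> J" for j
      using tend[OF j] xU j by (cases "j \<in> \<sigma>") (auto simp: U_def intro: order_tendstoD)
    then have "\<forall>\<^sub>F t in nhds (x i). \<forall>j\<in>J. if j \<in> \<sigma> then g j (x(i := t)) > 0 else g j (x(i := t)) < 0"
      by (intro eventually_ball_finite J) auto
    moreover have "\<forall>\<^sub>F t in nhds (x i). \<bar>t\<bar> < R"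
    proof -
      have "((\<lambda>t. \<bar>t\<bar>) \<longlongrightarrow> \<bar>x i\<bar>) (nhds (x i))" by (intro tendsto_intros filterlim_ident)
      then show ?thesis using xU i by (auto intro!: order_tendstoD simp: U_def)
    qed
    ultimately show ?thesis
    proof eventually_elim
      case (elim t)
      then have "x(i := t) \<in> U \<sigma>" using xU i by (auto simp: U_def)
      then show ?case using UC by blast
    qed
  qed
  obtain \<mu> where \<mu>: "\<mu> > 0" "\<And>\<sigma>. \<sigma> \<in> P \<Longrightarrow> \<mu> \<le> \<bar>G (v \<sigma>)\<bar>"
  proof -
    define S where "S = insert 1 ((\<lambda>\<sigma>. \<bar>G (v \<sigma>)\<bar>) ` P)"
    have S: "finite S" "S \<noteq> {}" using finP by (auto simp: S_def)
    show ?thesis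
    proof (rule that[of "Min S"])
      show "Min S > 0" using S UG[OF vU] by (auto simp: Min_gr_iff S_def)
      show "Min S \<le> \<bar>G (v \<sigma>)\<bar>" if "\<sigma> \<in> P" for \<sigma> using S that by (auto simp: S_def)
    qed
  qed
  \<comment> \<open>Chosen so that the tilt costs less than half of \<open>\<mu>\<close>, the least
    value of \<open>\<bar>G\<bar>\<close> at the witnesses (capped at 1). The added 1 keeps the
    denominator positive when \<open>I\<close> is empty.\<close>
  define \<eta> where "\<eta> = \<mu> / (4 * R * (real (card I) + 1))"
  have \<eta>: "\<eta> > 0" using \<mu> R(2) by (auto simp: \<eta>_def)
  have \<eta>\<mu>: "2 * (real (card I) * (\<eta> * R)) < \<mu>"
  proof -
    have "2 * (real (card I) * (\<eta> * R)) = \<mu> * (real (card I) / (2 * (real (card I) + 1)))"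
    proof -
      have "2 * (k * (\<mu> / (4 * R * c) * R)) = \<mu> * (k / (2 * c))" if "c > 0" for k c
        using R(2) that by (simp add: field_simps)
      from this[of "real (card I) + 1"] show ?thesis by (simp add: \<eta>_def)
    qed
    also have "\<dots> < \<mu> * 1" using \<mu> by (intro mult_strict_left_mono) (auto simp: field_simps)
    finally show ?thesis by simp
  qed
  have "card P \<le> (card I * (2 * card I + card J * D) + 1) ^ card I"
  proof (rule card_regions_le[OF I finP _ dG(1) _ \<eta>])
    show "disjoint_family_on U P"
      unfolding disjoint_family_on_def
    proof (intro ballI impI, rule ccontr)
      fix \<sigma> \<tau> assume *: "\<sigma> \<in> P" "\<tau> \<in> P" "\<sigma> \<noteq> \<tau>" "U \<sigma> \<inter> U \<tau> \<noteq> {}"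
      then obtain x where x: "x \<in> U \<sigma>" "x \<in> U \<tau>" by auto
      have "\<sigma> \<subseteq> J" "\<tau> \<subseteq> J" using * by (auto simp: P_def)
      moreover have "j \<in> \<sigma> \<longleftrightarrow> j \<in> \<tau>" if "j \<in> J" for j
      proof -
        have "if j \<in> \<sigma> then g j x > 0 else g j x < 0" "if j \<in> \<tau> then g j x > 0 else g j x < 0"
          using x that unfolding U_def by blast+
        then show ?thesis by (auto split: if_splits)
      qed
      ultimately show False using *(3) by blast
    qed
    fix \<sigma> assume \<sigma>: "\<sigma> \<in> P"
    show "x i = 0" if "x \<in> U \<sigma>" "i \<notin> I" for x i using that by (auto simp: U_def)
    fix y :: "'i \<Rightarrow> real" assume y: "\<And>i. i \<in> I \<Longrightarrow> \<bar>y i\<bar> \<le> \<eta>"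
    have "\<exists>x\<in>C \<sigma>. G x \<noteq> 0 \<and> (\<forall>i\<in>I. dG i x = y i)"
    proof (rule gradient_value_in_region[OF I compC, where s="sgn (G (v \<sigma>))" and R=R])
      show "v \<sigma> \<in> C \<sigma>" using vU[OF \<sigma>] UC by auto
      show "continuous_on (C \<sigma>) G" by (rule continuous_on_multipoly[OF polyG])
      show "2 * (real (card I) * (\<eta> * R)) < sgn (G (v \<sigma>)) * G (v \<sigma>)"
        using \<eta>\<mu> \<mu>(2)[OF \<sigma>] by (simp add: linordered_idom_class.abs_sgn mult.commute)
      show "\<bar>sgn (G (v \<sigma>))\<bar> = 1" using UG[OF vU[OF \<sigma>]] by (simp add: abs_sgn_eq)
    qed (use dG(2) inner y in \<open>auto simp: C_def\<close>)
    then show "\<exists>x\<in>U \<sigma>. \<forall>i\<in>I. dG i x = y i" using CU by blast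
  qed
  then show ?thesis unfolding P_def .
qed

section \<open>Covering numbers of ReLU networks\<close>

text \<open>A triple is (layer, unit, slot), with layers numbered from 1, slot 0 for the bias and
  slot \<open>Suc j\<close> for the weight of input \<open>j\<close>. A rectangular index set with
  the common width \<open>max d N\<close> covers the first layer and the later ones alike.\<close>

definition param_index :: "nat \<Rightarrow> nat \<Rightarrow> nat \<Rightarrow> (nat \<times> nat \<times> nat) set" where
  "param_index d L N = {1..Suc L} \<times> {..<N} \<times> {..max d N}"

definition net_weight :: "(nat \<times> nat \<times> nat \<Rightarrow> real) \<Rightarrow> nat \<Rightarrow> nat \<Rightarrow> nat \<Rightarrow> real" where
  "net_weight \<theta> k i j = \<theta> (k, i, Suc j)"

definition net_bias :: "(nat \<times> nat \<times> nat \<Rightarrow> real) \<Rightarrow> nat \<Rightarrow> nat \<Rightarrow> real" where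
  "net_bias \<theta> k i = \<theta> (k, i, 0)"

abbreviation "hidden d N \<theta> \<equiv> dnn_hidden d N (net_weight \<theta>) (net_bias \<theta>)"

definition net :: "nat \<Rightarrow> nat \<Rightarrow> nat \<Rightarrow> (nat \<times> nat \<times> nat \<Rightarrow> real) \<Rightarrow> (nat \<Rightarrow> real) \<Rightarrow> real" where
  "net d L N \<theta> = dnn_eval d L N (net_weight \<theta>) (net_bias \<theta>)"

definition preact :: "nat \<Rightarrow> nat \<Rightarrow> (nat \<times> nat \<times> nat \<Rightarrow> real) \<Rightarrow> nat \<Rightarrow> nat \<Rightarrow> (nat \<Rightarrow> real) \<Rightarrow> real" where
  "preact d N \<theta> k i z = (\<Sum>j<layer_in_dim d N k. net_weight \<theta> (Suc k) i j * z j) + net_bias \<theta> (Suc k) i"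

lemma hidden_Suc: "hidden d N \<theta> x (Suc k) = (\<lambda>i. if i < N then max 0 (preact d N \<theta> k i (hidden d N \<theta> x k)) else 0)"
  by (simp add: preact_def fun_eq_iff)

lemma net_eq: "net d L N \<theta> x = preact d N \<theta> L 0 (hidden d N \<theta> x L)"
  by (simp add: net_def dnn_eval_def preact_def)

lemma finite_param_index: "finite (param_index d L N)"
  by (simp add: param_index_def)

lemma param_index_memI:
  "k \<le> L \<Longrightarrow> i < N \<Longrightarrow> j \<le> layer_in_dim d N k \<Longrightarrow> (Suc k, i, j) \<in> param_index d L N"
  by (auto simp: param_index_def layer_in_dim_def split: if_splits)

lemma F_DNN_eq: "F_DNN d L N = range (net d L N)"
proof -
  have "dnn_eval d L N W b = net d L N (\<lambda>(k, i, j). case j of 0 \<Rightarrow> b k i | Suc j \<Rightarrow> W k i j)" for W b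
    unfolding net_def net_weight_def net_bias_def by simp
  then show ?thesis unfolding F_DNN_def by (auto simp: net_def)
qed

text \<open>Replacing each ReLU by a fixed switch turns a piecewise polynomial function of the
  parameters into a polynomial, whose degree bound grows by one per layer.\<close>

fun gated :: "nat \<Rightarrow> nat \<Rightarrow> (nat \<times> nat) set \<Rightarrow> (nat \<Rightarrow> real) \<Rightarrow> (nat \<times> nat \<times> nat \<Rightarrow> real) \<Rightarrow> nat \<Rightarrow> nat \<Rightarrow> real" where
  "gated d N \<gamma> x \<theta> 0 = x"
| "gated d N \<gamma> x \<theta> (Suc k) = (\<lambda>i. if i < N \<and> (k, i) \<in> \<gamma> then preact d N \<theta> k i (gated d N \<gamma> x \<theta> k) else 0)"

lemma multipoly_preact:
  assumes "k \<le> L" "i < N" "\<And>j. multipoly (param_index d L N) D (\<lambda>\<theta>. z \<theta> j)"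
  shows "multipoly (param_index d L N) (Suc D) (\<lambda>\<theta>. preact d N \<theta> k i (z \<theta>))"
proof -
  have var: "multipoly (param_index d L N) 1 (\<lambda>\<theta>. \<theta> (Suc k, i, j))" if "j \<le> layer_in_dim d N k" for j
    using assms that by (intro multipoly_var finite_param_index param_index_memI)
  have "multipoly (param_index d L N) (1 + D) (\<lambda>\<theta>. \<theta> (Suc k, i, Suc j) * z \<theta> j)" if "j < layer_in_dim d N k" for j
    using that by (intro multipoly_mult finite_param_index var assms) auto
  moreover have "multipoly (param_index d L N) (Suc D) (\<lambda>\<theta>. \<theta> (Suc k, i, 0))"
    using var[of 0] by (intro multipoly_mono[OF finite_param_index _ var]) auto
  ultimately show ?thesis
    unfolding preact_def net_weight_def net_bias_def by (intro multipoly_add multipoly_sum) auto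
qed

lemma multipoly_gated:
  assumes "k \<le> L" shows "multipoly (param_index d L N) k (\<lambda>\<theta>. gated d N \<gamma> x \<theta> k i)"
  using assms
proof (induction k arbitrary: i)
  case 0
  then show ?case by (simp add: multipoly_const finite_param_index)
next
  case (Suc k)
  show ?case
  proof (cases "i < N \<and> (k, i) \<in> \<gamma>")
    case True
    then have "multipoly (param_index d L N) (Suc k) (\<lambda>\<theta>. preact d N \<theta> k i (gated d N \<gamma> x \<theta> k))"
      using Suc by (intro multipoly_preact) auto
    with True show ?thesis by simp
  next
    case False
    then show ?thesis by (auto simp: multipoly_const finite_param_index)
  qed
qed

section \<open>Counting activation and threshold patterns\<close>

text \<open>The states of all units in the first \<open>K\<close> layers are recorded at all points
  of \<open>Q\<close> jointly. At pre-activation 0 both branches of the maximum agree, so the weak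
  inequality, which is the one counted by \<open>card_sign_patterns_le\<close>, describes the
  network correctly.\<close>

definition activation_pattern ::
  "nat \<Rightarrow> nat \<Rightarrow> (nat \<Rightarrow> real) set \<Rightarrow> nat \<Rightarrow> (nat \<times> nat \<times> nat \<Rightarrow> real) \<Rightarrow> (nat \<times> nat \<times> (nat \<Rightarrow> real)) set" where
  "activation_pattern d N Q K \<theta> =
     {(k, i, x). k < K \<and> i < N \<and> x \<in> Q \<and> preact d N \<theta> k i (hidden d N \<theta> x k) \<ge> 0}"

definition gates :: "(nat \<times> nat \<times> (nat \<Rightarrow> real)) set \<Rightarrow> (nat \<Rightarrow> real) \<Rightarrow> (nat \<times> nat) set" where
  "gates \<Gamma> x = {(k, i). (k, i, x) \<in> \<Gamma>}"

lemma hidden_eq_gated: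
  assumes "k \<le> K" "x \<in> Q"
  shows "hidden d N \<theta> x k = gated d N (gates (activation_pattern d N Q K \<theta>) x) x \<theta> k"
  using assms(1)
proof (induction k)
  case (Suc k)
  then have "hidden d N \<theta> x k = gated d N (gates (activation_pattern d N Q K \<theta>) x) x \<theta> k" by simp
  note eq = this[symmetric]
  show ?case unfolding hidden_Suc gated.simps eq
    using assms(2) Suc.prems by (auto simp: fun_eq_iff gates_def activation_pattern_def)
qed simp

lemma card_range_refine:
  assumes "finite (range g)" "\<And>\<gamma>. \<gamma> \<in> range g \<Longrightarrow> card (f ` {\<theta>. g \<theta> = \<gamma>}) \<le> B"
  shows "card (range f) \<le> card (range g) * B"
proof -
  have "range f = (\<Union>\<gamma>\<in>range g. f ` {\<theta>. g \<theta> = \<gamma>})" by auto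
  then have "card (range f) \<le> (\<Sum>\<gamma>\<in>range g. card (f ` {\<theta>. g \<theta> = \<gamma>}))"
    using card_UN_le[OF assms(1), of "\<lambda>\<gamma>. f ` {\<theta>. g \<theta> = \<gamma>}"] by simp
  also have "\<dots> \<le> (\<Sum>\<gamma>\<in>range g. B)" by (intro sum_mono assms(2))
  finally show ?thesis by simp
qed

lemma finite_range_activation_pattern:
  assumes "finite Q" shows "finite (range (activation_pattern d N Q K))"
  by (rule finite_subset[of _ "Pow ({..<K} \<times> {..<N} \<times> Q)"])
    (use assms in \<open>auto simp: activation_pattern_def\<close>)

text \<open>Once the gates of the earlier layers are fixed, the \<open>N * card Q\<close>
  pre-activations of the next layer are polynomials in the parameters with degree bound at most
  \<open>Suc L\<close>. Each layer therefore refines every class of parameters into at most as many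
  classes as there are sign patterns.\<close>

lemma card_activation_patterns_le:
  fixes d L N :: nat and Q :: "(nat \<Rightarrow> real) set"
  defines "W \<equiv> card (param_index d L N)"
  assumes Q: "finite Q" and "K \<le> L"
  shows "card (range (activation_pattern d N Q K)) \<le> ((W * (2 * W + N * card Q * Suc L) + 1) ^ W) ^ K"
  using assms(3)
proof (induction K)
  case 0
  have "range (activation_pattern d N Q 0) = {{}}" by (auto simp: activation_pattern_def)
  then show ?case by simp
next
  case (Suc K)
  define B where "B = (W * (2 * W + N * card Q * Suc L) + 1) ^ W"
  have "card (range (activation_pattern d N Q (Suc K))) \<le> card (range (activation_pattern d N Q K)) * B"
  proof (rule card_range_refine[OF finite_range_activation_pattern[OF Q]])
    fix \<gamma>
    define f where "f = (\<lambda>(i, x) \<theta>. preact d N \<theta> K i (gated d N (gates \<gamma> x) x \<theta> K))"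
    define S where "S = range (\<lambda>\<theta>. {j\<in>{..<N} \<times> Q. f j \<theta> \<ge> 0})"
    have finS: "finite S"
      unfolding S_def by (rule finite_subset[of _ "Pow ({..<N} \<times> Q)"]) (use Q in auto)
    \<comment> \<open>The polynomials \<open>f j\<close> have the gates of \<open>\<gamma>\<close>
      built in and agree with the true pre-activations only on the class of \<open>\<gamma>\<close>.
      Their sign patterns are nevertheless counted over all parameters, where the polynomial bound
      is available.\<close>
    have "activation_pattern d N Q (Suc K) ` {\<theta>. activation_pattern d N Q K \<theta> = \<gamma>}
       \<subseteq> (\<lambda>\<tau>. \<gamma> \<union> Pair K ` \<tau>) ` S"
    proof clarify
      fix \<theta> assume \<gamma>: "\<gamma> = activation_pattern d N Q K \<theta>"
      have "activation_pattern d N Q (Suc K) \<theta> = \<gamma> \<union> Pair K ` {j\<in>{..<N} \<times> Q. f j \<theta> \<ge> 0}"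
        using hidden_eq_gated[of K K _ Q d N \<theta>] \<gamma>
        by (auto simp: f_def activation_pattern_def less_Suc_eq image_iff)
      then show "activation_pattern d N Q (Suc K) \<theta> \<in> (\<lambda>\<tau>. activation_pattern d N Q K \<theta> \<union> Pair K ` \<tau>) ` S"
        unfolding S_def \<gamma> by blast
    qed
    then have "card (activation_pattern d N Q (Suc K) ` {\<theta>. activation_pattern d N Q K \<theta> = \<gamma>}) \<le> card S"
      using card_mono[OF finite_imageI[OF finS]] card_image_le[OF finS] by (meson order_trans)
    also have "\<dots> \<le> B"
    proof -
      have "card S \<le> (card (param_index d L N) * (2 * card (param_index d L N) + card ({..<N} \<times> Q) * Suc L) + 1) ^ card (param_index d L N)"
        unfolding S_def
      proof (rule card_sign_patterns_le)
        show "multipoly (param_index d L N) (Suc L) (f j)" if "j \<in> {..<N} \<times> Q" for j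
        proof -
          obtain i x where j: "j = (i, x)" by force
          have "multipoly (param_index d L N) (Suc K) (f j)"
            unfolding f_def j using that j Suc.prems by (auto intro!: multipoly_preact multipoly_gated)
          then show ?thesis by (rule multipoly_mono[OF finite_param_index, rotated]) (use Suc.prems in auto)
        qed
      qed (use Q finite_param_index in auto)
      then show ?thesis by (simp add: B_def W_def card_cartesian_product)
    qed
    finally show "card (activation_pattern d N Q (Suc K) ` {\<theta>. activation_pattern d N Q K \<theta> = \<gamma>}) \<le> B" .
  qed
  also have "\<dots> \<le> B ^ K * B" using Suc by (intro mult_right_mono) (auto simp: B_def)
  finally show ?case unfolding B_def by (simp add: mult.commute)
qed

text \<open>The output layer contributes the polynomials \<open>net - t\<close>, one for each point
  and threshold, hence one more factor after the \<open>L\<close> hidden layers. Comparison with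
  thresholds turns closeness of real outputs into equality of sign patterns.\<close>

lemma card_threshold_patterns_le:
  fixes d L N :: nat and Q :: "(nat \<Rightarrow> real) set" and T :: "real set"
  defines "W \<equiv> card (param_index d L N)"
  assumes Q: "finite Q" and T: "finite T" and N: "0 < N"
  shows "card (range (\<lambda>\<theta>. {(x, t)\<in>Q \<times> T. t \<le> net d L N \<theta> x})) \<le>
    ((W * (2 * W + N * card Q * Suc L) + 1) ^ W) ^ L * (W * (2 * W + card Q * card T * Suc L) + 1) ^ W"
proof -
  define B where "B = (W * (2 * W + card Q * card T * Suc L) + 1) ^ W"
  have "card (range (\<lambda>\<theta>. {(x, t)\<in>Q \<times> T. t \<le> net d L N \<theta> x})) \<le> card (range (activation_pattern d N Q L)) * B"
  proof (rule card_range_refine[OF finite_range_activation_pattern[OF Q]])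
    fix \<gamma>
    define f where "f = (\<lambda>(x, t) \<theta>. preact d N \<theta> L 0 (gated d N (gates \<gamma> x) x \<theta> L) - t)"
    define S where "S = range (\<lambda>\<theta>. {j\<in>Q \<times> T. f j \<theta> \<ge> 0})"
    have finS: "finite S"
      unfolding S_def by (rule finite_subset[of _ "Pow (Q \<times> T)"]) (use Q T in auto)
    have "(\<lambda>\<theta>. {(x, t)\<in>Q \<times> T. t \<le> net d L N \<theta> x}) ` {\<theta>. activation_pattern d N Q L \<theta> = \<gamma>} \<subseteq> S"
    proof clarify
      fix \<theta> assume \<gamma>: "\<gamma> = activation_pattern d N Q L \<theta>"
      have "{(x, t)\<in>Q \<times> T. t \<le> net d L N \<theta> x} = {j\<in>Q \<times> T. f j \<theta> \<ge> 0}"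
        using hidden_eq_gated[of L L _ Q d N \<theta>] \<gamma> by (auto simp: f_def net_eq)
      then show "{(x, t)\<in>Q \<times> T. t \<le> net d L N \<theta> x} \<in> S" unfolding S_def by blast
    qed
    then have "card ((\<lambda>\<theta>. {(x, t)\<in>Q \<times> T. t \<le> net d L N \<theta> x}) ` {\<theta>. activation_pattern d N Q L \<theta> = \<gamma>}) \<le> card S"
      using card_mono[OF finS] by blast
    also have "\<dots> \<le> (card (param_index d L N) * (2 * card (param_index d L N) + card (Q \<times> T) * Suc L) + 1) ^ card (param_index d L N)"
      unfolding S_def
    proof (rule card_sign_patterns_le)
      show "multipoly (param_index d L N) (Suc L) (f j)" if "j \<in> Q \<times> T" for j
        unfolding f_def using that N
        by (auto intro!: multipoly_diff multipoly_const multipoly_preact multipoly_gated finite_param_index)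
    qed (use Q T finite_param_index in auto)
    also have "\<dots> = B" by (simp add: B_def W_def card_cartesian_product)
    finally show "card ((\<lambda>\<theta>. {(x, t)\<in>Q \<times> T. t \<le> net d L N \<theta> x}) ` {\<theta>. activation_pattern d N Q L \<theta> = \<gamma>}) \<le> B" .
  qed
  also have "\<dots> \<le> ((W * (2 * W + N * card Q * Suc L) + 1) ^ W) ^ L * B"
    unfolding W_def by (intro mult_right_mono card_activation_patterns_le Q) auto
  finally show ?thesis by (simp add: B_def)
qed

section \<open>Size of the sup-norm cover\<close>

lemma trunc_eq: "0 \<le> M \<Longrightarrow> trunc M h = max (- M) (min h M)"
  by (auto simp: trunc_def sgn_if min_def max_def abs_if)

lemma trunc_close:
  assumes "0 \<le> M" "0 < \<epsilon>"
    and "\<And>j. j \<le> nat \<lfloor>2 * M / \<epsilon>\<rfloor> \<Longrightarrow> - M + real j * \<epsilon> \<le> a \<longleftrightarrow> - M + real j * \<epsilon> \<le> b"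
  shows "\<bar>trunc M a - trunc M b\<bar> \<le> \<epsilon>"
proof -
  have *: "trunc M b - trunc M a \<le> \<epsilon>"
    if "\<And>j. j \<le> nat \<lfloor>2 * M / \<epsilon>\<rfloor> \<Longrightarrow> - M + real j * \<epsilon> \<le> a \<longleftrightarrow> - M + real j * \<epsilon> \<le> b" for a b
  proof (rule ccontr)
    assume gt: "\<not> trunc M b - trunc M a \<le> \<epsilon>"
    define r where "r = (trunc M b + M) / \<epsilon>"
    \<comment> \<open>Index of the last grid point not above \<open>trunc M b\<close>. If the gap
      exceeded \<open>\<epsilon>\<close>, this grid point would lie above \<open>a\<close> but not
      above \<open>b\<close>.\<close>
    define j where "j = nat \<lfloor>r\<rfloor>"
    have r: "0 \<le> r" "r \<le> 2 * M / \<epsilon>"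
      using assms by (auto simp: r_def trunc_eq divide_right_mono)
    have j: "real j \<le> r" "r < real j + 1" using r by (auto simp: j_def)
    have "j \<le> nat \<lfloor>2 * M / \<epsilon>\<rfloor>" unfolding j_def using r by (intro nat_mono floor_mono)
    note iff = that[OF this]
    have "real j * \<epsilon> \<le> r * \<epsilon>" "r * \<epsilon> < (real j + 1) * \<epsilon>" using j assms by auto
    moreover have "r * \<epsilon> = trunc M b + M" using assms by (simp add: r_def)
    ultimately have "- M + real j * \<epsilon> \<le> trunc M b" "trunc M b < - M + real j * \<epsilon> + \<epsilon>"
      by (auto simp: algebra_simps)
    with gt iff assms show False
      by (auto simp: trunc_eq max_def min_def split: if_splits)
  qed
  show ?thesis using *[of a b] *[of b a] assms(3) by (auto simp: abs_le_iff)
qed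

text \<open>Since e is at most 3, the lower bounds 3 on \<open>N\<close> and \<open>n\<close> make
  both logarithms in \<open>delta_s\<close> at least 1, so that sums of logarithms and constants can
  be absorbed into their product.\<close>

lemma one_le_ln: "3 \<le> x \<Longrightarrow> 1 \<le> ln (x::real)"
  using exp_le ln_ge_iff[of x 1] by linarith

lemma card_param_index_le:
  assumes "1 \<le> d" "1 \<le> L" "1 \<le> N"
  shows "card (param_index d L N) \<le> 4 * (d * L * N) * N"
proof -
  have "max d N + 1 \<le> 2 * (d * N)"
  proof -
    have "max d N \<le> d * N" using assms by (intro max.boundedI) auto
    moreover have "1 * 1 \<le> d * N" using assms by (intro mult_mono) auto
    ultimately show ?thesis by linarith
  qed
  then have "Suc L * (N * (max d N + 1)) \<le> (2 * L) * (N * (2 * (d * N)))"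
    using assms by (intro mult_mono) auto
  then show ?thesis by (simp add: param_index_def card_cartesian_product mult_ac)
qed

lemma delta_s_power2:
  assumes "1 \<le> d" "1 \<le> L" "1 \<le> N" "1 \<le> n"
  shows "real n * (delta_s d L N n)\<^sup>2 = real d * (real L)\<^sup>2 * (real N)\<^sup>2 * ln (real (d * L * N)) * ln (real n)"
proof -
  have "1 \<le> d * L * N" using assms by auto
  then have "0 \<le> ln (real (d * L * N))" "0 \<le> ln (real n)" using assms by (simp_all only: ln_ge_zero real_of_nat_ge_one_iff)
  then show ?thesis using assms by (simp add: delta_s_def power_mult_distrib)
qed

text \<open>The cover is a colouring \<open>\<kappa>\<close> of the parameters: equal colours mean
  outputs within \<open>1 / n\<close> at all points of \<open>Q\<close>. This mesh costs only a
  factor of order \<open>n\<close> in the number of thresholds, that is \<open>ln n\<close> in the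
  exponent, and changes a sum of \<open>n\<close> losses by a bounded amount. \<open>Q\<close> may
  have \<open>2 * n\<close> points, to hold a sample and its ghost.\<close>

lemma network_cover:
  fixes M :: real
  assumes dim: "1 \<le> d" "1 \<le> L" "3 \<le> N" "3 \<le> n" and M: "1 \<le> M" and Q: "finite Q" "card Q \<le> 2 * n"
  shows "\<exists>\<kappa> :: (nat \<times> nat \<times> nat \<Rightarrow> real) \<Rightarrow> ((nat \<Rightarrow> real) \<times> real) set.
    finite (range \<kappa>) \<and>
    real (card (range \<kappa>)) \<le> exp (8 * (ln (81 * M) + 6) * (real n * (delta_s d L N n)\<^sup>2)) \<and>
    (\<forall>\<theta> \<theta>'. \<kappa> \<theta> = \<kappa> \<theta>' \<longrightarrow>
       (\<forall>x\<in>Q. \<bar>trunc M (net d L N \<theta> x) - trunc M (net d L N \<theta>' x)\<bar> \<le> 1 / real n))"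
proof -
  define J where "J = nat \<lfloor>2 * M / (1 / real n)\<rfloor>"
  define T where "T = (\<lambda>j. - M + real j * (1 / real n)) ` {..J}"
  define \<kappa> where "\<kappa> = (\<lambda>\<theta>. {(x, t)\<in>Q \<times> T. t \<le> net d L N \<theta> x})"
  have finT: "finite T" by (simp add: T_def)
  have "finite (range \<kappa>)"
    by (rule finite_subset[of _ "Pow (Q \<times> T)"]) (use Q finT in \<open>auto simp: \<kappa>_def\<close>)
  moreover have "\<bar>trunc M (net d L N \<theta> x) - trunc M (net d L N \<theta>' x)\<bar> \<le> 1 / real n"
    if "\<kappa> \<theta> = \<kappa> \<theta>'" "x \<in> Q" for \<theta> \<theta>' x
  proof (rule trunc_close)
    fix j assume "j \<le> nat \<lfloor>2 * M / (1 / real n)\<rfloor>"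
    then have "- M + real j * (1 / real n) \<in> T" by (auto simp: T_def J_def)
    moreover have "(x, t) \<in> \<kappa> \<theta> \<longleftrightarrow> (x, t) \<in> \<kappa> \<theta>'" for t using that by simp
    ultimately show "- M + real j * (1 / real n) \<le> net d L N \<theta> x \<longleftrightarrow> - M + real j * (1 / real n) \<le> net d L N \<theta>' x"
      using \<open>x \<in> Q\<close> by (auto simp: \<kappa>_def)
  qed (use M dim in auto)
  moreover have "real (card (range \<kappa>)) \<le> exp (8 * (ln (81 * M) + 6) * (real n * (delta_s d L N n)\<^sup>2))"
  proof -
    define W where "W = card (param_index d L N)"
    define S where "S = d * L * N"
    \<comment> \<open>Common base for hidden and output layers. With \<open>W\<close> at most
      \<open>4 * S^2\<close>, the bracket \<open>2 * W + y\<close> is at most (8 + 12) * M * S^2 *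
      n^2; multiplying by \<open>W\<close> gives the factor 80, and the added 1 makes it 81.\<close>
    define B where "B = 81 * M * real S ^ 4 * (real n)\<^sup>2"
    have NS: "N \<le> S" "L * N \<le> S" using dim by (auto simp: S_def)
    have S3: "3 \<le> real S" using NS dim by linarith
    have n3: "3 \<le> real n" using dim by simp
    have W: "W \<le> 4 * S * N" unfolding W_def S_def using dim card_param_index_le[of d L N] by simp
    also have "\<dots> \<le> 4 * S * S" using NS by (intro mult_left_mono) auto
    finally have WS: "real W \<le> 4 * (real S)\<^sup>2"
      by (metis (mono_tags, lifting) of_nat_le_iff of_nat_mult of_nat_numeral power2_eq_square mult.assoc)
    have base: "real (W * (2 * W + y) + 1) \<le> B" if y: "real y \<le> 12 * M * real S * (real n)\<^sup>2" for y
    proof -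
      have a1: "(real S)\<^sup>2 \<le> M * (real S)\<^sup>2 * (real n)\<^sup>2"
      proof -
        have "1 * 1 \<le> M * (real n)\<^sup>2" using M n3 by (intro mult_mono) auto
        then have "(real S)\<^sup>2 * 1 \<le> (real S)\<^sup>2 * (M * (real n)\<^sup>2)" by (intro mult_left_mono) auto
        then show ?thesis by (simp add: mult_ac)
      qed
      have a2: "M * real S * (real n)\<^sup>2 \<le> M * (real S)\<^sup>2 * (real n)\<^sup>2"
        using M S3 by (intro mult_right_mono mult_left_mono) (auto simp: power2_eq_square)
      have "real (2 * W + y) \<le> 20 * (M * (real S)\<^sup>2 * (real n)\<^sup>2)"
        using y a1 a2 WS by simp
      then have "real W * real (2 * W + y) \<le> (4 * (real S)\<^sup>2) * (20 * (M * (real S)\<^sup>2 * (real n)\<^sup>2))"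
        using WS by (intro mult_mono) auto
      also have "\<dots> = 80 * (M * real S ^ 4 * (real n)\<^sup>2)" by (simp add: power2_eq_square power4_eq_xxxx)
      finally have "real W * real (2 * W + y) \<le> 80 * (M * real S ^ 4 * (real n)\<^sup>2)" .
      moreover have "1 * 1 * 1 \<le> M * real S ^ 4 * (real n)\<^sup>2"
        using M S3 n3 by (intro mult_mono) auto
      ultimately show ?thesis by (simp add: B_def)
    qed
    have L: "real (Suc L) \<le> 2 * real L" using dim by simp
    have Mn: "M * real n \<ge> 1 * 1" using M n3 by (intro mult_mono) auto
    have LS: "real L * 1 \<le> real S" "real N * real L \<le> real S"
      using NS dim by (auto simp: S_def of_nat_mult[symmetric] simp del: of_nat_mult)
    have y1: "real (N * card Q * Suc L) \<le> 12 * M * real S * (real n)\<^sup>2"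
    proof -
      have "real (N * card Q * Suc L) = real N * real (card Q) * real (Suc L)" by (simp only: of_nat_mult)
      also have "\<dots> \<le> real N * (2 * real n) * (2 * real L)"
        using Q L by (intro mult_mono) (auto simp del: of_nat_Suc)
      also have "\<dots> = 4 * ((real N * real L) * real n)" by simp
      also have "\<dots> \<le> 4 * (real S * real n)" using LS by (intro mult_left_mono mult_right_mono) auto
      also have "\<dots> = 4 * (real S * real n) * 1" by simp
      also have "\<dots> \<le> 4 * (real S * real n) * (M * real n)" using Mn by (intro mult_left_mono) auto
      also have "\<dots> \<le> 12 * M * real S * (real n)\<^sup>2" using M by (simp add: power2_eq_square)
      finally show ?thesis .
    qed
    have cT: "real (card T) \<le> 3 * M * real n"
    proof -
      have "card T \<le> J + 1" unfolding T_def using card_image_le[of "{..J}"] by simp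
      moreover have "real J \<le> 2 * M * real n" unfolding J_def using M by simp
      ultimately show ?thesis using Mn by linarith
    qed
    have y2: "real (card Q * card T * Suc L) \<le> 12 * M * real S * (real n)\<^sup>2"
    proof -
      have "real (card Q * card T * Suc L) = real (card Q) * real (card T) * real (Suc L)" by (simp only: of_nat_mult)
      also have "\<dots> \<le> (2 * real n) * (3 * M * real n) * (2 * real S)"
        using Q L cT LS by (intro mult_mono) (auto simp del: of_nat_Suc)
      also have "\<dots> = 12 * M * real S * (real n)\<^sup>2" by (simp add: power2_eq_square)
      finally show ?thesis .
    qed
    have "0 < N" using dim by simp
    have "real (card (range \<kappa>)) \<le> real (((W * (2 * W + N * card Q * Suc L) + 1) ^ W) ^ L * (W * (2 * W + card Q * card T * Suc L) + 1) ^ W)"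
      unfolding \<kappa>_def W_def by (intro of_nat_mono card_threshold_patterns_le Q finT \<open>0 < N\<close>)
    also have "\<dots> = (real (W * (2 * W + N * card Q * Suc L) + 1) ^ W) ^ L * real (W * (2 * W + card Q * card T * Suc L) + 1) ^ W"
      by simp
    also have "\<dots> \<le> (B ^ W) ^ L * B ^ W"
    proof -
      have "0 \<le> B" using M by (simp add: B_def)
      then show ?thesis by (intro mult_mono power_mono base y1 y2) auto
    qed
    also have "\<dots> = B ^ (W * Suc L)" by (simp add: power_mult[symmetric] power_add[symmetric] add.commute)
    also have "\<dots> = exp (real (W * Suc L) * ln B)"
    proof -
      have "B > 0" using M S3 n3 by (auto simp: B_def intro!: mult_pos_pos)
      then show ?thesis by (metis exp_ln exp_of_nat_mult)
    qed
    also have "\<dots> \<le> exp (8 * (ln (81 * M) + 6) * (real n * (delta_s d L N n)\<^sup>2))"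
    proof -
      define s where "s = ln (real S)"
      define t where "t = ln (real n)"
      have st: "1 \<le> s" "1 \<le> t" using S3 n3 one_le_ln by (auto simp: s_def t_def)
      have m: "0 \<le> ln (81 * M)" using M by (intro ln_ge_zero) auto
      have "ln B = ln (81 * M) + 4 * s + 2 * t"
        using M S3 n3 unfolding B_def s_def t_def by (simp add: ln_mult ln_realpow del: ln_mult_pos)
      \<comment> \<open>As \<open>s\<close> and \<open>t\<close> are at least 1, each summand is at
        most its coefficient times \<open>s * t\<close>, and 4 + 2 = 6.\<close>
      also have "\<dots> \<le> (ln (81 * M) + 6) * (s * t)"
      proof -
        have "1 * 1 \<le> s * t" using st by (intro mult_mono) auto
        then have "ln (81 * M) * 1 \<le> ln (81 * M) * (s * t)" using m by (intro mult_left_mono) auto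
        moreover have "s * 1 \<le> s * t" "1 * t \<le> s * t" using st by (intro mult_mono; auto)+
        ultimately show ?thesis by (simp add: distrib_right)
      qed
      finally have lnB: "ln B \<le> (ln (81 * M) + 6) * (s * t)" .
      have "real (W * Suc L) = real W * real (Suc L)" by (simp only: of_nat_mult)
      also have "\<dots> \<le> (4 * real S * real N) * (2 * real L)"
      proof (intro mult_mono)
        have "real W \<le> real (4 * S * N)" using W by (simp only: of_nat_le_iff)
        then show "real W \<le> 4 * real S * real N" by simp
      qed (use L in auto)
      finally have "real (W * Suc L) \<le> 8 * (real d * (real L)\<^sup>2 * (real N)\<^sup>2)"
        by (simp add: S_def power2_eq_square mult_ac)
      then have "real (W * Suc L) * ln B \<le> 8 * (real d * (real L)\<^sup>2 * (real N)\<^sup>2) * ((ln (81 * M) + 6) * (s * t))"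
        using m st by (intro order_trans[OF mult_left_mono[OF lnB]] mult_right_mono) auto
      also have "\<dots> = 8 * (ln (81 * M) + 6) * (real n * (delta_s d L N n)\<^sup>2)"
        using delta_s_power2[of d L N n] dim by (simp add: s_def t_def S_def mult_ac)
      finally show ?thesis by simp
    qed
    finally show ?thesis .
  qed
  ultimately show ?thesis by blast
qed

section \<open>Symmetrization with quadratic offset\<close>

lemma exp_add_exp_minus_le: "exp x + exp (- x) \<le> 2 * exp (x\<^sup>2)" for x :: real
proof -
  have *: "exp x + exp (- x) \<le> 2 * exp (x\<^sup>2)" if "0 \<le> x" for x :: real
  proof (cases "x \<le> 1")
    case True
    have "exp (- x) \<le> 1 / (1 + x)"
      using exp_ge_add_one_self[of x] that by (simp add: exp_minus field_simps)
    also have "\<dots> \<le> 1 - x + x\<^sup>2"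
    proof -
      have "1 \<le> (1 - x + x\<^sup>2) * (1 + x)"
        using that by (simp add: algebra_simps power2_eq_square)
      then show ?thesis using that by (simp add: divide_le_eq)
    qed
    finally have "exp x + exp (- x) \<le> 2 + 2 * x\<^sup>2" using exp_bound[OF that True] by simp
    then show ?thesis using exp_ge_add_one_self[of "x\<^sup>2"] by linarith
  next
    case False
    then have "x \<le> x\<^sup>2" by (simp add: power2_eq_square)
    moreover have "exp (- x) \<le> exp x" using that by simp
    ultimately show ?thesis by (smt (verit) exp_le_cancel_iff)
  qed
  show ?thesis using *[of x] *[of "- x"] by (cases "0 \<le> x") auto
qed

text \<open>The sum over all exchanges \<open>S\<close> factorizes over \<open>i\<close>. Each
  factor is \<open>2 * cosh D * exp (- V)\<close>, and \<open>cosh D\<close> is at most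
  \<open>exp (D^2)\<close>. As (p - q)^2 is at most 2 * (p^2 + q^2), the condition on
  \<open>lam\<close> is what makes \<open>D^2\<close> at most \<open>V\<close>.\<close>

lemma sign_average_le:
  fixes p q :: "nat \<Rightarrow> real"
  assumes "0 \<le> lam" "lam \<le> c / 2"
  shows "(\<Sum>S\<in>Pow {..<n}. exp (lam * (\<Sum>i<n. (if i \<in> S then q i - p i else p i - q i) - c * ((p i)\<^sup>2 + (q i)\<^sup>2)))) \<le> 2 ^ n"
proof -
  define f where "f = (\<lambda>i. exp (lam * (q i - p i - c * ((p i)\<^sup>2 + (q i)\<^sup>2))))"
  define g where "g = (\<lambda>i. exp (lam * (p i - q i - c * ((p i)\<^sup>2 + (q i)\<^sup>2))))"
  have "(\<Sum>S\<in>Pow {..<n}. exp (lam * (\<Sum>i<n. (if i \<in> S then q i - p i else p i - q i) - c * ((p i)\<^sup>2 + (q i)\<^sup>2))))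
      = (\<Sum>S\<in>Pow {..<n}. (\<Prod>i\<in>S. f i) * (\<Prod>i\<in>{..<n}-S. g i))"
  proof (intro sum.cong refl)
    fix S assume S: "S \<in> Pow {..<n}"
    then have S_fin: "finite S" using finite_subset by auto
    have "exp (lam * (\<Sum>i<n. (if i \<in> S then q i - p i else p i - q i) - c * ((p i)\<^sup>2 + (q i)\<^sup>2)))
      = (\<Prod>i<n. if i \<in> S then f i else g i)"
      unfolding sum_distrib_left exp_sum[OF finite_lessThan] f_def g_def by (intro prod.cong) auto
    also have "\<dots> = (\<Prod>i\<in>{..<n} - S. if i \<in> S then f i else g i) * (\<Prod>i\<in>S. if i \<in> S then f i else g i)"
      using S by (intro prod.subset_diff) auto
    also have "\<dots> = (\<Prod>i\<in>S. f i) * (\<Prod>i\<in>{..<n}-S. g i)"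
      by (subst mult.commute) (auto intro!: arg_cong2[of _ _ _ _ "(*)"] prod.cong)
    finally show "exp (lam * (\<Sum>i<n. (if i \<in> S then q i - p i else p i - q i) - c * ((p i)\<^sup>2 + (q i)\<^sup>2)))
      = (\<Prod>i\<in>S. f i) * (\<Prod>i\<in>{..<n}-S. g i)" .
  qed
  also have "\<dots> = (\<Prod>i<n. f i + g i)" by (rule prod_add[symmetric]) simp
  also have "\<dots> \<le> (\<Prod>i<n. 2)"
  proof (intro prod_mono conjI)
    fix i
    show "0 \<le> f i + g i" by (simp add: f_def g_def add_nonneg_nonneg)
    define D where "D = lam * (p i - q i)"
    define V where "V = lam * (c * ((p i)\<^sup>2 + (q i)\<^sup>2))"
    have "D\<^sup>2 \<le> V"
    proof -
      have "(p i - q i)\<^sup>2 \<le> 2 * ((p i)\<^sup>2 + (q i)\<^sup>2)"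
        using sum_squares_ge_zero[of "p i + q i" 0] by (simp add: power2_eq_square algebra_simps)
      then have "D\<^sup>2 \<le> lam\<^sup>2 * (2 * ((p i)\<^sup>2 + (q i)\<^sup>2))"
        by (simp add: D_def power_mult_distrib mult_left_mono)
      also have "\<dots> = lam * ((2 * lam) * ((p i)\<^sup>2 + (q i)\<^sup>2))" by (simp add: power2_eq_square)
      also have "\<dots> \<le> V" unfolding V_def using assms by (intro mult_left_mono mult_right_mono) auto
      finally show ?thesis .
    qed
    have "f i + g i = (exp D + exp (- D)) * exp (- V)"
      by (simp add: f_def g_def D_def V_def distrib_right exp_add[symmetric] algebra_simps)
    also have "\<dots> \<le> 2 * exp (D\<^sup>2) * exp (- V)" by (intro mult_right_mono exp_add_exp_minus_le) simp
    also have "\<dots> \<le> 2" using \<open>D\<^sup>2 \<le> V\<close> by (simp add: mult_exp_exp)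
    finally show "f i + g i \<le> 2" .
  qed
  finally show ?thesis by simp
qed

text \<open>Jensen's inequality, from the tangent of \<open>exp\<close> at the mean. The nonnegative
  integral on the right is the form in which a supremum over the class can be moved inside.\<close>

lemma (in prob_space) exp_expectation_le:
  assumes Y: "Y \<in> borel_measurable M" "\<And>x. x \<in> space M \<Longrightarrow> \<bar>Y x\<bar> \<le> (B::real)"
  shows "ennreal (exp (expectation Y)) \<le> (\<integral>\<^sup>+x. ennreal (exp (Y x)) \<partial>M)"
proof -
  have int: "integrable M Y" using Y by (intro integrable_const_bound[where B=B]) auto
  have int': "integrable M (\<lambda>x. exp (Y x))"
    using Y by (intro integrable_const_bound[where B="exp B"]) (auto intro!: AE_I2 simp: abs_le_iff)
  define m where "m = expectation Y"
  have "exp m = expectation (\<lambda>x. exp m * (1 + (Y x - m)))"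
    using int by (simp add: prob_space m_def)
  also have "\<dots> \<le> expectation (\<lambda>x. exp (Y x))"
  proof (intro integral_mono)
    fix x
    have "exp m * (1 + (Y x - m)) \<le> exp m * exp (Y x - m)"
      by (intro mult_left_mono exp_ge_add_one_self) auto
    then show "exp m * (1 + (Y x - m)) \<le> exp (Y x)" by (simp add: exp_diff)
  qed (use int int' in auto)
  finally have "ennreal (exp m) \<le> ennreal (expectation (\<lambda>x. exp (Y x)))" by (rule ennreal_leI)
  also have "\<dots> = (\<integral>\<^sup>+x. ennreal (exp (Y x)) \<partial>M)"
    using int' by (intro nn_integral_eq_integral[symmetric]) auto
  finally show ?thesis by (simp add: m_def)
qed

lemma integral_PiM_component:
  fixes g :: "'a \<Rightarrow> real"
  assumes "prob_space Q" "i \<in> I" "integrable Q g"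
  shows "integrable (PiM I (\<lambda>_. Q)) (\<lambda>\<omega>. g (\<omega> i))"
    and "(\<integral>\<omega>. g (\<omega> i) \<partial>PiM I (\<lambda>_. Q)) = (\<integral>z. g z \<partial>Q)"
proof -
  have d: "distr (PiM I (\<lambda>_. Q)) Q (\<lambda>\<omega>. \<omega> i) = Q"
    using distr_PiM_component[of I "\<lambda>_. Q" i] assms by auto
  have g: "g \<in> borel_measurable Q" using assms by simp
  have m: "(\<lambda>\<omega>. \<omega> i) \<in> measurable (PiM I (\<lambda>_. Q)) Q" using assms by simp
  show "integrable (PiM I (\<lambda>_. Q)) (\<lambda>\<omega>. g (\<omega> i))"
    using integrable_distr_eq[OF m g] d assms by simp
  show "(\<integral>\<omega>. g (\<omega> i) \<partial>PiM I (\<lambda>_. Q)) = (\<integral>z. g z \<partial>Q)"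
    using integral_distr[OF m g] d by simp
qed

text \<open>A ghost sample occupies the coordinates \<open>n, \<dots>, 2n - 1\<close>; exchanging \<open>\<omega> i\<close> with \<open>\<omega> (n + i)\<close> leaves
  the law invariant, and the quadratic offset makes the average over all exchanges at most the
  number of cells of the cover.\<close>

lemma nn_integral_swap:
  fixes S :: "nat set"
  assumes Q: "prob_space Q" and S: "S \<subseteq> {..<n}" and F: "F \<in> borel_measurable (PiM {..<2 * n} (\<lambda>_. Q))"
  defines "\<pi> \<equiv> \<lambda>i. if i \<in> S then i + n else if n \<le> i \<and> i - n \<in> S then i - n else i"
  shows "(\<integral>\<^sup>+\<omega>. F (\<lambda>i\<in>{..<2 * n}. \<omega> (\<pi> i)) \<partial>PiM {..<2 * n} (\<lambda>_. Q)) = (\<integral>\<^sup>+\<omega>. F \<omega> \<partial>PiM {..<2 * n} (\<lambda>_. Q))"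
proof -
  have "\<pi> (\<pi> i) = i" if "i \<in> {..<2 * n}" for i using that S by (auto simp: \<pi>_def)
  then have inj: "inj_on \<pi> {..<2 * n}" by (rule inj_on_inverseI)
  have pi: "\<pi> \<in> {..<2 * n} \<rightarrow> {..<2 * n}" using S by (force simp: \<pi>_def)
  have d: "distr (PiM {..<2 * n} (\<lambda>_. Q)) (PiM {..<2 * n} (\<lambda>_. Q)) (\<lambda>\<omega>. \<lambda>i\<in>{..<2 * n}. \<omega> (\<pi> i)) = PiM {..<2 * n} (\<lambda>_. Q)"
    using distr_PiM_reindex[of "{..<2 * n}" "\<lambda>_. Q", OF _ inj pi] Q by simp
  have m: "(\<lambda>\<omega>. \<lambda>i\<in>{..<2 * n}. \<omega> (\<pi> i)) \<in> measurable (PiM {..<2 * n} (\<lambda>_. Q)) (PiM {..<2 * n} (\<lambda>_. Q))"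
    using pi by (intro measurable_restrict measurable_component_singleton) auto
  have "(\<integral>\<^sup>+\<omega>. F \<omega> \<partial>PiM {..<2 * n} (\<lambda>_. Q))
    = (\<integral>\<^sup>+\<omega>. F \<omega> \<partial>distr (PiM {..<2 * n} (\<lambda>_. Q)) (PiM {..<2 * n} (\<lambda>_. Q)) (\<lambda>\<omega>. \<lambda>i\<in>{..<2 * n}. \<omega> (\<pi> i)))"
    using d by simp
  also have "\<dots> = (\<integral>\<^sup>+\<omega>. F (\<lambda>i\<in>{..<2 * n}. \<omega> (\<pi> i)) \<partial>PiM {..<2 * n} (\<lambda>_. Q))"
    using F m by (intro nn_integral_distr) auto
  finally show ?thesis ..
qed

text \<open>The population terms are means over the ghost sample, so Jensen's inequality replaces
  them by ghost values inside the exponential; averaging over exchanges then bounds its expectation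
  by \<open>exp H\<close>, up to the covering error. The family is countable to keep suprema
  measurable, and the cover may depend on the points \<open>\<omega>\<close>.\<close>

lemma symmetrized_deviation:
  fixes \<phi> :: "nat \<Rightarrow> 'a \<Rightarrow> real" and H u \<epsilon> b c :: real
  assumes Q: "prob_space Q" and c: "0 < c" and b: "0 \<le> b" and eps: "0 \<le> \<epsilon>"
    and meas: "\<And>k. \<phi> k \<in> borel_measurable Q"
    and bound: "\<And>k z. z \<in> space Q \<Longrightarrow> \<bar>\<phi> k z\<bar> \<le> b"
    and cover: "\<And>\<omega>. \<omega> \<in> space (PiM {..<2 * n} (\<lambda>_. Q)) \<Longrightarrow>
      \<exists>\<kappa> :: nat \<Rightarrow> 'c. finite (range \<kappa>) \<and> real (card (range \<kappa>)) \<le> exp H \<and>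
        (\<forall>k k'. \<kappa> k = \<kappa> k' \<longrightarrow> (\<forall>i<2 * n. \<bar>\<phi> k (\<omega> i) - \<phi> k' (\<omega> i)\<bar> \<le> \<epsilon>))"
  shows "\<exists>A\<in>sets (PiM {..<n} (\<lambda>_. Q)). measure (PiM {..<n} (\<lambda>_. Q)) A \<le> exp (- u) \<and>
    (\<forall>\<omega>\<in>space (PiM {..<n} (\<lambda>_. Q)) - A. \<forall>k.
      real n * ((\<integral>z. \<phi> k z \<partial>Q) - c * (\<integral>z. (\<phi> k z)\<^sup>2 \<partial>Q)) - (\<Sum>i<n. \<phi> k (\<omega> i) + c * (\<phi> k (\<omega> i))\<^sup>2)
        \<le> 2 * (H + u) / c + real n * \<epsilon> * (2 + 4 * c * b))"
proof -
  interpret Q: prob_space Q by fact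
  interpret product_sigma_finite "\<lambda>_::nat. Q" by standard
  let ?P1 = "PiM {..<n} (\<lambda>_. Q)"
  let ?P2 = "PiM {n..<2 * n} (\<lambda>_. Q)"
  let ?P = "PiM {..<2 * n} (\<lambda>_. Q)"
  interpret P1: prob_space ?P1 by (intro prob_space_PiM Q)
  interpret P2: prob_space ?P2 by (intro prob_space_PiM Q)
  interpret P: prob_space ?P by (intro prob_space_PiM Q)
  note meas[measurable]
  define lam where "lam = c / 2"
  \<comment> \<open>Price of replacing a function by its representative: each of the
    \<open>n\<close> summands of \<open>X\<close> moves by at most
    \<open>\<epsilon> * (2 + 4 * c * b)\<close>, from two linear and two quadratic terms.\<close>
  define err where "err = real n * \<epsilon> * (2 + 4 * c * b)"
  define V where "V = (\<lambda>k \<omega>. real n * ((\<integral>z. \<phi> k z \<partial>Q) - c * (\<integral>z. (\<phi> k z)\<^sup>2 \<partial>Q)) - (\<Sum>i<n. \<phi> k (\<omega> i) + c * (\<phi> k (\<omega> i))\<^sup>2))"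
  define X where "X = (\<lambda>k \<omega>. \<Sum>i<n. (\<phi> k (\<omega> (n + i)) - \<phi> k (\<omega> i)) - c * ((\<phi> k (\<omega> (n + i)))\<^sup>2 + (\<phi> k (\<omega> i))\<^sup>2))"
  define F where "F = (\<lambda>\<omega>. SUP k. ennreal (exp (lam * X k \<omega>)))"
  have lam: "0 < lam" "lam \<le> c / 2" using c by (auto simp: lam_def)
  have comp1[measurable]: "(\<lambda>\<omega>. \<phi> k (\<omega> i)) \<in> borel_measurable ?P1" if "i < n" for k i
    using that by (intro measurable_compose[OF _ meas] measurable_component_singleton) auto
  have comp[measurable]: "(\<lambda>\<omega>. \<phi> k (\<omega> i)) \<in> borel_measurable ?P" if "i < 2 * n" for k i
    using that by (intro measurable_compose[OF _ meas] measurable_component_singleton) auto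
  have V_meas[measurable]: "V k \<in> borel_measurable ?P1" for k
    unfolding V_def by (intro borel_measurable_diff borel_measurable_const borel_measurable_sum
        borel_measurable_add borel_measurable_times borel_measurable_power comp1) auto
  have X_meas[measurable]: "X k \<in> borel_measurable ?P" for k
    unfolding X_def by (intro borel_measurable_diff borel_measurable_const borel_measurable_sum
        borel_measurable_add borel_measurable_times borel_measurable_power comp) auto
  have F_meas[measurable]: "F \<in> borel_measurable ?P" unfolding F_def by measurable
  define A where "A = {\<omega> \<in> space ?P1. \<exists>k. (H + u) / lam + err < V k \<omega>}"
  have A_sets: "A \<in> sets ?P1" unfolding A_def by measurable

  \<comment> \<open>For a fixed sample, \<open>lam * V k\<close> is the mean of
    \<open>lam * X k\<close> over the ghost coordinates.\<close>
  have exp_V: "ennreal (exp (lam * V k \<omega>)) \<le> (\<integral>\<^sup>+\<omega>'. ennreal (exp (lam * X k (merge {..<n} {n..<2 * n} (\<omega>, \<omega>')))) \<partial>?P2)"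
    if \<omega>: "\<omega> \<in> space ?P1" for k \<omega>
  proof -
    define g where "g = (\<lambda>z. \<phi> k z - c * (\<phi> k z)\<^sup>2)"
    define const where "const = (\<Sum>i<n. \<phi> k (\<omega> i) + c * (\<phi> k (\<omega> i))\<^sup>2)"
    define Y where "Y = (\<lambda>\<omega>'. lam * ((\<Sum>i<n. g (\<omega>' (n + i))) - const))"
    have int_phi: "integrable Q (\<phi> k)" using bound by (intro Q.integrable_const_bound[where B=b]) auto
    have int_sq: "integrable Q (\<lambda>z. (\<phi> k z)\<^sup>2)"
      using bound b by (intro Q.integrable_const_bound[where B="b\<^sup>2"]) (auto intro!: AE_I2 simp: abs_le_square_iff[symmetric])
    have int_g: "integrable Q g" unfolding g_def using int_phi int_sq by simp
    have X_eq: "lam * X k (merge {..<n} {n..<2 * n} (\<omega>, \<omega>')) = Y \<omega>'" for \<omega>'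
    proof -
      have "X k (merge {..<n} {n..<2 * n} (\<omega>, \<omega>')) = (\<Sum>i<n. g (\<omega>' (n + i)) - (\<phi> k (\<omega> i) + c * (\<phi> k (\<omega> i))\<^sup>2))"
        unfolding X_def g_def by (intro sum.cong refl) (auto simp: merge_def algebra_simps)
      then show ?thesis by (simp add: Y_def const_def sum_subtractf)
    qed
    have "P2.expectation Y = lam * ((\<Sum>i<n. \<integral>z. g z \<partial>Q) - const)"
      unfolding Y_def using integral_PiM_component[OF Q _ int_g, of _ "{n..<2 * n}"]
      by (subst integral_mult_right_zero, subst Bochner_Integration.integral_diff, auto simp: P2.prob_space)
    also have "\<dots> = lam * V k \<omega>"
      unfolding V_def const_def g_def using int_phi int_sq by (simp add: algebra_simps)
    finally have EY: "P2.expectation Y = lam * V k \<omega>" .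
    have "ennreal (exp (P2.expectation Y)) \<le> (\<integral>\<^sup>+\<omega>'. ennreal (exp (Y \<omega>')) \<partial>?P2)"
    proof (rule P2.exp_expectation_le)
      have [measurable]: "g \<in> borel_measurable Q" unfolding g_def by measurable
      show "Y \<in> borel_measurable ?P2"
        unfolding Y_def by (intro borel_measurable_diff borel_measurable_const borel_measurable_sum borel_measurable_times) measurable
      fix \<omega>' assume \<omega>': "\<omega>' \<in> space ?P2"
      have "\<bar>g (\<omega>' (n + i))\<bar> \<le> b + c * b\<^sup>2" if "i < n" for i
      proof -
        have "\<omega>' (n + i) \<in> space Q" using \<omega>' that by (auto simp: space_PiM PiE_iff)
        from bound[OF this, of k] have "\<bar>\<phi> k (\<omega>' (n + i))\<bar> \<le> b" "(\<phi> k (\<omega>' (n + i)))\<^sup>2 \<le> b\<^sup>2"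
          using b by (auto simp: abs_le_square_iff[symmetric])
        then have "\<bar>\<phi> k (\<omega>' (n + i))\<bar> + c * (\<phi> k (\<omega>' (n + i)))\<^sup>2 \<le> b + c * b\<^sup>2"
          using c by (intro add_mono mult_left_mono) auto
        moreover have "0 \<le> c * (\<phi> k (\<omega>' (n + i)))\<^sup>2" using c by simp
        ultimately show ?thesis unfolding g_def by linarith
      qed
      then have "(\<Sum>i<n. \<bar>g (\<omega>' (n + i))\<bar>) \<le> (\<Sum>i<n. b + c * b\<^sup>2)" by (intro sum_mono) auto
      also have "\<dots> = real n * (b + c * b\<^sup>2)" by simp
      finally have "\<bar>\<Sum>i<n. g (\<omega>' (n + i))\<bar> \<le> real n * (b + c * b\<^sup>2)"
        using sum_abs[of "\<lambda>i. g (\<omega>' (n + i))" "{..<n}"] by linarith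
      then have "\<bar>(\<Sum>i<n. g (\<omega>' (n + i))) - const\<bar> \<le> real n * (b + c * b\<^sup>2) + \<bar>const\<bar>" by linarith
      then show "\<bar>Y \<omega>'\<bar> \<le> lam * (real n * (b + c * b\<^sup>2) + \<bar>const\<bar>)"
        unfolding Y_def using lam by (simp add: abs_mult mult_left_mono)
    qed
    then show ?thesis unfolding EY X_eq .
  qed

  have un: "{..<n} \<union> {n..<2 * n} = {..<2 * n}" by auto
  have "(\<integral>\<^sup>+\<omega>. (SUP k. ennreal (exp (lam * V k \<omega>))) \<partial>?P1)
    \<le> (\<integral>\<^sup>+\<omega>. (\<integral>\<^sup>+\<omega>'. F (merge {..<n} {n..<2 * n} (\<omega>, \<omega>')) \<partial>?P2) \<partial>?P1)"
  proof (intro nn_integral_mono SUP_least)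
    fix \<omega> k assume "\<omega> \<in> space ?P1"
    from exp_V[OF this, of k] show "ennreal (exp (lam * V k \<omega>)) \<le> (\<integral>\<^sup>+\<omega>'. F (merge {..<n} {n..<2 * n} (\<omega>, \<omega>')) \<partial>?P2)"
      by (rule order_trans) (auto intro!: nn_integral_mono SUP_upper simp: F_def)
  qed
  also have "\<dots> = (\<integral>\<^sup>+\<omega>. F \<omega> \<partial>?P)"
  proof -
    have "{..<n} \<inter> {n..<2 * n} = {}" by auto
    from product_nn_integral_fold[OF this, of F] F_meas show ?thesis unfolding un by simp
  qed
  also have "\<dots> \<le> ennreal (exp (H + lam * err))"
  proof -
    define sw where "sw = (\<lambda>S (\<omega>::nat \<Rightarrow> 'a). \<lambda>i\<in>{..<2 * n}. \<omega> (if i \<in> S then i + n else if n \<le> i \<and> i - n \<in> S then i - n else i))"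
    have X_sw: "X k (sw S \<omega>) = (\<Sum>i<n. (if i \<in> S then \<phi> k (\<omega> i) - \<phi> k (\<omega> (n + i)) else \<phi> k (\<omega> (n + i)) - \<phi> k (\<omega> i))
        - c * ((\<phi> k (\<omega> (n + i)))\<^sup>2 + (\<phi> k (\<omega> i))\<^sup>2))" if "S \<subseteq> {..<n}" for S k \<omega>
      unfolding X_def
    proof (intro sum.cong refl)
      fix i assume i: "i \<in> {..<n}"
      have "sw S \<omega> i = \<omega> (if i \<in> S then n + i else i)" "sw S \<omega> (n + i) = \<omega> (if i \<in> S then i else n + i)"
        using i that by (auto simp: sw_def add.commute)
      then show "(\<phi> k (sw S \<omega> (n + i)) - \<phi> k (sw S \<omega> i)) - c * ((\<phi> k (sw S \<omega> (n + i)))\<^sup>2 + (\<phi> k (sw S \<omega> i))\<^sup>2)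
        = (if i \<in> S then \<phi> k (\<omega> i) - \<phi> k (\<omega> (n + i)) else \<phi> k (\<omega> (n + i)) - \<phi> k (\<omega> i))
        - c * ((\<phi> k (\<omega> (n + i)))\<^sup>2 + (\<phi> k (\<omega> i))\<^sup>2)"
        by simp
    qed
    have sw_meas: "(\<lambda>\<omega>. F (sw S \<omega>)) \<in> borel_measurable ?P" if "S \<subseteq> {..<n}" for S
    proof -
      have "sw S \<in> measurable ?P ?P"
        unfolding sw_def using that by (intro measurable_restrict measurable_component_singleton) auto
      from measurable_compose[OF this F_meas] show ?thesis .
    qed
    have "2 ^ n * (\<integral>\<^sup>+\<omega>. F \<omega> \<partial>?P) = (\<Sum>S\<in>Pow {..<n}. (\<integral>\<^sup>+\<omega>. F \<omega> \<partial>?P))"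
      by (simp add: card_Pow)
    also have "\<dots> = (\<Sum>S\<in>Pow {..<n}. (\<integral>\<^sup>+\<omega>. F (sw S \<omega>) \<partial>?P))"
      unfolding sw_def using nn_integral_swap[OF Q _ F_meas] by (intro sum.cong refl) auto
    also have "\<dots> = (\<integral>\<^sup>+\<omega>. (\<Sum>S\<in>Pow {..<n}. F (sw S \<omega>)) \<partial>?P)"
      using sw_meas by (intro nn_integral_sum[symmetric]) auto
    also have "\<dots> \<le> (\<integral>\<^sup>+\<omega>. ennreal (2 ^ n * exp (H + lam * err)) \<partial>?P)"
    proof (intro nn_integral_mono)
      fix \<omega> assume \<omega>: "\<omega> \<in> space ?P"
      obtain \<kappa> :: "nat \<Rightarrow> 'c" where \<kappa>: "finite (range \<kappa>)" "real (card (range \<kappa>)) \<le> exp H"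
        "\<And>k k' i. \<kappa> k = \<kappa> k' \<Longrightarrow> i < 2 * n \<Longrightarrow> \<bar>\<phi> k (\<omega> i) - \<phi> k' (\<omega> i)\<bar> \<le> \<epsilon>"
        using cover[OF \<omega>] by blast
      \<comment> \<open>The cells belong to the full set of \<open>2 * n\<close> points, which
        exchanges only permute. One choice of representatives thus serves all \<open>S\<close>, and
        after swapping the two sums \<open>sign_average_le\<close> applies to each fixed
        representative.\<close>
      define rep where "rep = (\<lambda>\<gamma>. SOME k. \<kappa> k = \<gamma>)"
      have rep: "\<kappa> (rep (\<kappa> k)) = \<kappa> k" for k unfolding rep_def by (rule someI[of _ k]) simp
      have close: "lam * X k (sw S \<omega>) \<le> lam * err + lam * X (rep (\<kappa> k)) (sw S \<omega>)" if S: "S \<subseteq> {..<n}" for k S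
      proof -
        let ?r = "rep (\<kappa> k)"
        have lip: "\<bar>(p - q - c * (p\<^sup>2 + q\<^sup>2)) - (p' - q' - c * (p'\<^sup>2 + q'\<^sup>2))\<bar> \<le> \<epsilon> * (2 + 4 * c * b)"
          if "\<bar>p - p'\<bar> \<le> \<epsilon>" "\<bar>q - q'\<bar> \<le> \<epsilon>" "\<bar>p\<bar> \<le> b" "\<bar>p'\<bar> \<le> b" "\<bar>q\<bar> \<le> b" "\<bar>q'\<bar> \<le> b" for p q p' q'
        proof -
          have "\<bar>x\<^sup>2 - y\<^sup>2\<bar> \<le> \<epsilon> * (2 * b)" if "\<bar>x - y\<bar> \<le> \<epsilon>" "\<bar>x\<bar> \<le> b" "\<bar>y\<bar> \<le> b" for x y
          proof -
            have "\<bar>x\<^sup>2 - y\<^sup>2\<bar> = \<bar>x - y\<bar> * \<bar>x + y\<bar>"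
              by (simp add: abs_mult[symmetric] power2_eq_square algebra_simps)
            also have "\<dots> \<le> \<epsilon> * (2 * b)" using that eps by (intro mult_mono) auto
            finally show ?thesis .
          qed
          from this[of p p'] this[of q q'] that
          have "\<bar>(p\<^sup>2 - p'\<^sup>2) + (q\<^sup>2 - q'\<^sup>2)\<bar> \<le> 4 * (\<epsilon> * b)" by linarith
          then have "\<bar>c * ((p\<^sup>2 - p'\<^sup>2) + (q\<^sup>2 - q'\<^sup>2))\<bar> \<le> c * (4 * (\<epsilon> * b))"
            using c by (simp add: abs_mult mult_left_mono)
          moreover have "(p - q - c * (p\<^sup>2 + q\<^sup>2)) - (p' - q' - c * (p'\<^sup>2 + q'\<^sup>2))
             = (p - p') - (q - q') - c * ((p\<^sup>2 - p'\<^sup>2) + (q\<^sup>2 - q'\<^sup>2))" by (simp add: algebra_simps)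
          moreover have "\<epsilon> * (2 + 4 * c * b) = 2 * \<epsilon> + c * (4 * (\<epsilon> * b))" by (simp add: algebra_simps)
          ultimately show ?thesis using that(1,2) by linarith
        qed
        have "X k (sw S \<omega>) - X ?r (sw S \<omega>) \<le> (\<Sum>i<n. \<epsilon> * (2 + 4 * c * b))"
          unfolding X_def sum_subtractf[symmetric]
        proof (intro sum_mono)
          fix i assume i: "i \<in> {..<n}"
          have sw: "\<exists>j<2 * n. sw S \<omega> m = \<omega> j" if "m < 2 * n" for m
            using that S
            by (intro exI[of _ "if m \<in> S then m + n else if n \<le> m \<and> m - n \<in> S then m - n else m"])
              (auto simp: sw_def)
          have phi: "\<bar>\<phi> k (sw S \<omega> m) - \<phi> ?r (sw S \<omega> m)\<bar> \<le> \<epsilon>" "\<And>k. \<bar>\<phi> k (sw S \<omega> m)\<bar> \<le> b" if m: "m < 2 * n" for m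
          proof -
            obtain j where j: "j < 2 * n" "sw S \<omega> m = \<omega> j" using sw[OF m] by blast
            then have "\<omega> j \<in> space Q" using \<omega> by (auto simp: space_PiM PiE_iff)
            then show "\<bar>\<phi> k (sw S \<omega> m)\<bar> \<le> b" for k using bound j by simp
            show "\<bar>\<phi> k (sw S \<omega> m) - \<phi> ?r (sw S \<omega> m)\<bar> \<le> \<epsilon>" using \<kappa>(3)[of k ?r] rep j by simp
          qed
          have "i < 2 * n" "n + i < 2 * n" using i by auto
          from lip[OF phi(1)[OF this(2)] phi(1)[OF this(1)] phi(2)[OF this(2)] phi(2)[OF this(2)] phi(2)[OF this(1)] phi(2)[OF this(1)]]
          show "\<phi> k (sw S \<omega> (n + i)) - \<phi> k (sw S \<omega> i) - c * ((\<phi> k (sw S \<omega> (n + i)))\<^sup>2 + (\<phi> k (sw S \<omega> i))\<^sup>2) -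
            (\<phi> ?r (sw S \<omega> (n + i)) - \<phi> ?r (sw S \<omega> i) - c * ((\<phi> ?r (sw S \<omega> (n + i)))\<^sup>2 + (\<phi> ?r (sw S \<omega> i))\<^sup>2))
            \<le> \<epsilon> * (2 + 4 * c * b)" by linarith
        qed
        then have "X k (sw S \<omega>) \<le> err + X ?r (sw S \<omega>)" by (simp add: err_def mult.assoc)
        then have "lam * X k (sw S \<omega>) \<le> lam * (err + X ?r (sw S \<omega>))" using lam by (intro mult_left_mono) auto
        then show ?thesis by (simp add: distrib_left)
      qed
      have "(\<Sum>S\<in>Pow {..<n}. F (sw S \<omega>))
        \<le> (\<Sum>S\<in>Pow {..<n}. \<Sum>\<gamma>\<in>range \<kappa>. ennreal (exp (lam * err) * exp (lam * X (rep \<gamma>) (sw S \<omega>))))"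
      proof (intro sum_mono)
        fix S assume S: "S \<in> Pow {..<n}"
        show "F (sw S \<omega>) \<le> (\<Sum>\<gamma>\<in>range \<kappa>. ennreal (exp (lam * err) * exp (lam * X (rep \<gamma>) (sw S \<omega>))))"
          unfolding F_def
        proof (intro SUP_least)
          fix k
          have "ennreal (exp (lam * X k (sw S \<omega>))) \<le> ennreal (exp (lam * err) * exp (lam * X (rep (\<kappa> k)) (sw S \<omega>)))"
            using close[of S k] S by (intro ennreal_leI) (auto simp: exp_add[symmetric])
          also have "\<dots> \<le> (\<Sum>\<gamma>\<in>range \<kappa>. ennreal (exp (lam * err) * exp (lam * X (rep \<gamma>) (sw S \<omega>))))"
            by (rule member_le_sum[of "\<kappa> k" "range \<kappa>" "\<lambda>\<gamma>. ennreal (exp (lam * err) * exp (lam * X (rep \<gamma>) (sw S \<omega>)))"]) (use \<kappa>(1) in auto)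
          finally show "ennreal (exp (lam * X k (sw S \<omega>))) \<le> (\<Sum>\<gamma>\<in>range \<kappa>. ennreal (exp (lam * err) * exp (lam * X (rep \<gamma>) (sw S \<omega>))))" .
        qed
      qed
      also have "\<dots> = ennreal (\<Sum>S\<in>Pow {..<n}. \<Sum>\<gamma>\<in>range \<kappa>. exp (lam * err) * exp (lam * X (rep \<gamma>) (sw S \<omega>)))"
        by (simp add: sum_ennreal sum_nonneg)
      also have "\<dots> \<le> ennreal (2 ^ n * exp (H + lam * err))"
      proof (rule ennreal_leI)
        have "(\<Sum>S\<in>Pow {..<n}. \<Sum>\<gamma>\<in>range \<kappa>. exp (lam * err) * exp (lam * X (rep \<gamma>) (sw S \<omega>)))
          = (\<Sum>\<gamma>\<in>range \<kappa>. exp (lam * err) * (\<Sum>S\<in>Pow {..<n}. exp (lam * X (rep \<gamma>) (sw S \<omega>))))"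
          by (subst sum.swap) (simp add: sum_distrib_left)
        also have "\<dots> \<le> (\<Sum>\<gamma>\<in>range \<kappa>. exp (lam * err) * 2 ^ n)"
        proof (intro sum_mono mult_left_mono)
          fix \<gamma>
          have "(\<Sum>S\<in>Pow {..<n}. exp (lam * X (rep \<gamma>) (sw S \<omega>))) = (\<Sum>S\<in>Pow {..<n}. exp (lam *
             (\<Sum>i<n. (if i \<in> S then \<phi> (rep \<gamma>) (\<omega> i) - \<phi> (rep \<gamma>) (\<omega> (n + i)) else \<phi> (rep \<gamma>) (\<omega> (n + i)) - \<phi> (rep \<gamma>) (\<omega> i))
               - c * ((\<phi> (rep \<gamma>) (\<omega> (n + i)))\<^sup>2 + (\<phi> (rep \<gamma>) (\<omega> i))\<^sup>2))))"
            by (intro sum.cong refl) (simp add: X_sw)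
          also have "\<dots> \<le> 2 ^ n" using lam by (intro sign_average_le) auto
          finally show "(\<Sum>S\<in>Pow {..<n}. exp (lam * X (rep \<gamma>) (sw S \<omega>))) \<le> 2 ^ n" .
        qed auto
        also have "\<dots> = real (card (range \<kappa>)) * (exp (lam * err) * 2 ^ n)" by simp
        also have "\<dots> \<le> exp H * (exp (lam * err) * 2 ^ n)" using \<kappa>(2) by (intro mult_right_mono) auto
        finally show "(\<Sum>S\<in>Pow {..<n}. \<Sum>\<gamma>\<in>range \<kappa>. exp (lam * err) * exp (lam * X (rep \<gamma>) (sw S \<omega>))) \<le> 2 ^ n * exp (H + lam * err)"
          by (simp add: exp_add mult_ac)
      qed
      finally show "(\<Sum>S\<in>Pow {..<n}. F (sw S \<omega>)) \<le> ennreal (2 ^ n * exp (H + lam * err))" .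
    qed
    also have "\<dots> = ennreal (2 ^ n * exp (H + lam * err))" by (simp add: P.emeasure_space_1)
    also have "\<dots> = 2 ^ n * ennreal (exp (H + lam * err))" by (simp add: ennreal_mult ennreal_power[symmetric])
    finally show ?thesis by (subst (asm) ennreal_mult_le_mult_iff) (auto simp: power_eq_top_ennreal)
  qed
  finally have EV: "(\<integral>\<^sup>+\<omega>. (SUP k. ennreal (exp (lam * V k \<omega>))) \<partial>?P1) \<le> ennreal (exp (H + lam * err))" .
  \<comment> \<open>Markov's inequality at level \<open>exp t\<close>: on \<open>A\<close> the
    supremum exceeds it, while its expectation is at most \<open>exp (H + lam * err)\<close>, so the
    quotient is \<open>exp (- u)\<close>.\<close>
  define t where "t = H + u + lam * err"
  have "emeasure ?P1 A \<le> emeasure ?P1 {\<omega> \<in> space ?P1. 1 \<le> ennreal (exp (- t)) * (SUP k. ennreal (exp (lam * V k \<omega>)))}"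
  proof (rule emeasure_mono)
    show "A \<subseteq> {\<omega> \<in> space ?P1. 1 \<le> ennreal (exp (- t)) * (SUP k. ennreal (exp (lam * V k \<omega>)))}"
    proof
      fix \<omega> assume "\<omega> \<in> A"
      then obtain k where k: "\<omega> \<in> space ?P1" "(H + u) / lam + err < V k \<omega>" unfolding A_def by auto
      have "lam * ((H + u) / lam + err) \<le> lam * V k \<omega>" using k lam by (intro mult_left_mono) auto
      then have "0 \<le> - t + lam * V k \<omega>"
      proof -
        have "lam * ((H + u) / lam) = H + u" using lam by simp
        with \<open>lam * ((H + u) / lam + err) \<le> lam * V k \<omega>\<close> show ?thesis
          by (simp only: t_def distrib_left[of lam "(H + u) / lam" err])
      qed
      then have "1 \<le> exp (- t) * exp (lam * V k \<omega>)" by (simp add: exp_add[symmetric])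
      then have "1 \<le> ennreal (exp (- t) * exp (lam * V k \<omega>))" using ennreal_leI[of 1] by simp
      also have "\<dots> = ennreal (exp (- t)) * ennreal (exp (lam * V k \<omega>))" by (rule ennreal_mult) auto
      also have "\<dots> \<le> ennreal (exp (- t)) * (SUP k. ennreal (exp (lam * V k \<omega>)))"
        by (intro mult_left_mono SUP_upper) auto
      finally show "\<omega> \<in> {\<omega> \<in> space ?P1. 1 \<le> ennreal (exp (- t)) * (SUP k. ennreal (exp (lam * V k \<omega>)))}" using k by simp
    qed
    show "{\<omega> \<in> space ?P1. 1 \<le> ennreal (exp (- t)) * (SUP k. ennreal (exp (lam * V k \<omega>)))} \<in> sets ?P1" by measurable
  qed
  also have "\<dots> \<le> ennreal (exp (- t)) * (\<integral>\<^sup>+\<omega>. (SUP k. ennreal (exp (lam * V k \<omega>))) * indicator (space ?P1) \<omega> \<partial>?P1)"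
    by (intro nn_integral_Markov_inequality) auto
  also have "\<dots> = ennreal (exp (- t)) * (\<integral>\<^sup>+\<omega>. (SUP k. ennreal (exp (lam * V k \<omega>))) \<partial>?P1)"
    by (intro arg_cong2[of _ _ _ _ "(*)"] nn_integral_cong) auto
  also have "\<dots> \<le> ennreal (exp (- t)) * ennreal (exp (H + lam * err))" by (intro mult_left_mono EV) auto
  also have "\<dots> = ennreal (exp (- u))" by (simp add: ennreal_mult[symmetric] exp_add[symmetric] t_def)
  finally have "measure ?P1 A \<le> exp (- u)" by (simp add: P1.emeasure_eq_measure)
  moreover have "V k \<omega> \<le> 2 * (H + u) / c + err" if "\<omega> \<in> space ?P1 - A" for k \<omega>
  proof -
    have "(H + u) / lam = 2 * (H + u) / c" by (simp add: lam_def mult.commute)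
    then show ?thesis using that by (auto simp: A_def not_less)
  qed
  ultimately show ?thesis using A_sets unfolding V_def err_def by blast
qed

section \<open>Excess check loss\<close>

lemma check_loss_lipschitz:
  assumes "0 < \<alpha>" "\<alpha> < 1"
  shows "\<bar>check_loss \<alpha> a - check_loss \<alpha> b\<bar> \<le> \<bar>a - b\<bar>"
proof -
  have max: "check_loss \<alpha> u = max (\<alpha> * u) ((\<alpha> - 1) * u)" for u
    by (simp add: check_loss_def max_def algebra_simps)
  have "\<bar>\<alpha> * a - \<alpha> * b\<bar> \<le> 1 * \<bar>a - b\<bar>" "\<bar>(\<alpha> - 1) * a - (\<alpha> - 1) * b\<bar> \<le> 1 * \<bar>a - b\<bar>"
    unfolding right_diff_distrib[symmetric] abs_mult using assms by (intro mult_right_mono; simp)+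
  then show ?thesis unfolding max by (auto simp: max_def)
qed

text \<open>Knight's identity: a part linear in \<open>\<Delta>\<close>, with mean zero by the
  quantile condition, plus a nonnegative remainder supported between 0 and \<open>\<Delta>\<close>.
  At \<open>e = 0\<close> it fails for negative \<open>\<Delta>\<close>, which is a null event for a
  density.\<close>

lemma check_loss_excess:
  assumes "e \<noteq> 0"
  shows "check_loss \<alpha> (e - \<Delta>) - check_loss \<alpha> e =
    - \<Delta> * (\<alpha> - indicator {..0} e) + \<bar>\<Delta> - e\<bar> * indicator {min 0 \<Delta><..<max 0 \<Delta>} e"
  using assms by (auto simp: check_loss_def indicator_def min_def max_def algebra_simps abs_if)

text \<open>Only the remainder in Knight's identity survives integration. It is at most
  \<open>\<bar>\<Delta>\<bar>\<close> on an interval of length \<open>\<bar>\<Delta>\<bar>\<close>,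
  which gives the upper bound. From below it yields
  \<open>\<bar>\<Delta>\<bar> * min \<bar>\<Delta>\<bar> \<tau>\<close>; boundedness of
  \<open>\<Delta>\<close> makes this quadratic again, whence the minimum with
  \<open>\<tau> / (2 * M)\<close>.\<close>

lemma conditional_excess_risk:
  fixes q :: "real \<Rightarrow> real"
  assumes q: "\<And>e. 0 \<le> q e" "integrable lborel q" "(\<integral>e. q e \<partial>lborel) = 1"
    and up: "\<And>e. q e \<le> pbar" and low: "plow \<le> q 0" "0 < plow"
    and lip: "\<And>e e'. \<bar>q e - q e'\<bar> \<le> l0 * \<bar>e - e'\<bar>"
    and quant: "(LINT e:{..0}|lborel. q e) = \<alpha>"
    and M: "0 < M" "\<bar>\<Delta>\<bar> \<le> 2 * M"
  defines "\<tau> \<equiv> plow / (2 * (\<bar>l0\<bar> + 1))"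
  shows "plow / 8 * min 1 (\<tau> / (2 * M)) * \<Delta>\<^sup>2 \<le> (\<integral>e. q e * (check_loss \<alpha> (e - \<Delta>) - check_loss \<alpha> e) \<partial>lborel)"
    and "(\<integral>e. q e * (check_loss \<alpha> (e - \<Delta>) - check_loss \<alpha> e) \<partial>lborel) \<le> pbar * \<Delta>\<^sup>2"
proof -
  define r where "r = (\<lambda>e. \<bar>\<Delta> - e\<bar> * indicator {min 0 \<Delta><..<max 0 \<Delta>} e)"
  have [measurable]: "q \<in> borel_measurable borel" using q(2) by simp
  have r_bound: "\<bar>r e\<bar> \<le> \<bar>\<Delta>\<bar>" "0 \<le> r e" for e
    by (auto simp: r_def indicator_def min_def max_def abs_if split: if_splits)
  have int_r: "integrable lborel (\<lambda>e. q e * r e)"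
  proof (rule Bochner_Integration.integrable_bound)
    show "integrable lborel (\<lambda>e. \<bar>\<Delta>\<bar> * q e)" using q by simp
    show "(\<lambda>e. q e * r e) \<in> borel_measurable lborel" unfolding r_def by measurable
    show "AE e in lborel. norm (q e * r e) \<le> norm (\<bar>\<Delta>\<bar> * q e)"
    proof (rule AE_I2)
      fix e
      have "q e * \<bar>r e\<bar> \<le> q e * \<bar>\<Delta>\<bar>" by (intro mult_left_mono r_bound q)
      then show "norm (q e * r e) \<le> norm (\<bar>\<Delta>\<bar> * q e)" using q(1)[of e] by (simp add: abs_mult mult.commute)
    qed
  qed
  have int_i: "integrable lborel (\<lambda>e. q e * indicator {..0} e)"
    using q(2) by (intro integrable_real_mult_indicator) auto
  have quant': "(\<integral>e. q e * indicator {..0} e \<partial>lborel) = \<alpha>"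
    using quant by (simp add: set_lebesgue_integral_def mult.commute)
  have "(\<integral>e. q e * (check_loss \<alpha> (e - \<Delta>) - check_loss \<alpha> e) \<partial>lborel)
      = (\<integral>e. - \<Delta> * \<alpha> * q e + \<Delta> * (q e * indicator {..0} e) + q e * r e \<partial>lborel)"
  proof (rule integral_cong_AE)
    have "AE e in lborel. e \<noteq> (0::real)" by (rule AE_lborel_singleton)
    then show "AE e in lborel. q e * (check_loss \<alpha> (e - \<Delta>) - check_loss \<alpha> e)
      = - \<Delta> * \<alpha> * q e + \<Delta> * (q e * indicator {..0} e) + q e * r e"
      by eventually_elim (simp add: check_loss_excess r_def algebra_simps)
  qed (unfold check_loss_def r_def, measurable)
  also have "\<dots> = - \<Delta> * \<alpha> * 1 + \<Delta> * \<alpha> + (\<integral>e. q e * r e \<partial>lborel)"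
    using q(2) int_i int_r quant' q(3) by simp
  finally have eq: "(\<integral>e. q e * (check_loss \<alpha> (e - \<Delta>) - check_loss \<alpha> e) \<partial>lborel) = (\<integral>e. q e * r e \<partial>lborel)"
    by simp
  have "0 \<le> pbar" using up[of 0] q(1)[of 0] by simp
  have "(\<integral>e. q e * r e \<partial>lborel) \<le> (\<integral>e. (pbar * \<bar>\<Delta>\<bar>) * indicator {min 0 \<Delta><..<max 0 \<Delta>} e \<partial>lborel)"
  proof (intro integral_mono int_r)
    fix e
    have "q e * \<bar>\<Delta> - e\<bar> \<le> pbar * \<bar>\<Delta>\<bar>" if "e \<in> {min 0 \<Delta><..<max 0 \<Delta>}"
      using that up[of e] \<open>0 \<le> pbar\<close> q(1)[of e]
      by (intro mult_mono) (auto simp: min_def max_def abs_if split: if_splits)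
    then show "q e * r e \<le> (pbar * \<bar>\<Delta>\<bar>) * indicator {min 0 \<Delta><..<max 0 \<Delta>} e"
      by (auto simp: r_def indicator_def)
  qed auto
  also have "\<dots> = pbar * \<bar>\<Delta>\<bar> * \<bar>\<Delta>\<bar>" by (auto simp: min_def max_def abs_if)
  also have "\<dots> = pbar * \<Delta>\<^sup>2" by (simp add: power2_eq_square mult.assoc)
  finally show "(\<integral>e. q e * (check_loss \<alpha> (e - \<Delta>) - check_loss \<alpha> e) \<partial>lborel) \<le> pbar * \<Delta>\<^sup>2"
    unfolding eq .
  have \<tau>: "0 < \<tau>" "(\<bar>l0\<bar> + 1) * \<tau> = plow / 2" using low(2) by (auto simp: \<tau>_def field_simps)
  \<comment> \<open>Within \<open>\<tau>\<close> of 0 the Lipschitz condition keeps the density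
    above \<open>plow / 2\<close>, and on \<open>S\<close> the distance to \<open>\<Delta>\<close>
    is at least \<open>\<bar>\<Delta>\<bar> / 2\<close>. Together with the 1/2 in the length
    \<open>m\<close> these make the 1/8.\<close>
  define m where "m = min \<bar>\<Delta>\<bar> \<tau> / 2"
  define S where "S = (if \<Delta> > 0 then {0<..<m} else {- m<..<0})"
  have m: "0 \<le> m" "m \<le> \<tau>" "2 * m \<le> \<bar>\<Delta>\<bar>" using \<tau>(1) by (auto simp: m_def)
  have "plow / 8 * min 1 (\<tau> / (2 * M)) * \<Delta>\<^sup>2 = plow / 8 * (min 1 (\<tau> / (2 * M)) * \<Delta>\<^sup>2)" by simp
  also have "\<dots> \<le> plow / 8 * (\<bar>\<Delta>\<bar> * min \<bar>\<Delta>\<bar> \<tau>)"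
  proof (intro mult_left_mono)
    have sq: "\<Delta>\<^sup>2 = \<bar>\<Delta>\<bar> * \<bar>\<Delta>\<bar>" by (simp add: power2_eq_square)
    show "min 1 (\<tau> / (2 * M)) * \<Delta>\<^sup>2 \<le> \<bar>\<Delta>\<bar> * min \<bar>\<Delta>\<bar> \<tau>"
    proof (cases "\<bar>\<Delta>\<bar> \<le> \<tau>")
      case True
      have "min 1 (\<tau> / (2 * M)) * \<Delta>\<^sup>2 \<le> 1 * \<Delta>\<^sup>2" by (intro mult_right_mono) auto
      with True sq show ?thesis by simp
    next
      case False
      have "min 1 (\<tau> / (2 * M)) * \<Delta>\<^sup>2 \<le> \<tau> / (2 * M) * \<Delta>\<^sup>2" by (intro mult_right_mono) auto
      also have "\<dots> = \<bar>\<Delta>\<bar> * \<tau> * (\<bar>\<Delta>\<bar> / (2 * M))" by (simp add: sq)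
      also have "\<dots> \<le> \<bar>\<Delta>\<bar> * \<tau> * 1" using M \<tau>(1) by (intro mult_left_mono) auto
      finally show ?thesis using False by simp
    qed
  qed (use low in simp)
  also have "\<dots> = (plow / 2 * (\<bar>\<Delta>\<bar> / 2)) * m" by (simp add: m_def)
  also have "\<dots> = (\<integral>e. (plow / 2 * (\<bar>\<Delta>\<bar> / 2)) * indicator S e \<partial>lborel)"
    using m by (auto simp: S_def)
  also have "\<dots> \<le> (\<integral>e. q e * r e \<partial>lborel)"
  proof (intro integral_mono int_r)
    show "integrable lborel (\<lambda>e. (plow / 2 * (\<bar>\<Delta>\<bar> / 2)) * indicator S e)"
      by (intro integrable_mult_right integrable_real_indicator) (use m in \<open>auto simp: S_def\<close>)
    fix e
    show "(plow / 2 * (\<bar>\<Delta>\<bar> / 2)) * indicator S e \<le> q e * r e"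
    proof (cases "e \<in> S")
      case True
      then have e: "\<bar>e\<bar> < m" "e \<in> {min 0 \<Delta><..<max 0 \<Delta>}" "\<bar>\<Delta>\<bar> / 2 \<le> \<bar>\<Delta> - e\<bar>"
        using m by (auto simp: S_def min_def max_def abs_if split: if_splits)
      have "\<bar>q e - q 0\<bar> \<le> l0 * \<bar>e\<bar>" using lip[of e 0] by simp
      also have "\<dots> \<le> (\<bar>l0\<bar> + 1) * \<tau>" using e(1) m(2) by (intro mult_mono) auto
      finally have "plow / 2 \<le> q e" using low(1) \<tau>(2) by linarith
      then have "(plow / 2) * (\<bar>\<Delta>\<bar> / 2) \<le> q e * \<bar>\<Delta> - e\<bar>"
        using e(3) low(2) q(1)[of e] by (intro mult_mono) auto
      then show ?thesis using True e(2) by (simp add: r_def)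
    next
      case False
      then show ?thesis using q(1)[of e] r_bound(2)[of e] by simp
    qed
  qed
  finally show "plow / 8 * min 1 (\<tau> / (2 * M)) * \<Delta>\<^sup>2 \<le> (\<integral>e. q e * (check_loss \<alpha> (e - \<Delta>) - check_loss \<alpha> e) \<partial>lborel)"
    unfolding eq .
qed

section \<open>The joint law of input and noise, and moments of the excess loss\<close>

lemma
  assumes PX: "prob_space PX" and cond: "cond_density_condition PX p pbar plow l0"
  shows prob_space_joint_law: "prob_space (joint_law PX p)"
    and integral_joint_law: "\<And>g B. g \<in> borel_measurable (PX \<Otimes>\<^sub>M lborel) \<Longrightarrow>
      (\<And>z. z \<in> space (PX \<Otimes>\<^sub>M lborel) \<Longrightarrow> \<bar>g z\<bar> \<le> B) \<Longrightarrow>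
      integrable PX (\<lambda>x. \<integral>e. p x e * g (x, e) \<partial>lborel) \<and>
      (\<integral>z. g z \<partial>joint_law PX p) = (\<integral>x. (\<integral>e. p x e * g (x, e) \<partial>lborel) \<partial>PX)"
    and AE_joint_law: "\<And>S. S \<in> sets PX \<Longrightarrow> AE x in PX. x \<in> S \<Longrightarrow> AE z in joint_law PX p. fst z \<in> S"
proof -
  interpret PX: prob_space PX by fact
  interpret pair_sigma_finite PX lborel by standard
  have p_meas[measurable]: "(\<lambda>(x, e). p x e) \<in> borel_measurable (PX \<Otimes>\<^sub>M lborel)"
    and good: "AE x in PX. (\<forall>e. 0 \<le> p x e) \<and> integrable lborel (p x) \<and> (\<integral>e. p x e \<partial>lborel) = 1"
    using cond unfolding cond_density_condition_def by auto
  have nn1: "(\<integral>\<^sup>+z. ennreal (case z of (x, e) \<Rightarrow> p x e) \<partial>(PX \<Otimes>\<^sub>M lborel)) = 1"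
  proof -
    have "(\<integral>\<^sup>+z. ennreal (case z of (x, e) \<Rightarrow> p x e) \<partial>(PX \<Otimes>\<^sub>M lborel)) = (\<integral>\<^sup>+x. (\<integral>\<^sup>+e. ennreal (p x e) \<partial>lborel) \<partial>PX)"
      using lborel.nn_integral_fst[of "\<lambda>z. ennreal (case z of (x, e) \<Rightarrow> p x e)" PX] by simp
    also have "\<dots> = (\<integral>\<^sup>+x. 1 \<partial>PX)"
    proof (rule nn_integral_cong_AE)
      show "AE x in PX. (\<integral>\<^sup>+e. ennreal (p x e) \<partial>lborel) = 1"
        using good by eventually_elim (auto simp: nn_integral_eq_integral)
    qed
    finally show ?thesis by (simp add: PX.emeasure_space_1)
  qed
  have dens_meas: "(\<lambda>(x, e). ennreal (p x e)) \<in> borel_measurable (PX \<Otimes>\<^sub>M lborel)"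
    using p_meas by (simp add: split_beta')
  have split_eq: "(\<lambda>(x, e). ennreal (p x e)) = (\<lambda>z. ennreal (case z of (x, e) \<Rightarrow> p x e))" by auto
  show "prob_space (joint_law PX p)"
  proof
    have "emeasure (joint_law PX p) (space (joint_law PX p)) = (\<integral>\<^sup>+z. ennreal (case z of (x, e) \<Rightarrow> p x e) * indicator (space (PX \<Otimes>\<^sub>M lborel)) z \<partial>(PX \<Otimes>\<^sub>M lborel))"
      unfolding joint_law_def split_eq space_density by (rule emeasure_density[OF _ sets.top]) measurable
    also have "\<dots> = (\<integral>\<^sup>+z. ennreal (case z of (x, e) \<Rightarrow> p x e) \<partial>(PX \<Otimes>\<^sub>M lborel))"
      by (intro nn_integral_cong) auto
    finally show "emeasure (joint_law PX p) (space (joint_law PX p)) = 1" using nn1 by simp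
  qed
  have pos: "AE z in PX \<Otimes>\<^sub>M lborel. 0 \<le> (case z of (x, e) \<Rightarrow> p x e)"
  proof (rule AE_pair_measure)
    show "{z \<in> space (PX \<Otimes>\<^sub>M lborel). 0 \<le> (case z of (x, e) \<Rightarrow> p x e)} \<in> sets (PX \<Otimes>\<^sub>M lborel)" by measurable
    show "AE x in PX. AE y in lborel. 0 \<le> (case (x, y) of (x, e) \<Rightarrow> p x e)"
      using good by eventually_elim auto
  qed
  have int_p: "integrable (PX \<Otimes>\<^sub>M lborel) (\<lambda>(x, e). p x e)"
    using p_meas pos nn1 by (intro integrableI_nonneg) auto
  show "integrable PX (\<lambda>x. \<integral>e. p x e * g (x, e) \<partial>lborel) \<and>
      (\<integral>z. g z \<partial>joint_law PX p) = (\<integral>x. (\<integral>e. p x e * g (x, e) \<partial>lborel) \<partial>PX)"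
    if g[measurable]: "g \<in> borel_measurable (PX \<Otimes>\<^sub>M lborel)" and B: "\<And>z. z \<in> space (PX \<Otimes>\<^sub>M lborel) \<Longrightarrow> \<bar>g z\<bar> \<le> B"
    for g B
  proof -
    have int: "integrable (PX \<Otimes>\<^sub>M lborel) (\<lambda>z. (case z of (x, e) \<Rightarrow> p x e) * g z)"
    proof (rule Bochner_Integration.integrable_bound)
      show "integrable (PX \<Otimes>\<^sub>M lborel) (\<lambda>z. B * (case z of (x, e) \<Rightarrow> p x e))" using int_p by simp
      show "AE z in PX \<Otimes>\<^sub>M lborel. norm ((case z of (x, e) \<Rightarrow> p x e) * g z) \<le> norm (B * (case z of (x, e) \<Rightarrow> p x e))"
      proof (rule AE_I2)
        fix z :: "(nat \<Rightarrow> real) \<times> real" assume "z \<in> space (PX \<Otimes>\<^sub>M lborel)"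
        from B[OF this] have "\<bar>case z of (x, e) \<Rightarrow> p x e\<bar> * \<bar>g z\<bar> \<le> \<bar>case z of (x, e) \<Rightarrow> p x e\<bar> * \<bar>B\<bar>"
          by (intro mult_left_mono) auto
        then show "norm ((case z of (x, e) \<Rightarrow> p x e) * g z) \<le> norm (B * (case z of (x, e) \<Rightarrow> p x e))"
          by (simp add: abs_mult mult.commute)
      qed
    qed measurable
    have "(\<integral>z. g z \<partial>joint_law PX p) = (\<integral>z. (case z of (x, e) \<Rightarrow> p x e) * g z \<partial>(PX \<Otimes>\<^sub>M lborel))"
      unfolding joint_law_def split_eq using integral_density[OF g _ pos] p_meas by simp
    also have "\<dots> = (\<integral>x. (\<integral>e. p x e * g (x, e) \<partial>lborel) \<partial>PX)"
      using integral_fst'[OF int, symmetric] by simp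
    finally show ?thesis using integrable_fst'[OF int] by simp
  qed
  show "AE z in joint_law PX p. fst z \<in> S" if S: "S \<in> sets PX" and AE: "AE x in PX. x \<in> S" for S
  proof -
    have "AE z in PX \<Otimes>\<^sub>M lborel. fst z \<in> S"
    proof (rule AE_pair_measure)
      show "{z \<in> space (PX \<Otimes>\<^sub>M lborel). fst z \<in> S} \<in> sets (PX \<Otimes>\<^sub>M lborel)" using S by measurable
      show "AE x in PX. AE y in lborel. fst (x, y) \<in> S" using AE by eventually_elim simp
    qed
    then show ?thesis unfolding joint_law_def split_eq by (subst AE_density) auto
  qed
qed

definition excess_loss :: "real \<Rightarrow> ((nat \<Rightarrow> real) \<Rightarrow> real) \<Rightarrow> ((nat \<Rightarrow> real) \<Rightarrow> real) \<Rightarrow> (nat \<Rightarrow> real) \<times> real \<Rightarrow> real" where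
  "excess_loss \<alpha> f0 f z = check_loss \<alpha> (snd z - (f (fst z) - f0 (fst z))) - check_loss \<alpha> (snd z)"

text \<open>Lower quadratic growth rate of the expected check loss around \<open>f0\<close>, as
  found in \<open>conditional_excess_risk\<close>. It is the \<open>\<kappa>\<close> of everything
  that follows and involves neither \<alpha> nor the network.\<close>

definition curvature :: "real \<Rightarrow> real \<Rightarrow> real \<Rightarrow> real" where
  "curvature plow l0 M = plow / 8 * min 1 (plow / (2 * (\<bar>l0\<bar> + 1)) / (2 * M))"

lemma curvature_pos: "0 < plow \<Longrightarrow> 0 < M \<Longrightarrow> 0 < curvature plow l0 M"
  by (auto simp: curvature_def min_def)

lemma excess_loss_bound:
  assumes "0 < \<alpha>" "\<alpha> < 1" shows "\<bar>excess_loss \<alpha> f0 f z\<bar> \<le> \<bar>f (fst z) - f0 (fst z)\<bar>"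
  using check_loss_lipschitz[OF assms, of "snd z - (f (fst z) - f0 (fst z))" "snd z"]
  by (simp add: excess_loss_def)

lemma excess_loss_lipschitz:
  assumes "0 < \<alpha>" "\<alpha> < 1" shows "\<bar>excess_loss \<alpha> f0 f z - excess_loss \<alpha> f0 g z\<bar> \<le> \<bar>f (fst z) - g (fst z)\<bar>"
  using check_loss_lipschitz[OF assms, of "snd z - (f (fst z) - f0 (fst z))" "snd z - (g (fst z) - f0 (fst z))"]
  by (simp add: excess_loss_def)

lemma measurable_excess_loss:
  assumes [measurable]: "f0 \<in> borel_measurable PX" "f \<in> borel_measurable PX"
  shows "excess_loss \<alpha> f0 f \<in> borel_measurable (PX \<Otimes>\<^sub>M lborel)"
  unfolding excess_loss_def[abs_def] check_loss_def by measurable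

text \<open>The first two bounds integrate the conditional ones over \<open>PX\<close>. The third
  holds because the check loss is 1-Lipschitz; with the first it is a Bernstein condition, the
  second moment being at most a multiple of the mean.\<close>

lemma excess_loss_moments:
  assumes PX: "prob_space PX" and cond: "cond_density_condition PX p pbar plow l0" and plow: "0 < plow"
    and \<alpha>: "0 < \<alpha>" "\<alpha> < 1" and quant: "AE x in PX. (LINT e:{..0}|lborel. p x e) = \<alpha>"
    and M: "0 < M" and f0: "f0 \<in> borel_measurable PX" "\<And>x. x \<in> space PX \<Longrightarrow> \<bar>f0 x\<bar> \<le> M"
    and f: "f \<in> borel_measurable PX" "\<And>x. x \<in> space PX \<Longrightarrow> \<bar>f x\<bar> \<le> M"
  shows "curvature plow l0 M * (\<integral>x. (f x - f0 x)\<^sup>2 \<partial>PX) \<le> (\<integral>z. excess_loss \<alpha> f0 f z \<partial>joint_law PX p)"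
    and "(\<integral>z. excess_loss \<alpha> f0 f z \<partial>joint_law PX p) \<le> pbar * (\<integral>x. (f x - f0 x)\<^sup>2 \<partial>PX)"
    and "(\<integral>z. (excess_loss \<alpha> f0 f z)\<^sup>2 \<partial>joint_law PX p) \<le> (\<integral>x. (f x - f0 x)\<^sup>2 \<partial>PX)"
proof -
  interpret PX: prob_space PX by fact
  have diff: "\<bar>f x - f0 x\<bar> \<le> 2 * M" if "x \<in> space PX" for x using f0(2)[OF that] f(2)[OF that] by linarith
  have bound: "\<bar>excess_loss \<alpha> f0 f z\<bar> \<le> 2 * M" if "z \<in> space (PX \<Otimes>\<^sub>M lborel)" for z
  proof -
    have "fst z \<in> space PX" using that by (auto simp: space_pair_measure)
    from diff[OF this] excess_loss_bound[OF \<alpha>, of f0 f z] show ?thesis by linarith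
  qed
  have int_sq: "integrable PX (\<lambda>x. (f x - f0 x)\<^sup>2)"
  proof (rule PX.integrable_const_bound[where B="(2 * M)\<^sup>2"])
    show "AE x in PX. norm ((f x - f0 x)\<^sup>2) \<le> (2 * M)\<^sup>2"
      using power_mono[OF diff abs_ge_zero, of _ 2] by (intro AE_I2) simp
  qed (use f0 f in measurable)
  note 1 = integral_joint_law[OF PX cond measurable_excess_loss[OF f0(1) f(1)] bound]
  have *: "AE x in PX. curvature plow l0 M * (f x - f0 x)\<^sup>2 \<le> (\<integral>e. p x e * excess_loss \<alpha> f0 f (x, e) \<partial>lborel) \<and>
      (\<integral>e. p x e * excess_loss \<alpha> f0 f (x, e) \<partial>lborel) \<le> pbar * (f x - f0 x)\<^sup>2"
    using cond[unfolded cond_density_condition_def, THEN conjunct2] quant AE_space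
  proof eventually_elim
    case (elim x)
    have "\<bar>f x - f0 x\<bar> \<le> 2 * M" using diff elim by blast
    then show ?case
      using conditional_excess_risk[of "p x" pbar plow l0 \<alpha> M "f x - f0 x"] elim plow M
      unfolding excess_loss_def curvature_def by simp
  qed
  show "curvature plow l0 M * (\<integral>x. (f x - f0 x)\<^sup>2 \<partial>PX) \<le> (\<integral>z. excess_loss \<alpha> f0 f z \<partial>joint_law PX p)"
  proof -
    have "(\<integral>x. curvature plow l0 M * (f x - f0 x)\<^sup>2 \<partial>PX) \<le> (\<integral>x. (\<integral>e. p x e * excess_loss \<alpha> f0 f (x, e) \<partial>lborel) \<partial>PX)"
      by (rule integral_mono_AE) (use 1 int_sq * in auto)
    then show ?thesis using 1 by simp
  qed
  show "(\<integral>z. excess_loss \<alpha> f0 f z \<partial>joint_law PX p) \<le> pbar * (\<integral>x. (f x - f0 x)\<^sup>2 \<partial>PX)"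
  proof -
    have "(\<integral>x. (\<integral>e. p x e * excess_loss \<alpha> f0 f (x, e) \<partial>lborel) \<partial>PX) \<le> (\<integral>x. pbar * (f x - f0 x)\<^sup>2 \<partial>PX)"
      by (rule integral_mono_AE) (use 1 int_sq * in auto)
    then show ?thesis using 1 by simp
  qed
  have bound2: "\<bar>(excess_loss \<alpha> f0 f z)\<^sup>2\<bar> \<le> (2 * M)\<^sup>2" if "z \<in> space (PX \<Otimes>\<^sub>M lborel)" for z
    using power_mono[OF bound[OF that] abs_ge_zero, of 2] by simp
  note 2 = integral_joint_law[OF PX cond borel_measurable_power[OF measurable_excess_loss[OF f0(1) f(1)]] bound2]
  have "AE x in PX. (\<integral>e. p x e * (excess_loss \<alpha> f0 f (x, e))\<^sup>2 \<partial>lborel) \<le> (f x - f0 x)\<^sup>2"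
    using cond[unfolded cond_density_condition_def, THEN conjunct2] AE_space
  proof eventually_elim
    case (elim x)
    have le: "(excess_loss \<alpha> f0 f (x, e))\<^sup>2 \<le> (f x - f0 x)\<^sup>2" for e
      using excess_loss_bound[OF \<alpha>, of f0 f "(x, e)"] by (simp add: abs_le_square_iff)
    have "(\<integral>e. p x e * (excess_loss \<alpha> f0 f (x, e))\<^sup>2 \<partial>lborel) \<le> (\<integral>e. p x e * (f x - f0 x)\<^sup>2 \<partial>lborel)"
    proof (rule integral_mono')
      show "integrable lborel (\<lambda>e. p x e * (f x - f0 x)\<^sup>2)" using elim by simp
      show "p x e * (excess_loss \<alpha> f0 f (x, e))\<^sup>2 \<le> p x e * (f x - f0 x)\<^sup>2" for e
        using le elim by (intro mult_left_mono) auto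
    qed (use elim in auto)
    also have "\<dots> = (f x - f0 x)\<^sup>2" using elim by simp
    finally show ?case .
  qed
  then show "(\<integral>z. (excess_loss \<alpha> f0 f z)\<^sup>2 \<partial>joint_law PX p) \<le> (\<integral>x. (f x - f0 x)\<^sup>2 \<partial>PX)"
    using 2 int_sq by (auto intro!: integral_mono_AE)
qed

section \<open>Regularity of networks in the input and in the parameters\<close>

lemma measurable_net:
  assumes "0 < N" shows "net d L N \<theta> \<in> borel_measurable (PiM {..<d} (\<lambda>_. borel))"
proof -
  have "(\<lambda>x. hidden d N \<theta> x k i) \<in> borel_measurable (PiM {..<d} (\<lambda>_. borel))" if "i < layer_in_dim d N k" for k i
    using that
  proof (induction k arbitrary: i)
    case 0
    then show ?case by (simp add: layer_in_dim_def)
  next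
    case (Suc k)
    then show ?case unfolding hidden_Suc preact_def
      by (auto intro!: borel_measurable_max borel_measurable_add borel_measurable_sum borel_measurable_times)
  qed
  then show ?thesis
    unfolding net_eq[abs_def] preact_def
    by (auto intro!: borel_measurable_add borel_measurable_sum borel_measurable_times)
qed

lemma tendsto_net:
  assumes lim: "\<And>i. i \<in> param_index d L N \<Longrightarrow> (\<lambda>m. \<Theta> m i) \<longlonglongrightarrow> \<theta> i" and N: "0 < N"
  shows "(\<lambda>m. net d L N (\<Theta> m) x) \<longlonglongrightarrow> net d L N \<theta> x"
proof -
  have pre: "(\<lambda>m. preact d N (\<Theta> m) k i (z m)) \<longlonglongrightarrow> preact d N \<theta> k i z0"
    if "k \<le> L" "i < N" "\<And>j. (\<lambda>m. z m j) \<longlonglongrightarrow> z0 j" for k i z z0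
    unfolding preact_def net_weight_def net_bias_def
    using that by (intro tendsto_add tendsto_sum tendsto_mult lim param_index_memI) auto
  have "(\<lambda>m. hidden d N (\<Theta> m) x k i) \<longlonglongrightarrow> hidden d N \<theta> x k i" if "k \<le> L" for k i
    using that
  proof (induction k arbitrary: i)
    case (Suc k)
    show ?case
    proof (cases "i < N")
      case True
      then show ?thesis unfolding hidden_Suc using Suc
        by (auto intro!: tendsto_max pre)
    qed (simp add: hidden_Suc)
  qed simp
  then show ?thesis unfolding net_eq using N by (intro pre) auto
qed

lemma abs_trunc_le: "0 \<le> M \<Longrightarrow> \<bar>trunc M h\<bar> \<le> M"
  by (simp add: trunc_eq)

lemma tendsto_trunc: "0 \<le> M \<Longrightarrow> (f \<longlongrightarrow> l) F \<Longrightarrow> ((\<lambda>m. trunc M (f m)) \<longlongrightarrow> trunc M l) F"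
  unfolding trunc_eq by (intro tendsto_intros)

lemma measurable_trunc: "0 \<le> M \<Longrightarrow> f \<in> borel_measurable A \<Longrightarrow> (\<lambda>x. trunc M (f x)) \<in> borel_measurable A"
  by (simp only: trunc_eq) (intro borel_measurable_max borel_measurable_min; simp)

text \<open>Up to the continuity of the network in its parameters, it suffices to control the
  countably many networks with rational parameters.\<close>

lemma rational_params:
  obtains e :: "nat \<Rightarrow> nat \<times> nat \<times> nat \<Rightarrow> real" where
    "\<And>\<theta>. \<exists>r. \<forall>i\<in>param_index d L N. (\<lambda>m. e (r m) i) \<longlonglongrightarrow> \<theta> i"
proof -
  let ?I = "param_index d L N"
  define S where "S = PiE ?I (\<lambda>_. \<rat> :: real set)"
  have S: "countable S" "S \<noteq> {}"
    unfolding S_def using finite_param_index[of d L N] by (auto intro!: countable_PiE countable_rat simp: PiE_eq_empty_iff)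
  show ?thesis
  proof (rule that[of "from_nat_into S"])
    fix \<theta> :: "nat \<times> nat \<times> nat \<Rightarrow> real"
    have "\<exists>q\<in>\<rat>. \<theta> i < q \<and> q < \<theta> i + 1 / real (Suc m)" for i m
      by (rule Rats_dense_in_real) simp
    then obtain q where q: "\<And>i m. q i m \<in> \<rat>" "\<And>i m. \<theta> i < q i m \<and> q i m < \<theta> i + 1 / real (Suc m)"
      by metis
    have "(\<lambda>i\<in>?I. q i m) \<in> S" for m using q by (auto simp: S_def)
    then have "\<forall>m. \<exists>k. from_nat_into S k = (\<lambda>i\<in>?I. q i m)"
      using from_nat_into_surj[OF S(1)] by blast
    from choice[OF this] obtain r where r: "\<And>m. from_nat_into S (r m) = (\<lambda>i\<in>?I. q i m)" by blast
    have lim: "(\<lambda>m. q i m) \<longlonglongrightarrow> \<theta> i" for i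
    proof (rule tendsto_sandwich[of "\<lambda>_. \<theta> i" "\<lambda>m. q i m" _ "\<lambda>m. \<theta> i + 1 / real (Suc m)"])
      show "(\<lambda>m. \<theta> i + 1 / real (Suc m)) \<longlonglongrightarrow> \<theta> i"
        using tendsto_add[OF tendsto_const[of "\<theta> i"] LIMSEQ_Suc[OF lim_1_over_n]] by simp
    qed (use q(2)[of i] in \<open>auto intro!: always_eventually less_imp_le simp del: of_nat_Suc\<close>)
    show "\<exists>r. \<forall>i\<in>?I. (\<lambda>m. from_nat_into S (r m) i) \<longlonglongrightarrow> \<theta> i"
      by (intro exI[of _ r]) (simp add: r lim)
  qed
qed

section \<open>Empirical risk minimization\<close>

lemma tendsto_excess_loss:
  assumes "((\<lambda>m. g m (fst z)) \<longlongrightarrow> f (fst z)) F"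
  shows "((\<lambda>m. excess_loss \<alpha> f0 (g m) z) \<longlongrightarrow> excess_loss \<alpha> f0 f z) F"
proof -
  have "check_loss \<alpha> u = max (\<alpha> * u) ((\<alpha> - 1) * u)" for u
    by (simp add: check_loss_def max_def algebra_simps)
  then show ?thesis unfolding excess_loss_def by (simp only:) (intro tendsto_intros assms)
qed

text \<open>\<open>E3\<close> bounds the empirical second moment: with the quartic terms absorbed,
  \<open>S2\<close> is at most \<open>3 * n * w + 2 * T3\<close>. The offsets in \<open>E1\<close>
  and \<open>E2\<close> then add up to \<kappa>/8 * (3 + 1) = \<kappa>/2 times \<open>v * n\<close>,
  which leaves half of the lower bound \<open>\<kappa> * v\<close> on the mean.\<close>

lemma deviation_to_risk:
  fixes a w w4 S S2 S4 v :: real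
  assumes E1: "n * (a - \<kappa> / 8 * w) - (S + \<kappa> / 8 * S2) \<le> T1"
    and E2: "n * (- a - \<kappa> / 8 * w) - (- S + \<kappa> / 8 * S2) \<le> T1"
    and E3: "n * (- w - c3 * w4) - (- S2 + c3 * S4) \<le> T3"
    and w4: "c3 * w4 \<le> w / 2" and S4: "c3 * S4 \<le> S2 / 2" and n: "0 \<le> n" and \<kappa>: "0 \<le> \<kappa>"
    and a: "\<kappa> * v \<le> a" "a \<le> pbar * v" and w: "w \<le> v"
  shows "\<kappa> / 2 * v * n \<le> S + (T1 + \<kappa> / 4 * T3)" and "S \<le> (pbar + \<kappa> / 2) * v * n + (T1 + \<kappa> / 4 * T3)"
proof -
  have "n * (c3 * w4) \<le> n * (w / 2)" using n w4 by (rule mult_left_mono[rotated])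
  then have S2: "S2 \<le> 3 * (n * w) + 2 * T3" using E3 S4 by (simp add: right_diff_distrib)
  have nw: "n * w \<le> n * v" using n w by (rule mult_left_mono[rotated])
  have "\<kappa> / 8 * S2 \<le> \<kappa> / 8 * (3 * (n * v) + 2 * T3)" using S2 nw \<kappa> by (intro mult_left_mono) auto
  moreover have "\<kappa> / 8 * (n * w) \<le> \<kappa> / 8 * (n * v)" using \<kappa> by (intro mult_left_mono nw) auto
  ultimately have q: "\<kappa> / 8 * S2 + \<kappa> / 8 * (n * w) \<le> \<kappa> / 2 * (n * v) + \<kappa> / 4 * T3"
    by (simp add: algebra_simps)
  have na: "n * (\<kappa> * v) \<le> n * a" "n * a \<le> n * (pbar * v)" using n a by (auto intro: mult_left_mono)
  show "\<kappa> / 2 * v * n \<le> S + (T1 + \<kappa> / 4 * T3)" using E1 q na by (simp add: algebra_simps)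
  show "S \<le> (pbar + \<kappa> / 2) * v * n + (T1 + \<kappa> / 4 * T3)" using E2 q na by (simp add: algebra_simps)
qed

text \<open>The first inequality bounds the distance of the minimizer through its empirical excess
  loss; the second bounds the empirical excess loss of a comparator. Both hold off one event that is
  independent of \<open>\<theta>\<close>, so a minimizer chosen from the data is covered.\<close>

lemma uniform_excess_risk_bound:
  fixes M :: real and PX :: "(nat \<Rightarrow> real) measure" and u :: real
  assumes dim: "1 \<le> d" "1 \<le> L" "3 \<le> N" "3 \<le> n" and M: "1 \<le> M" and \<alpha>: "0 < \<alpha>" "\<alpha> < 1"
    and PX: "prob_space PX" and sets_PX: "sets PX = sets (PiM {..<d} (\<lambda>_. borel))"
    and f0: "f0 \<in> borel_measurable PX" "\<And>x. x \<in> space PX \<Longrightarrow> \<bar>f0 x\<bar> \<le> M"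
    and cond: "cond_density_condition PX p pbar plow l0" and plow: "0 < plow"
    and quant: "AE x in PX. (LINT e:{..0}|lborel. p x e) = \<alpha>" and u: "1 \<le> u"
  defines "f \<equiv> \<lambda>\<theta> x. trunc M (net d L N \<theta> x)"
  defines "v \<equiv> \<lambda>\<theta>. \<integral>x. (f \<theta> x - f0 x)\<^sup>2 \<partial>PX"
  defines "H \<equiv> 8 * (ln (81 * M) + 6) * (real n * (delta_s d L N n)\<^sup>2)"
  defines "\<kappa> \<equiv> curvature plow l0 M"
  defines "T \<equiv> (16 / \<kappa> + 2 + 5 * \<kappa> * M + 4 * \<kappa> * M\<^sup>2) * (H + u)"
  shows "\<exists>A\<in>sets (sample_law PX p n). measure (sample_law PX p n) A \<le> 3 * exp (- u) \<and>
    (\<forall>s\<in>space (sample_law PX p n) - A. \<forall>\<theta>.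
       \<kappa> / 2 * v \<theta> * real n \<le> (\<Sum>i<n. excess_loss \<alpha> f0 (f \<theta>) (s i)) + T \<and>
       (\<Sum>i<n. excess_loss \<alpha> f0 (f \<theta>) (s i)) \<le> (pbar + \<kappa> / 2) * v \<theta> * real n + T)"
proof -
  define Q where "Q = joint_law PX p"
  have Q: "prob_space Q" unfolding Q_def by (rule prob_space_joint_law[OF PX cond])
  interpret PX: prob_space PX by fact
  interpret Q: prob_space Q by fact
  let ?P = "PiM {..<n} (\<lambda>_. Q)"
  interpret P: prob_space ?P by (intro prob_space_PiM Q)
  have sets_Q: "sets Q = sets (PX \<Otimes>\<^sub>M lborel)" by (simp add: Q_def joint_law_def)
  have space_Q: "space Q = space (PX \<Otimes>\<^sub>M lborel)" by (simp add: Q_def joint_law_def)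
  have n: "0 < real n" and N: "0 < N" using dim by auto
  have \<kappa>: "0 < \<kappa>" unfolding \<kappa>_def using plow M by (intro curvature_pos) auto
  have H: "0 \<le> H"
  proof -
    have "0 \<le> ln (81 * M)" using M by (intro ln_ge_zero) auto
    then show ?thesis unfolding H_def by (intro mult_nonneg_nonneg) auto
  qed
  have f_meas: "f \<theta> \<in> borel_measurable PX" for \<theta>
    unfolding f_def measurable_cong_sets[OF sets_PX refl]
    using M N by (intro measurable_trunc measurable_net) auto
  have f_bound: "\<bar>f \<theta> x\<bar> \<le> M" for \<theta> x unfolding f_def using M by (intro abs_trunc_le) auto
  define h where "h = (\<lambda>\<theta>. excess_loss \<alpha> f0 (f \<theta>))"
  have h_meas[measurable]: "h \<theta> \<in> borel_measurable Q" for \<theta>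
    unfolding h_def measurable_cong_sets[OF sets_Q refl] by (intro measurable_excess_loss f0 f_meas)
  have h_bound: "\<bar>h \<theta> z\<bar> \<le> 2 * M" if "z \<in> space Q" for \<theta> z
  proof -
    have "fst z \<in> space PX" using that by (auto simp: space_Q space_pair_measure)
    from f0(2)[OF this] f_bound[of \<theta> "fst z"] excess_loss_bound[OF \<alpha>, of f0 "f \<theta>" z]
    show ?thesis unfolding h_def by linarith
  qed
  have h_sq: "(h \<theta> z)\<^sup>2 \<le> 4 * M\<^sup>2" if "z \<in> space Q" for \<theta> z
    using power_mono[OF h_bound[OF that] abs_ge_zero, of \<theta> 2] by simp
  note moments = excess_loss_moments[OF PX cond plow \<alpha> quant _ f0 f_meas f_bound]
  have m1: "\<kappa> * v \<theta> \<le> (\<integral>z. h \<theta> z \<partial>Q)" "(\<integral>z. h \<theta> z \<partial>Q) \<le> pbar * v \<theta>" "(\<integral>z. (h \<theta> z)\<^sup>2 \<partial>Q) \<le> v \<theta>" for \<theta>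
    unfolding \<kappa>_def v_def Q_def h_def using M by (intro moments; simp)+
  have m4: "(\<integral>z. ((h \<theta> z)\<^sup>2)\<^sup>2 \<partial>Q) \<le> 4 * M\<^sup>2 * (\<integral>z. (h \<theta> z)\<^sup>2 \<partial>Q)" for \<theta>
  proof -
    have "(\<integral>z. ((h \<theta> z)\<^sup>2)\<^sup>2 \<partial>Q) \<le> (\<integral>z. 4 * M\<^sup>2 * (h \<theta> z)\<^sup>2 \<partial>Q)"
    proof (rule integral_mono')
      have "integrable Q (\<lambda>z. (h \<theta> z)\<^sup>2)"
        by (rule Q.integrable_const_bound[where B="4 * M\<^sup>2"]) (use h_sq in \<open>auto intro!: AE_I2\<close>)
      then show "integrable Q (\<lambda>z. 4 * M\<^sup>2 * (h \<theta> z)\<^sup>2)" by simp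
      show "((h \<theta> z)\<^sup>2)\<^sup>2 \<le> 4 * M\<^sup>2 * (h \<theta> z)\<^sup>2" if "z \<in> space Q" for z
        unfolding power2_eq_square[of "(h \<theta> z)\<^sup>2"] by (intro mult_right_mono h_sq that) auto
    qed auto
    then show ?thesis by simp
  qed
  obtain e :: "nat \<Rightarrow> nat \<times> nat \<times> nat \<Rightarrow> real" where
    e: "\<And>\<theta>. \<exists>r. \<forall>i\<in>param_index d L N. (\<lambda>m. e (r m) i) \<longlonglongrightarrow> \<theta> i"
    using rational_params[of d L N] by blast
  have cover: "\<exists>K :: nat \<Rightarrow> ((nat \<Rightarrow> real) \<times> real) set. finite (range K) \<and> real (card (range K)) \<le> exp H \<and>
      (\<forall>k k'. K k = K k' \<longrightarrow> (\<forall>i<2 * n. \<bar>h (e k) (\<omega> i) - h (e k') (\<omega> i)\<bar> \<le> 1 / real n))" for \<omega>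
  proof -
    \<comment> \<open>Covering the inputs is enough: for any noise value the excess loss is
      1-Lipschitz in the output of the network.\<close>
    have "card ((\<lambda>i. fst (\<omega> i)) ` {..<2 * n}) \<le> 2 * n" using card_image_le[of "{..<2 * n}"] by simp
    from network_cover[OF dim M _ this]
    obtain K :: "(nat \<times> nat \<times> nat \<Rightarrow> real) \<Rightarrow> ((nat \<Rightarrow> real) \<times> real) set" where
      K: "finite (range K)" "real (card (range K)) \<le> exp H"
        "\<And>\<theta> \<theta>' i. K \<theta> = K \<theta>' \<Longrightarrow> i < 2 * n \<Longrightarrow> \<bar>f \<theta> (fst (\<omega> i)) - f \<theta>' (fst (\<omega> i))\<bar> \<le> 1 / real n"
      unfolding H_def f_def by fastforce
    have sub: "range (\<lambda>k. K (e k)) \<subseteq> range K" by auto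
    show ?thesis
    proof (intro exI[of _ "\<lambda>k. K (e k)"] conjI allI impI)
      show "finite (range (\<lambda>k. K (e k)))" using sub K(1) by (rule finite_subset)
      show "real (card (range (\<lambda>k. K (e k)))) \<le> exp H" using card_mono[OF K(1) sub] K(2) by linarith
      show "\<bar>h (e k) (\<omega> i) - h (e k') (\<omega> i)\<bar> \<le> 1 / real n" if "K (e k) = K (e k')" "i < 2 * n" for k k' i
        using excess_loss_lipschitz[OF \<alpha>, of f0 "f (e k)" "\<omega> i" "f (e k')"] K(3)[OF that] unfolding h_def by linarith
    qed
  qed
  \<comment> \<open>Since \<open>h^2\<close> is at most \<open>4 * M^2\<close>, this makes
    \<open>c3 * h^4\<close> at most \<open>h^2 / 2\<close>, both for the population and for the
    sample.\<close>
  define c3 where "c3 = 1 / (8 * M\<^sup>2)"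
  define T1 where "T1 = 2 * (H + u) / (\<kappa> / 8) + real n * (1 / real n) * (2 + 4 * (\<kappa> / 8) * (2 * M))"
  \<comment> \<open>For the squares the covering radius becomes \<open>4 * M / n\<close>, as
    \<open>\<bar>h + h'\<bar>\<close> is at most \<open>4 * M\<close>, and the uniform bound becomes
    \<open>4 * M^2\<close>.\<close>
  define T3 where "T3 = 2 * (H + u) / c3 + real n * (4 * M / real n) * (2 + 4 * c3 * (4 * M\<^sup>2))"
  have c3: "0 < c3" using M by (simp add: c3_def)
  have "\<exists>A\<in>sets ?P. measure ?P A \<le> exp (- u) \<and> (\<forall>\<omega>\<in>space ?P - A. \<forall>k.
      real n * ((\<integral>z. h (e k) z \<partial>Q) - \<kappa> / 8 * (\<integral>z. (h (e k) z)\<^sup>2 \<partial>Q)) - (\<Sum>i<n. h (e k) (\<omega> i) + \<kappa> / 8 * (h (e k) (\<omega> i))\<^sup>2) \<le> T1)"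
    unfolding T1_def
    by (rule symmetrized_deviation[OF Q, where 'c="((nat \<Rightarrow> real) \<times> real) set"])
      (use \<kappa> M n h_bound cover in auto)
  then obtain A1 where A1: "A1 \<in> sets ?P" "measure ?P A1 \<le> exp (- u)" "\<And>\<omega> k. \<omega> \<in> space ?P - A1 \<Longrightarrow>
      real n * ((\<integral>z. h (e k) z \<partial>Q) - \<kappa> / 8 * (\<integral>z. (h (e k) z)\<^sup>2 \<partial>Q)) - (\<Sum>i<n. h (e k) (\<omega> i) + \<kappa> / 8 * (h (e k) (\<omega> i))\<^sup>2) \<le> T1"
    by blast
  have "\<exists>A\<in>sets ?P. measure ?P A \<le> exp (- u) \<and> (\<forall>\<omega>\<in>space ?P - A. \<forall>k.
      real n * ((\<integral>z. - h (e k) z \<partial>Q) - \<kappa> / 8 * (\<integral>z. (- h (e k) z)\<^sup>2 \<partial>Q)) - (\<Sum>i<n. - h (e k) (\<omega> i) + \<kappa> / 8 * (- h (e k) (\<omega> i))\<^sup>2) \<le> T1)"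
    unfolding T1_def
  proof (rule symmetrized_deviation[OF Q, where 'c="((nat \<Rightarrow> real) \<times> real) set"])
    fix \<omega> :: "nat \<Rightarrow> (nat \<Rightarrow> real) \<times> real"
    show "\<exists>K :: nat \<Rightarrow> ((nat \<Rightarrow> real) \<times> real) set. finite (range K) \<and> real (card (range K)) \<le> exp H \<and>
      (\<forall>k k'. K k = K k' \<longrightarrow> (\<forall>i<2 * n. \<bar>- h (e k) (\<omega> i) - - h (e k') (\<omega> i)\<bar> \<le> 1 / real n))"
      using cover[of \<omega>] by (simp add: abs_minus_commute)
  qed (use \<kappa> M n h_bound in auto)
  then obtain A2 where A2: "A2 \<in> sets ?P" "measure ?P A2 \<le> exp (- u)" "\<And>\<omega> k. \<omega> \<in> space ?P - A2 \<Longrightarrow>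
      real n * ((\<integral>z. - h (e k) z \<partial>Q) - \<kappa> / 8 * (\<integral>z. (- h (e k) z)\<^sup>2 \<partial>Q)) - (\<Sum>i<n. - h (e k) (\<omega> i) + \<kappa> / 8 * (- h (e k) (\<omega> i))\<^sup>2) \<le> T1"
    by blast
  have "\<exists>A\<in>sets ?P. measure ?P A \<le> exp (- u) \<and> (\<forall>\<omega>\<in>space ?P - A. \<forall>k.
      real n * ((\<integral>z. - (h (e k) z)\<^sup>2 \<partial>Q) - c3 * (\<integral>z. (- (h (e k) z)\<^sup>2)\<^sup>2 \<partial>Q)) - (\<Sum>i<n. - (h (e k) (\<omega> i))\<^sup>2 + c3 * (- (h (e k) (\<omega> i))\<^sup>2)\<^sup>2) \<le> T3)"
    unfolding T3_def
  proof (rule symmetrized_deviation[OF Q, where 'c="((nat \<Rightarrow> real) \<times> real) set"])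
    fix \<omega> assume \<omega>: "\<omega> \<in> space (PiM {..<2 * n} (\<lambda>_. Q))"
    obtain K :: "nat \<Rightarrow> ((nat \<Rightarrow> real) \<times> real) set" where K: "finite (range K)" "real (card (range K)) \<le> exp H"
      "\<And>k k' i. K k = K k' \<Longrightarrow> i < 2 * n \<Longrightarrow> \<bar>h (e k) (\<omega> i) - h (e k') (\<omega> i)\<bar> \<le> 1 / real n"
      using cover[of \<omega>] by blast
    have "\<bar>- (h (e k) (\<omega> i))\<^sup>2 - - (h (e k') (\<omega> i))\<^sup>2\<bar> \<le> 4 * M / real n" if "K k = K k'" "i < 2 * n" for k k' i
    proof -
      have "\<omega> i \<in> space Q" using \<omega> that by (auto simp: space_PiM PiE_iff)
      note b = h_bound[OF this, of "e k"] h_bound[OF this, of "e k'"]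
      have "\<bar>- (h (e k) (\<omega> i))\<^sup>2 - - (h (e k') (\<omega> i))\<^sup>2\<bar> = \<bar>h (e k) (\<omega> i) - h (e k') (\<omega> i)\<bar> * \<bar>h (e k) (\<omega> i) + h (e k') (\<omega> i)\<bar>"
        unfolding abs_mult[symmetric] by (subst abs_minus_cancel[symmetric]) (simp add: power2_eq_square algebra_simps)
      also have "\<dots> \<le> 1 / real n * (4 * M)" using K(3)[OF that] b by (intro mult_mono) auto
      finally show ?thesis by simp
    qed
    then show "\<exists>K :: nat \<Rightarrow> ((nat \<Rightarrow> real) \<times> real) set. finite (range K) \<and> real (card (range K)) \<le> exp H \<and>
      (\<forall>k k'. K k = K k' \<longrightarrow> (\<forall>i<2 * n. \<bar>- (h (e k) (\<omega> i))\<^sup>2 - - (h (e k') (\<omega> i))\<^sup>2\<bar> \<le> 4 * M / real n))"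
      using K(1,2) by blast
  qed (use c3 M n h_sq in auto)
  then obtain A3 where A3: "A3 \<in> sets ?P" "measure ?P A3 \<le> exp (- u)" "\<And>\<omega> k. \<omega> \<in> space ?P - A3 \<Longrightarrow>
      real n * ((\<integral>z. - (h (e k) z)\<^sup>2 \<partial>Q) - c3 * (\<integral>z. (- (h (e k) z)\<^sup>2)\<^sup>2 \<partial>Q)) - (\<Sum>i<n. - (h (e k) (\<omega> i))\<^sup>2 + c3 * (- (h (e k) (\<omega> i))\<^sup>2)\<^sup>2) \<le> T3"
    by blast
  have T: "T1 + \<kappa> / 4 * T3 \<le> T"
  proof -
    have "T1 = 16 / \<kappa> * (H + u) + (2 + \<kappa> * M)" using n by (simp add: T1_def)
    moreover have "T3 = 16 * M\<^sup>2 * (H + u) + 16 * M" using n M by (simp add: T3_def c3_def)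
    ultimately have "T1 + \<kappa> / 4 * T3 = (16 / \<kappa> + 4 * \<kappa> * M\<^sup>2) * (H + u) + (2 + 5 * \<kappa> * M) * 1"
      by (simp add: algebra_simps)
    also have "\<dots> \<le> (16 / \<kappa> + 4 * \<kappa> * M\<^sup>2) * (H + u) + (2 + 5 * \<kappa> * M) * (H + u)"
      \<comment> \<open>The additive constants left by the mesh of the cover are absorbed here,
        because \<open>H + u\<close> is at least 1.\<close>
      using u H \<kappa> M by (intro add_left_mono mult_left_mono) auto
    also have "\<dots> = T" by (simp add: T_def algebra_simps)
    finally show ?thesis .
  qed
  have countable_case: "\<kappa> / 2 * v (e k) * real n \<le> (\<Sum>i<n. h (e k) (s i)) + T \<and>
       (\<Sum>i<n. h (e k) (s i)) \<le> (pbar + \<kappa> / 2) * v (e k) * real n + T"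
    if s: "s \<in> space ?P - (A1 \<union> A2 \<union> A3)" for s k
  proof -
    have sQ: "s i \<in> space Q" if "i < n" for i using s that by (auto simp: space_PiM PiE_iff)
    have S4: "c3 * (\<Sum>i<n. ((h (e k) (s i))\<^sup>2)\<^sup>2) \<le> (\<Sum>i<n. (h (e k) (s i))\<^sup>2) / 2"
      unfolding sum_distrib_left sum_divide_distrib
    proof (intro sum_mono)
      fix i assume "i \<in> {..<n}"
      then have "((h (e k) (s i))\<^sup>2)\<^sup>2 \<le> 4 * M\<^sup>2 * (h (e k) (s i))\<^sup>2"
        unfolding power2_eq_square[of "(h (e k) (s i))\<^sup>2"] by (intro mult_right_mono h_sq sQ) auto
      then have "c3 * ((h (e k) (s i))\<^sup>2)\<^sup>2 \<le> c3 * (4 * M\<^sup>2 * (h (e k) (s i))\<^sup>2)" using c3 by simp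
      then show "c3 * ((h (e k) (s i))\<^sup>2)\<^sup>2 \<le> (h (e k) (s i))\<^sup>2 / 2" using M by (simp add: c3_def)
    qed
    have W4: "c3 * (\<integral>z. ((h (e k) z)\<^sup>2)\<^sup>2 \<partial>Q) \<le> (\<integral>z. (h (e k) z)\<^sup>2 \<partial>Q) / 2"
    proof -
      have "c3 * (\<integral>z. ((h (e k) z)\<^sup>2)\<^sup>2 \<partial>Q) \<le> c3 * (4 * M\<^sup>2 * (\<integral>z. (h (e k) z)\<^sup>2 \<partial>Q))"
        using m4 c3 by (intro mult_left_mono) auto
      also have "\<dots> = (\<integral>z. (h (e k) z)\<^sup>2 \<partial>Q) / 2" using M by (simp add: c3_def)
      finally show ?thesis .
    qed
    let ?S = "\<Sum>i<n. h (e k) (s i)" and ?S2 = "\<Sum>i<n. (h (e k) (s i))\<^sup>2" and ?S4 = "\<Sum>i<n. ((h (e k) (s i))\<^sup>2)\<^sup>2"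
    let ?a = "\<integral>z. h (e k) z \<partial>Q" and ?w = "\<integral>z. (h (e k) z)\<^sup>2 \<partial>Q" and ?w4 = "\<integral>z. ((h (e k) z)\<^sup>2)\<^sup>2 \<partial>Q"
    have E1: "real n * (?a - \<kappa> / 8 * ?w) - (?S + \<kappa> / 8 * ?S2) \<le> T1"
      using A1(3)[of s k] s by (simp only: sum.distrib sum_distrib_left[symmetric]) auto
    have E2: "real n * (- ?a - \<kappa> / 8 * ?w) - (- ?S + \<kappa> / 8 * ?S2) \<le> T1"
      using A2(3)[of s k] s by (simp only: sum.distrib sum_distrib_left[symmetric] sum_negf power2_minus integral_minus) auto
    have E3: "real n * (- ?w - c3 * ?w4) - (- ?S2 + c3 * ?S4) \<le> T3"
      using A3(3)[of s k] s by (simp only: sum.distrib sum_distrib_left[symmetric] sum_negf power2_minus integral_minus) auto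
    note dev = deviation_to_risk[OF E1 E2 E3 W4 S4 _ _ m1]
    have "\<kappa> / 2 * v (e k) * real n \<le> ?S + (T1 + \<kappa> / 4 * T3)" "?S \<le> (pbar + \<kappa> / 2) * v (e k) * real n + (T1 + \<kappa> / 4 * T3)"
      using \<kappa> by (intro dev; simp)+
    then show ?thesis using T by linarith
  qed
  have all: "\<kappa> / 2 * v \<theta> * real n \<le> (\<Sum>i<n. h \<theta> (s i)) + T \<and>
       (\<Sum>i<n. h \<theta> (s i)) \<le> (pbar + \<kappa> / 2) * v \<theta> * real n + T"
    if s: "s \<in> space ?P - (A1 \<union> A2 \<union> A3)" for s \<theta>
  proof -
    obtain r where r: "\<And>i. i \<in> param_index d L N \<Longrightarrow> (\<lambda>m. e (r m) i) \<longlonglongrightarrow> \<theta> i" using e[of \<theta>] by blast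
    have f_lim: "(\<lambda>m. f (e (r m)) x) \<longlonglongrightarrow> f \<theta> x" for x
      unfolding f_def using M N r by (intro tendsto_trunc tendsto_net) auto
    have S_lim: "(\<lambda>m. \<Sum>i<n. h (e (r m)) (s i)) \<longlonglongrightarrow> (\<Sum>i<n. h \<theta> (s i))"
      unfolding h_def by (intro tendsto_sum tendsto_excess_loss f_lim)
    have v_lim: "(\<lambda>m. v (e (r m))) \<longlonglongrightarrow> v \<theta>"
      unfolding v_def
    proof (rule integral_dominated_convergence[where w="\<lambda>_. (2 * M)\<^sup>2"])
      show "AE x in PX. norm ((f (e (r m)) x - f0 x)\<^sup>2) \<le> (2 * M)\<^sup>2" for m
      proof (rule AE_I2)
        fix x assume "x \<in> space PX"
        then have "\<bar>f (e (r m)) x - f0 x\<bar> \<le> 2 * M" using f_bound[of "e (r m)" x] f0(2)[of x] by linarith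
        from power_mono[OF this abs_ge_zero, of 2] show "norm ((f (e (r m)) x - f0 x)\<^sup>2) \<le> (2 * M)\<^sup>2" by simp
      qed
      show "AE x in PX. (\<lambda>m. (f (e (r m)) x - f0 x)\<^sup>2) \<longlonglongrightarrow> (f \<theta> x - f0 x)\<^sup>2"
        by (intro AE_I2 tendsto_intros f_lim)
    qed (use f_meas f0 in auto)
    have "\<kappa> / 2 * v \<theta> * real n \<le> (\<Sum>i<n. h \<theta> (s i)) + T"
      by (rule LIMSEQ_le[of "\<lambda>m. \<kappa> / 2 * v (e (r m)) * real n" _ "\<lambda>m. (\<Sum>i<n. h (e (r m)) (s i)) + T"])
        (use countable_case[OF s] in \<open>auto intro!: tendsto_intros S_lim v_lim\<close>)
    moreover have "(\<Sum>i<n. h \<theta> (s i)) \<le> (pbar + \<kappa> / 2) * v \<theta> * real n + T"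
      by (rule LIMSEQ_le[of "\<lambda>m. \<Sum>i<n. h (e (r m)) (s i)" _ "\<lambda>m. (pbar + \<kappa> / 2) * v (e (r m)) * real n + T"])
        (use countable_case[OF s] in \<open>auto intro!: tendsto_intros S_lim v_lim\<close>)
    ultimately show ?thesis ..
  qed
  have "measure ?P (A1 \<union> A2 \<union> A3) \<le> measure ?P (A1 \<union> A2) + measure ?P A3"
    using A1 A2 A3 by (intro measure_Un_le) auto
  also have "measure ?P (A1 \<union> A2) \<le> measure ?P A1 + measure ?P A2"
    using A1 A2 by (intro measure_Un_le) auto
  finally have "measure ?P (A1 \<union> A2 \<union> A3) \<le> 3 * exp (- u)" using A1(2) A2(2) A3(2) by linarith
  then show ?thesis
    unfolding sample_law_def Q_def[symmetric] using A1(1) A2(1) A3(1) all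
    by (intro bexI[of _ "A1 \<union> A2 \<union> A3"] conjI) (auto simp: h_def)
qed

section \<open>From the uniform bounds to the minimizer\<close>

lemma L2dist_nonneg: "0 \<le> L2dist PX f g"
  by (simp add: L2dist_def)

lemma L2dist_power2: "(L2dist PX f g)\<^sup>2 = (\<integral>x. (f x - g x)\<^sup>2 \<partial>PX)"
  by (simp add: L2dist_def)

text \<open>The infimum defining \<open>delta_a\<close> may not be attained, so the comparator is
  only nearly optimal; the slack will be \<open>sqrt (u / n)\<close>, a term already present in the
  rate.\<close>

lemma near_delta_a:
  assumes "F \<noteq> {}" "0 < \<delta>"
  obtains f where "f \<in> F" "L2dist PX f f0 < delta_a PX F f0 + \<delta>"
proof -
  have "(INF f\<in>F. L2dist PX f f0) < delta_a PX F f0 + \<delta>" using assms by (simp add: delta_a_def)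
  then obtain y where "y \<in> (\<lambda>f. L2dist PX f f0) ` F" "y < delta_a PX F f0 + \<delta>"
    using cInf_lessD[of "(\<lambda>f. L2dist PX f f0) ` F"] assms(1) by blast
  then show ?thesis using that by blast
qed

lemma delta_a_nonneg: "F \<noteq> {} \<Longrightarrow> 0 \<le> delta_a PX F f0"
  unfolding delta_a_def by (intro cINF_greatest L2dist_nonneg)

text \<open>The factor of \<open>risk_arithmetic\<close>, with \<open>K\<close> the coefficient of
  \<open>H + u\<close> in the deviation term and \<open>c\<close> that of
  \<open>n * delta_s^2\<close> in \<open>H\<close>. Its arguments show on what \<open>c4\<close>
  depends.\<close>

definition erm_const :: "real \<Rightarrow> real \<Rightarrow> real \<Rightarrow> real \<Rightarrow> real" where
  "erm_const M pbar plow l0 = (let \<kappa> = curvature plow l0 M in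
     2 / \<kappa> * (\<bar>pbar\<bar> + \<kappa> / 2 + 2 * (16 / \<kappa> + 2 + 5 * \<kappa> * M + 4 * \<kappa> * M\<^sup>2) * (8 * (ln (81 * M) + 6) + 1)))"

lemma erm_const_nonneg:
  assumes "1 \<le> M" "0 < plow" shows "0 \<le> erm_const M pbar plow l0"
proof -
  have "0 \<le> ln (81 * M)" using assms by (intro ln_ge_zero) auto
  moreover have "0 < curvature plow l0 M" using assms by (intro curvature_pos) auto
  ultimately show ?thesis using assms unfolding erm_const_def Let_def by simp
qed

text \<open>Chain minimizer, optimality, comparator, and divide by \<open>n\<close>; then
  \<open>ds^2\<close>, \<open>w\<close> and \<open>u / n\<close> are each at most the square of the
  sum of the three rates.\<close>

lemma risk_arithmetic:
  fixes \<kappa> v w n S S' K c ds da u :: real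
  assumes "0 < \<kappa>" "0 < n" "0 \<le> K" "0 \<le> c" "0 \<le> ds" "0 \<le> da" "0 \<le> u"
    and est: "\<kappa> / 2 * v * n \<le> S + K * (c * (n * ds\<^sup>2) + u)"
    and opt: "S \<le> S'" and cmp: "S' \<le> (pbar + \<kappa> / 2) * w * n + K * (c * (n * ds\<^sup>2) + u)"
    and w: "0 \<le> w" "w \<le> (da + sqrt (u / n))\<^sup>2"
  shows "v \<le> 2 / \<kappa> * (\<bar>pbar\<bar> + \<kappa> / 2 + 2 * K * (c + 1)) * (ds + da + sqrt (u / n))\<^sup>2"
proof -
  define r where "r = ds + da + sqrt (u / n)"
  have un: "0 \<le> u / n" using assms by simp
  have wr: "w \<le> r\<^sup>2"
  proof -
    have "0 \<le> sqrt (u / n)" using un by simp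
    then have "(da + sqrt (u / n))\<^sup>2 \<le> r\<^sup>2" using assms(5,6) by (intro power_mono) (auto simp: r_def)
    with w(2) show ?thesis by simp
  qed
  have dr: "ds\<^sup>2 \<le> r\<^sup>2" using un assms by (intro power_mono) (auto simp: r_def)
  have ur: "u / n \<le> r\<^sup>2"
    using power_mono[of "sqrt (u / n)" r 2] un assms by (simp add: r_def)
  have "\<kappa> / 2 * v * n \<le> (pbar + \<kappa> / 2) * w * n + 2 * (K * (c * (n * ds\<^sup>2) + u))"
    using est opt cmp by linarith
  also have "\<dots> = ((pbar + \<kappa> / 2) * w + 2 * (K * (c * ds\<^sup>2 + u / n))) * n"
    using assms(2) by (simp add: field_simps)
  finally have "\<kappa> / 2 * v \<le> (pbar + \<kappa> / 2) * w + 2 * (K * (c * ds\<^sup>2 + u / n))"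
    using assms(2) by simp
  also have "\<dots> \<le> (\<bar>pbar\<bar> + \<kappa> / 2) * r\<^sup>2 + 2 * (K * (c * r\<^sup>2 + r\<^sup>2))"
  proof (intro add_mono mult_left_mono dr ur)
    have "(pbar + \<kappa> / 2) * w \<le> (\<bar>pbar\<bar> + \<kappa> / 2) * w" using w(1) by (intro mult_right_mono) auto
    also have "\<dots> \<le> (\<bar>pbar\<bar> + \<kappa> / 2) * r\<^sup>2" using wr assms(1) by (intro mult_left_mono) auto
    finally show "(pbar + \<kappa> / 2) * w \<le> (\<bar>pbar\<bar> + \<kappa> / 2) * r\<^sup>2" .
  qed (use assms in auto)
  also have "\<dots> = (\<bar>pbar\<bar> + \<kappa> / 2 + 2 * K * (c + 1)) * r\<^sup>2" by (simp add: algebra_simps)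
  finally have "2 / \<kappa> * (\<kappa> / 2 * v) \<le> 2 / \<kappa> * ((\<bar>pbar\<bar> + \<kappa> / 2 + 2 * K * (c + 1)) * r\<^sup>2)"
    using assms(1) by (intro mult_left_mono) auto
  moreover have "2 / \<kappa> * (\<kappa> / 2 * v) = v" using assms(1) by simp
  ultimately show ?thesis by (simp only: r_def mult.assoc)
qed

text \<open>\<open>f0\<close> is bounded only on the unit cube, so it is first replaced by its truncation; the samples
  outside the cube form a null set, which is added to the exceptional event.\<close>

lemma erm_error_bound:
  fixes d L N n :: nat and \<alpha> u M0 pbar plow l0 :: real and PX :: "(nat \<Rightarrow> real) measure" and p f0 fhat
  assumes M0: "1 \<le> M0" and plow: "0 < plow"
    and dim: "1 \<le> d" "3 \<le> L" "3 \<le> N" "3 \<le> n" and \<alpha>: "0 < \<alpha>" "\<alpha> < 1"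
    and PX: "prob_space PX" and sets_PX: "sets PX = sets (PiM {..<d} (\<lambda>_. borel))"
    and cube: "AE x in PX. x \<in> unit_cube d"
    and f0: "f0 \<in> borel_measurable PX" "\<forall>x\<in>unit_cube d. \<bar>f0 x\<bar> \<le> M0"
    and cond: "cond_density_condition PX p pbar plow l0"
    and quant: "AE x in PX. (LINT e:{..0}|lborel. p x e) = \<alpha>" and u: "1 \<le> u"
    and erm: "\<forall>s\<in>space (sample_law PX p n). fhat s \<in> F_DNN_trunc d L N M0 \<and>
        (\<forall>g\<in>F_DNN_trunc d L N M0. emp_risk \<alpha> n f0 (fhat s) s \<le> emp_risk \<alpha> n f0 g s)"
  shows "\<exists>A\<in>sets (sample_law PX p n).
    {s\<in>space (sample_law PX p n).
       (sqrt (erm_const M0 pbar plow l0) + 1) *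
         (delta_s d L N n + delta_a PX (F_DNN_trunc d L N M0) f0 + sqrt (u / real n))
         \<le> L2dist PX (fhat s) f0} \<subseteq> A \<and>
    measure (sample_law PX p n) A \<le> 3 * exp (- u)"
proof -
  define C3 where "C3 = erm_const M0 pbar plow l0"
  interpret PX: prob_space PX by fact
  have Q: "prob_space (joint_law PX p)" by (rule prob_space_joint_law[OF PX cond])
  interpret P: prob_space "sample_law PX p n" unfolding sample_law_def by (intro prob_space_PiM Q)
  let ?F = "F_DNN_trunc d L N M0"
  define f where "f = (\<lambda>\<theta> x. trunc M0 (net d L N \<theta> x))"
  have F_eq: "?F = range f" by (auto simp: F_DNN_trunc_def F_DNN_eq f_def)
  define g0 where "g0 = (\<lambda>x. trunc M0 (f0 x))"
  have g0_eq: "g0 x = f0 x" if "x \<in> unit_cube d" for x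
    using f0(2) that M0 by (auto simp: g0_def trunc_eq)
  have g0: "g0 \<in> borel_measurable PX" "\<And>x. \<bar>g0 x\<bar> \<le> M0"
    unfolding g0_def using M0 f0(1) by (auto intro: measurable_trunc abs_trunc_le)
  have f_meas: "f \<theta> \<in> borel_measurable PX" for \<theta>
    unfolding f_def measurable_cong_sets[OF sets_PX refl]
    using M0 dim by (intro measurable_trunc measurable_net) auto
  have sq_eq: "(\<integral>x. (f \<theta> x - g0 x)\<^sup>2 \<partial>PX) = (L2dist PX (f \<theta>) f0)\<^sup>2" for \<theta>
    unfolding L2dist_power2
    by (rule integral_cong_AE) (use cube g0 f0(1) f_meas in \<open>auto elim: eventually_mono simp: g0_eq\<close>)
  define \<kappa> where "\<kappa> = curvature plow l0 M0"
  define K where "K = 16 / \<kappa> + 2 + 5 * \<kappa> * M0 + 4 * \<kappa> * M0\<^sup>2"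
  define c where "c = 8 * (ln (81 * M0) + 6)"
  have \<kappa>: "0 < \<kappa>" unfolding \<kappa>_def using M0 plow by (intro curvature_pos) auto
  have K: "0 \<le> K" unfolding K_def using \<kappa> M0 by simp
  have c: "0 \<le> c"
  proof -
    have "0 \<le> ln (81 * M0)" using M0 by (intro ln_ge_zero) auto
    then show ?thesis by (simp add: c_def)
  qed
  have C3_eq: "C3 = 2 / \<kappa> * (\<bar>pbar\<bar> + \<kappa> / 2 + 2 * K * (c + 1))"
    by (simp add: C3_def erm_const_def Let_def \<kappa>_def K_def c_def)
  have "1 \<le> L" using dim by simp
  have "\<exists>A\<in>sets (sample_law PX p n). measure (sample_law PX p n) A \<le> 3 * exp (- u) \<and>
    (\<forall>s\<in>space (sample_law PX p n) - A. \<forall>\<theta>.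
      \<kappa> / 2 * (\<integral>x. (f \<theta> x - g0 x)\<^sup>2 \<partial>PX) * real n \<le> (\<Sum>i<n. excess_loss \<alpha> g0 (f \<theta>) (s i)) + K * (c * (real n * (delta_s d L N n)\<^sup>2) + u) \<and>
      (\<Sum>i<n. excess_loss \<alpha> g0 (f \<theta>) (s i)) \<le> (pbar + \<kappa> / 2) * (\<integral>x. (f \<theta> x - g0 x)\<^sup>2 \<partial>PX) * real n + K * (c * (real n * (delta_s d L N n)\<^sup>2) + u))"
    unfolding f_def \<kappa>_def K_def c_def
    by (rule uniform_excess_risk_bound[OF dim(1) \<open>1 \<le> L\<close> dim(3,4) M0 \<alpha> PX sets_PX g0 cond plow quant u])
  then obtain A where A: "A \<in> sets (sample_law PX p n)" "measure (sample_law PX p n) A \<le> 3 * exp (- u)"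
    and dev: "\<And>s \<theta>. s \<in> space (sample_law PX p n) - A \<Longrightarrow>
      \<kappa> / 2 * (L2dist PX (f \<theta>) f0)\<^sup>2 * real n \<le> (\<Sum>i<n. excess_loss \<alpha> g0 (f \<theta>) (s i)) + K * (c * (real n * (delta_s d L N n)\<^sup>2) + u) \<and>
      (\<Sum>i<n. excess_loss \<alpha> g0 (f \<theta>) (s i)) \<le> (pbar + \<kappa> / 2) * (L2dist PX (f \<theta>) f0)\<^sup>2 * real n + K * (c * (real n * (delta_s d L N n)\<^sup>2) + u)"
    unfolding sq_eq by blast
  have "unit_cube d \<in> sets PX"
    unfolding unit_cube_def sets_PX by (intro sets_PiM_I_finite) auto
  then have "AE z in joint_law PX p. fst z \<in> unit_cube d" by (rule AE_joint_law[OF PX cond _ cube])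
  then have "AE s in sample_law PX p n. fst (s i) \<in> unit_cube d" if "i < n" for i
    unfolding sample_law_def using that Q by (intro AE_PiM_component) auto
  then have "AE s in sample_law PX p n. \<forall>i\<in>{..<n}. fst (s i) \<in> unit_cube d"
    by (intro AE_finite_allI) auto
  then obtain B where B: "{s \<in> space (sample_law PX p n). \<not> (\<forall>i\<in>{..<n}. fst (s i) \<in> unit_cube d)} \<subseteq> B"
    "B \<in> sets (sample_law PX p n)" "emeasure (sample_law PX p n) B = 0"
    by (auto elim!: AE_E)
  have "measure (sample_law PX p n) (A \<union> B) \<le> measure (sample_law PX p n) A + measure (sample_law PX p n) B"
    using A B by (intro measure_Un_le) auto
  also have "measure (sample_law PX p n) B = 0" using B(3) by (simp add: measure_def)
  finally have AB: "measure (sample_law PX p n) (A \<union> B) \<le> 3 * exp (- u)" using A(2) by simp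
  let ?r = "delta_s d L N n + delta_a PX ?F f0 + sqrt (u / real n)"
  have n: "0 < real n" using dim by simp
  have ds: "0 \<le> delta_s d L N n"
  proof -
    have "1 \<le> d * L * N" using dim by auto
    then have "0 \<le> ln (real (d * L * N))" by (intro ln_ge_zero) (simp only: real_of_nat_ge_one_iff)
    then show ?thesis using n dim by (simp add: delta_s_def)
  qed
  have da: "0 \<le> delta_a PX ?F f0" by (rule delta_a_nonneg) (simp add: F_eq)
  have r: "0 < ?r" using ds da n u by (intro add_nonneg_pos) auto
  \<comment> \<open>The error event is defined by a weak inequality, so a strict bound is required
    off the exceptional set. Adding 1 to \<open>sqrt C3\<close> provides it, as \<open>?r\<close> is
    positive.\<close>
  have "L2dist PX (fhat s) f0 < (sqrt C3 + 1) * ?r" if s: "s \<in> space (sample_law PX p n)" "s \<notin> A" "s \<notin> B" for s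
  proof -
    obtain \<theta> where \<theta>: "fhat s = f \<theta>" using erm s(1) F_eq by blast
    have "0 < sqrt (u / real n)" using n u by simp
    then obtain g where g: "g \<in> ?F" "L2dist PX g f0 < delta_a PX ?F f0 + sqrt (u / real n)"
      using near_delta_a[of ?F _ PX f0] F_eq by blast
    then obtain \<eta> where \<eta>: "g = f \<eta>" using F_eq by blast
    have in_cube: "fst (s i) \<in> unit_cube d" if "i < n" for i using B(1) s that by blast
    \<comment> \<open>The subtracted sum is free of \<open>h\<close>, so minimizing the empirical
      risk and minimizing the summed excess loss are the same problem.\<close>
    have risk: "(\<Sum>i<n. excess_loss \<alpha> g0 h (s i)) = real n * emp_risk \<alpha> n f0 h s - (\<Sum>i<n. check_loss \<alpha> (snd (s i)))" for h
    proof -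
      have "(\<Sum>i<n. excess_loss \<alpha> g0 h (s i)) = (\<Sum>i<n. check_loss \<alpha> (f0 (fst (s i)) + snd (s i) - h (fst (s i))) - check_loss \<alpha> (snd (s i)))"
        unfolding excess_loss_def by (intro sum.cong refl) (simp add: g0_eq in_cube algebra_simps)
      then show ?thesis using n by (simp add: sum_subtractf emp_risk_def)
    qed
    have "emp_risk \<alpha> n f0 (f \<theta>) s \<le> emp_risk \<alpha> n f0 (f \<eta>) s" using erm s(1) g(1) \<theta> \<eta> by auto
    then have opt: "(\<Sum>i<n. excess_loss \<alpha> g0 (f \<theta>) (s i)) \<le> (\<Sum>i<n. excess_loss \<alpha> g0 (f \<eta>) (s i))"
      unfolding risk using n by simp
    have "(L2dist PX (f \<eta>) f0)\<^sup>2 \<le> (delta_a PX ?F f0 + sqrt (u / real n))\<^sup>2"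
      using g(2) \<eta> by (intro power_mono L2dist_nonneg) auto
    then have "(L2dist PX (f \<theta>) f0)\<^sup>2 \<le> C3 * ?r\<^sup>2"
      unfolding C3_eq using dev[of s \<theta>] dev[of s \<eta>] s u
      by (intro risk_arithmetic[OF \<kappa> n K c ds da _ _ opt]) auto
    then have "L2dist PX (f \<theta>) f0 \<le> sqrt (C3 * ?r\<^sup>2)" by (rule real_le_rsqrt)
    also have "\<dots> = sqrt C3 * ?r" using r by (simp add: real_sqrt_mult)
    also have "\<dots> < (sqrt C3 + 1) * ?r" using r by (simp add: distrib_right)
    finally show ?thesis by (simp add: \<theta>)
  qed
  then have "{s\<in>space (sample_law PX p n). (sqrt C3 + 1) * ?r \<le> L2dist PX (fhat s) f0} \<subseteq> A \<union> B"
    by (auto simp: not_less[symmetric])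
  with AB A(1) B(2) show ?thesis unfolding C3_def by (intro bexI[of _ "A \<union> B"] conjI) auto
qed

text \<open>The estimator is an arbitrary selection of minimizers, with no measurability in the
  sample; the probability bound is therefore expressed by a measurable event \<open>A\<close> that
  contains the error event.\<close>

theorem theorem3p1:
  shows "\<exists>C>0. \<forall>M0 pbar plow l0 :: real. 1 \<le> M0 \<longrightarrow> 0 < plow \<longrightarrow>
    (\<exists>c4>0. \<forall>(d::nat) (L::nat) (N::nat) (n::nat) (\<alpha>::real) (PX :: (nat \<Rightarrow> real) measure)
        (p :: (nat \<Rightarrow> real) \<Rightarrow> real \<Rightarrow> real) (f0 :: (nat \<Rightarrow> real) \<Rightarrow> real) (u::real)
        (fhat :: (nat \<Rightarrow> (nat \<Rightarrow> real) \<times> real) \<Rightarrow> (nat \<Rightarrow> real) \<Rightarrow> real).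
      1 \<le> d \<longrightarrow> 3 \<le> L \<longrightarrow> 3 \<le> N \<longrightarrow> 3 \<le> n \<longrightarrow> 0 < \<alpha> \<longrightarrow> \<alpha> < 1 \<longrightarrow>
      prob_space PX \<longrightarrow> sets PX = sets (PiM {..<d} (\<lambda>_. borel)) \<longrightarrow>
      (AE x in PX. x \<in> unit_cube d) \<longrightarrow>
      f0 \<in> borel_measurable PX \<longrightarrow> (\<forall>x\<in>unit_cube d. \<bar>f0 x\<bar> \<le> M0) \<longrightarrow>
      cond_density_condition PX p pbar plow l0 \<longrightarrow>
      (AE x in PX. (LINT e:{..0}|lborel. p x e) = \<alpha>) \<longrightarrow>
      1 \<le> u \<longrightarrow>
      (\<forall>s\<in>space (sample_law PX p n).
          fhat s \<in> F_DNN_trunc d L N M0 \<and>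
          (\<forall>g\<in>F_DNN_trunc d L N M0. emp_risk \<alpha> n f0 (fhat s) s \<le> emp_risk \<alpha> n f0 g s)) \<longrightarrow>
      (\<exists>A\<in>sets (sample_law PX p n).
          {s\<in>space (sample_law PX p n).
             c4 * (delta_s d L N n + delta_a PX (F_DNN_trunc d L N M0) f0 + sqrt (u / real n))
               \<le> L2dist PX (fhat s) f0} \<subseteq> A \<and>
          measure (sample_law PX p n) A \<le> C * exp (- u)))"
  apply (rule exI[of _ 3], intro conjI allI impI exI)
    apply simp
   \<comment> \<open>Positivity of \<open>c4\<close> waits until unification with
     \<open>erm_error_bound\<close> has fixed it as
     \<open>sqrt (erm_const M0 pbar plow l0) + 1\<close>.\<close>
   defer
   apply (rule erm_error_bound; assumption)
  apply (simp add: add_nonneg_pos erm_const_nonneg)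
  done

end
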